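(* Let $\mathcal X:y^n=f(x)$ be a superelliptic curve over $\mathbb F_q$ as in the context, and let $s\in W(\mathcal X)$. Then $$\operatorname{Hull}(\mathcal C_s)=C_L\bigl(D,\mu(s)D_\infty-E\bigr)\cong C_L\bigl(D,\nu(s)D_\infty\bigr),$$ where the isomorphism is the monomial equivalence given by the diagonal matrix $\operatorname{diag}(e_\Delta(P))_{P}$ (over the points $P$ of $D$), which carries $C_L(D,\nu(s)D_\infty)$ onto $C_L(D,\mu(s)D_\infty-E)$, and $$\dim\operatorname{Hull}(\mathcal C_s)=c\,\nu(s)+1-g_{\mathcal X}=c\,\mu(s)-n\delta+1-g_{\mathcal X}.$$ In particular $\dim\operatorname{Hull}(\mathcal C_s)\ge g_{\mathcal X}\ge1$, so no $\mathcal C_s$ with $s\in W(\mathcal X)$ is LCD. The function $s\mapsto\dim\operatorname{Hull}(\mathcal C_s)$ is affine of slope $c$ on $W(\mathcal X)\cap[1,M/2]$ and of slope $-c$ on $W(\mathcal X)\cap[M/2,\infty)$, with maximum $c\lfloor M/2\rfloor-n\delta+1-g_{\mathcal X}$ over $W(\mathcal X)$. On the window, for given $(n,d,q)$ and $s$, $\dim\operatorname{Hull}(\mathcal C_s)$ depends on $\mathcal X$ only through the integer $\delta$, that is, through the number $N=n(q-\delta)$ of affine rational points.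
   Context: Setting. $q$ is a power of a prime $p$; $n\ge2$, $d\ge3$ are integers with $n\mid q-1$ (so $p\nmid n$); $c=\gcd(n,d)$; $f\in\mathbb F_q[x]$ is separable of degree $d$ with no root in $\mathbb F_q$. $\mathcal X$ is the smooth projective model of $y^n=f(x)$ over $\mathbb F_q$, of genus $g_{\mathcal X}=\frac{(n-1)(d-1)+1-c}{2}$, and $\pi:\mathcal X\to\mathbb P^1$, $(x,y)\mapsto x$. $D_\infty$ is the reduced divisor of the $c$ geometric points over $x=\infty$. $D$ is the sum of all $\mathbb F_q$-rational points of $\mathcal X$ over $\mathbb A^1(\mathbb F_q)$, $N=\deg D$, and $E=\sum_{a\in\mathbb F_q}\pi^*(a)-D$ (effective). $\Delta=\{a\in\mathbb F_q:f(a)\notin(\mathbb F_q^* )^n\}$, $\delta=|\Delta|$, $e_\Delta(x)=\prod_{a\in\Delta}(x-a)$; one has $N=n(q-\delta)$, $E=\pi^*(\Delta)$, $\deg E=n\delta$. Codes. $L(G)=\{h\in\mathbb F_q(\mathcal X)^*:\operatorname{div}(h)+G\ge0\}\cup\{0\}$; for $G$ with support disjoint from $\operatorname{Supp} D$, $C_L(D,G)\subseteq\mathbb F_q^N$ is the image of evaluation of $L(G)$ at the points of $D$. For $s\ge1$, $\mathcal C_s=C_L(D,sD_\infty)$ is the weighted superelliptic code (equivalently the span of the vectors $(x(P)^iy(P)^j)_{P}$, $i\ge0$, $0\le j\le n-1$, $\frac nc i+\frac dc j\le s$). $\operatorname{Hull}(C)=C\cap C^\perp$ for the standard bilinear form;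 $C$ is LCD if $\operatorname{Hull}(C)=0$. Notation. $M=\frac{(q-1)n}{c}-1$, $\mu(s)=\min\{s,M-s\}$, $\nu(s)=\mu(s)-\frac{n\delta}{c}\in\mathbb Z$, $t(s)=2g_{\mathcal X}-2-c\,\mu(s)+n\delta$, and the window is the set of integers $W(\mathcal X)=\{s\ge1:t(s)<0\}$. *)

theory Defs
  imports
    "HOL-Algebra.Algebraic_Closure_Type"
    "HOL-Computational_Algebra.Polynomial_Factorial"
    "HOL-Library.Function_Algebras"
    "HOL-Library.Cardinality"
begin

text \<open>
  The finite field \<open>\<F>\<^sub>q\<close> is a type \<open>'a :: {field, finite}\<close> with \<open>q = CARD('a)\<close>.  All function
  fields of curves \<open>y\<^sup>n = f(x)\<close> over it live in one algebraic closure of \<open>\<F>\<^sub>q(x)\<close>.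
\<close>

type_synonym 'a ambient = "'a poly fract alg_closure"

text \<open>A place is represented by its normalised discrete valuation.\<close>

type_synonym 'a place = "'a ambient \<Rightarrow> int"
type_synonym 'a divisor = "'a place \<Rightarrow> int"

text \<open>
  Words of \<open>\<F>\<^sub>q\<^sup>N\<close> are indexed by the points of the evaluation divisor themselves: a word is a
  function on places that is zero off these \<open>N\<close> points.
\<close>

type_synonym 'a word = "'a place \<Rightarrow> 'a"

definition superelliptic :: "nat \<Rightarrow> nat \<Rightarrow> 'a::{field, finite} poly \<Rightarrow> bool" where
  "superelliptic n d f \<longleftrightarrow>
     n \<ge> 2 \<and> d \<ge> 3 \<and> n dvd CARD('a) - 1 \<and>
     degree f = d \<and> coprime f (pderiv f) \<and> (\<forall>a. poly f a \<noteq> 0)"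


subsection \<open>The function field, its places and divisors\<close>

text \<open>\<open>emb p\<close> is the function \<open>p(x)\<close>; in particular \<open>emb [:0, 1:]\<close> is \<open>x\<close>.\<close>

definition emb :: "'a::{field, finite} poly \<Rightarrow> 'a ambient" where
  "emb p = to_ac (to_fract p)"

abbreviation cst :: "'a::{field, finite} \<Rightarrow> 'a ambient" where
  "cst a \<equiv> emb [:a:]"

abbreviation xfun :: "'a::{field, finite} ambient" where
  "xfun \<equiv> emb [:0, 1:]"

text \<open>
  Since \<open>\<F>\<^sub>q\<close> contains the \<open>n\<close>-th roots of unity, nothing below depends on which root is chosen
  here.
\<close>

definition yfun :: "nat \<Rightarrow> 'a::{field, finite} poly \<Rightarrow> 'a ambient" where
  "yfun n f = (SOME z. z ^ n = emb f)"

lemma yfun_power: "n > 0 \<Longrightarrow> yfun n f ^ n = emb f"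
  unfolding yfun_def by (rule someI_ex) (metis nth_root_exists)

text \<open>
  \<open>\<F>\<^sub>q(x)[y]\<close>, which is the field \<open>\<F>\<^sub>q(x, y)\<close> because \<open>y\<close> is algebraic over \<open>\<F>\<^sub>q(x)\<close>.
\<close>

definition function_field :: "nat \<Rightarrow> 'a::{field, finite} poly \<Rightarrow> 'a ambient set" where
  "function_field n f = range (\<lambda>r :: 'a poly fract poly. poly (map_poly to_ac r) (yfun n f))"

text \<open>
  The closed points of the smooth projective model correspond to the surjective valuations
  \<open>v : K\<^sup>* \<rightarrow> \<int>\<close> of its function field \<open>K\<close> that are trivial on \<open>\<F>\<^sub>q\<^sup>*\<close>.  The value at \<open>0\<close>, which
  should be \<open>\<infinity>\<close>, and the values outside \<open>K\<close> are normalised to \<open>0\<close>, so that distinct functions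
  are distinct places.
\<close>

definition is_place :: "nat \<Rightarrow> 'a::{field, finite} poly \<Rightarrow> 'a place \<Rightarrow> bool" where
  "is_place n f v \<longleftrightarrow>
     (\<forall>g\<in>function_field n f. \<forall>h\<in>function_field n f.
        g \<noteq> 0 \<longrightarrow> h \<noteq> 0 \<longrightarrow> v (g * h) = v g + v h) \<and>
     (\<forall>g\<in>function_field n f. \<forall>h\<in>function_field n f.
        g \<noteq> 0 \<longrightarrow> h \<noteq> 0 \<longrightarrow> g + h \<noteq> 0 \<longrightarrow> v (g + h) \<ge> min (v g) (v h)) \<and>
     (\<forall>a. a \<noteq> 0 \<longrightarrow> v (cst a) = 0) \<and>
     (\<exists>g\<in>function_field n f. g \<noteq> 0 \<and> v g = 1) \<and>
     (\<forall>g. g = 0 \<or> g \<notin> function_field n f \<longrightarrow> v g = 0)"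

definition vanishes_at :: "'a::{field, finite} place \<Rightarrow> 'a ambient \<Rightarrow> bool" where
  "vanishes_at v h \<longleftrightarrow> h = 0 \<or> v h > 0"

text \<open>Places whose residue field is \<open>\<F>\<^sub>q\<close>.\<close>

definition is_rational :: "nat \<Rightarrow> 'a::{field, finite} poly \<Rightarrow> 'a place \<Rightarrow> bool" where
  "is_rational n f v \<longleftrightarrow>
     is_place n f v \<and>
     (\<forall>h\<in>function_field n f. v h \<ge> 0 \<longrightarrow> (\<exists>a. vanishes_at v (h - cst a)))"

text \<open>The value \<open>h(P) \<in> \<F>\<^sub>q\<close> of a function at a rational point where it is regular.\<close>

definition value_at :: "'a::{field, finite} place \<Rightarrow> 'a ambient \<Rightarrow> 'a" where
  "value_at v h = (THE a. vanishes_at v (h - cst a))"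

text \<open>The support of \<open>D\<close>: the rational points over the affine line, that is, not over \<open>x = \<infinity>\<close>.\<close>

definition affine_points :: "nat \<Rightarrow> 'a::{field, finite} poly \<Rightarrow> 'a place set" where
  "affine_points n f = {v. is_rational n f v \<and> v xfun \<ge> 0}"

definition div_D :: "nat \<Rightarrow> 'a::{field, finite} poly \<Rightarrow> 'a divisor" where
  "div_D n f v = (if v \<in> affine_points n f then 1 else 0)"

definition num_points :: "nat \<Rightarrow> 'a::{field, finite} poly \<Rightarrow> nat" where
  "num_points n f = card (affine_points n f)"

text \<open>
  A closed point of degree \<open>r\<close> is a sum of \<open>r\<close> distinct geometric points, so the reduced divisor of
  the geometric points over \<open>x = \<infinity>\<close> is the sum of the places that are poles of \<open>x\<close>.
\<close>

definition div_inf :: "nat \<Rightarrow> 'a::{field, finite} poly \<Rightarrow> 'a divisor" where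
  "div_inf n f v = (if is_place n f v \<and> v xfun < 0 then 1 else 0)"

text \<open>
  The pullback of the point \<open>x = a\<close> is the divisor of zeros of \<open>x - a\<close>: the multiplicity at a place
  above \<open>a\<close> is the valuation of the local parameter \<open>x - a\<close>.
\<close>

definition pullback_point :: "nat \<Rightarrow> 'a::{field, finite} poly \<Rightarrow> 'a \<Rightarrow> 'a divisor" where
  "pullback_point n f a v = (if is_place n f v then max 0 (v (xfun - cst a)) else 0)"

definition div_E :: "nat \<Rightarrow> 'a::{field, finite} poly \<Rightarrow> 'a divisor" where
  "div_E n f v = (\<Sum>a\<in>UNIV. pullback_point n f a v) - div_D n f v"

definition riemann_roch_space ::
    "nat \<Rightarrow> 'a::{field, finite} poly \<Rightarrow> 'a divisor \<Rightarrow> 'a ambient set" where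
  "riemann_roch_space n f G =
     {h \<in> function_field n f. h \<noteq> 0 \<longrightarrow> (\<forall>v. is_place n f v \<longrightarrow> v h + G v \<ge> 0)}"


subsection \<open>Codes\<close>

definition C_L :: "nat \<Rightarrow> 'a::{field, finite} poly \<Rightarrow> 'a divisor \<Rightarrow> 'a word set" where
  "C_L n f G =
     (\<lambda>h v. if v \<in> affine_points n f then value_at v h else 0) ` riemann_roch_space n f G"

definition superelliptic_code :: "nat \<Rightarrow> 'a::{field, finite} poly \<Rightarrow> int \<Rightarrow> 'a word set" where
  "superelliptic_code n f s = C_L n f (\<lambda>v. s * div_inf n f v)"

definition dual_code ::
    "nat \<Rightarrow> 'a::{field, finite} poly \<Rightarrow> 'a word set \<Rightarrow> 'a word set" where
  "dual_code n f C =
     {w. (\<forall>v. v \<notin> affine_points n f \<longrightarrow> w v = 0) \<and>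
         (\<forall>u\<in>C. (\<Sum>v\<in>affine_points n f. u v * w v) = 0)}"

definition code_hull :: "nat \<Rightarrow> 'a::{field, finite} poly \<Rightarrow> 'a word set \<Rightarrow> 'a word set" where
  "code_hull n f C = C \<inter> dual_code n f C"

definition is_LCD :: "nat \<Rightarrow> 'a::{field, finite} poly \<Rightarrow> 'a word set \<Rightarrow> bool" where
  "is_LCD n f C \<longleftrightarrow> code_hull n f C = {\<lambda>v. 0}"

definition code_dim :: "'a::{field, finite} word set \<Rightarrow> nat" where
  "code_dim = vector_space.dim (\<lambda>a w v. a * w v)"

abbreviation hull_dim :: "nat \<Rightarrow> 'a::{field, finite} poly \<Rightarrow> int \<Rightarrow> int" where
  "hull_dim n f s \<equiv> int (code_dim (code_hull n f (superelliptic_code n f s)))"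


subsection \<open>Numerical data of the curve\<close>

definition Delta :: "nat \<Rightarrow> 'a::{field, finite} poly \<Rightarrow> 'a set" where
  "Delta n f = {a. poly f a \<notin> {b ^ n | b. b \<noteq> 0}}"

definition delta :: "nat \<Rightarrow> 'a::{field, finite} poly \<Rightarrow> nat" where
  "delta n f = card (Delta n f)"

text \<open>The function \<open>e\<^sub>\<Delta>(x)\<close> on the curve.\<close>

definition e_Delta :: "nat \<Rightarrow> 'a::{field, finite} poly \<Rightarrow> 'a ambient" where
  "e_Delta n f = emb (\<Prod>a\<in>Delta n f. [:- a, 1:])"

text \<open>
  In the next definitions \<open>d = degree f\<close>, and all divisions are exact: \<open>c\<close> divides \<open>n\<close>, and
  \<open>(n - 1)(d - 1) + 1 - c\<close> is even.  The number \<open>c\<close> is the degree of the divisor at infinity, and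
  \<open>g\<close> is given by the closed formula for superelliptic curves with \<open>f\<close> separable and
  \<open>n\<close> prime to the characteristic.
\<close>

definition ninf :: "nat \<Rightarrow> 'a::{field, finite} poly \<Rightarrow> int" where
  "ninf n f = int (gcd n (degree f))"

definition genus :: "nat \<Rightarrow> 'a::{field, finite} poly \<Rightarrow> int" where
  "genus n f = ((int n - 1) * (int (degree f) - 1) + 1 - ninf n f) div 2"

definition Mbound :: "nat \<Rightarrow> 'a::{field, finite} poly \<Rightarrow> int" where
  "Mbound n f = (int CARD('a) - 1) * int n div ninf n f - 1"

definition mu :: "nat \<Rightarrow> 'a::{field, finite} poly \<Rightarrow> int \<Rightarrow> int" where
  "mu n f s = min s (Mbound n f - s)"

definition nu :: "nat \<Rightarrow> 'a::{field, finite} poly \<Rightarrow> int \<Rightarrow> int" where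
  "nu n f s = mu n f s - int n * int (delta n f) div ninf n f"

definition tnum :: "nat \<Rightarrow> 'a::{field, finite} poly \<Rightarrow> int \<Rightarrow> int" where
  "tnum n f s = 2 * genus n f - 2 - ninf n f * mu n f s + int n * int (delta n f)"

definition window :: "nat \<Rightarrow> 'a::{field, finite} poly \<Rightarrow> int set" where
  "window n f = {s. s \<ge> 1 \<and> tnum n f s < 0}"

end

theory Submission
  imports Defs "HOL-Number_Theory.Cong"
begin

text \<open>
  Everything takes place in the decomposition of functions and words into their components along
  \<open>y\<^sup>j\<close>, \<open>0 \<le> j < n\<close>.  The projections are averages over the
  \<open>n\<close>-th roots of unity, which lie in \<open>\<F>\<^sub>q\<close>.

  \<^bold>\<open>Riemann-Roch spaces.\<close>  The substitutions \<open>y \<mapsto> \<zeta>y\<close> permute the places and fix \<open>D\<^sub>\<infinity>\<close>, so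
  averaging over them projects \<open>L(sD\<^sub>\<infinity>)\<close> onto its components \<open>r\<^sub>j(x) y\<^sup>j\<close>.  The orders of such a
  product are known: at a place over an irreducible \<open>P\<close> the factor \<open>y\<^sup>j\<close> cannot cancel a pole of
  \<open>r\<^sub>j\<close>, since \<open>f\<close> is squarefree and \<open>j < n\<close>, and at infinity \<open>x\<close> and \<open>y\<close> have pole orders \<open>n/c\<close>
  and \<open>d/c\<close>.  Hence \<open>L(sD\<^sub>\<infinity>)\<close> has the basis \<open>x\<^sup>i y\<^sup>j\<close> with \<open>n i + d j \<le> c s\<close> (\<open>Lspace_eq\<close>).  Moreover
  the rational points over \<open>\<A>\<^sup>1\<close> are the pairs \<open>(a, b)\<close> with \<open>b\<^sup>n = f(a)\<close>, they lie over the
  \<open>a \<notin> \<Delta>\<close>, and \<open>E\<close> is the zero divisor of \<open>e\<^sub>\<Delta>\<close>; so \<open>L(\<mu>D\<^sub>\<infinity> - E) = e\<^sub>\<Delta> L(\<nu>D\<^sub>\<infinity>)\<close>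
  (\<open>riemann_roch_minus_E\<close>), which is the monomial equivalence of the two codes.

  \<^bold>\<open>Places.\<close>  A place is a discrete valuation, and what is needed about places is proved from the
  axioms of a valuation.  Places exist over every irreducible polynomial and over infinity by
  Chevalley's theorem: a subring with a non-unit \<open>\<pi>\<close> lies in a valuation ring in which \<open>\<pi>\<close> is
  still a non-unit, and since any \<open>n + 1\<close> powers of a function are dependent over \<open>\<F>\<^sub>q(x)\<close>, that
  ring is discrete on the function field.  Ramification indices and uniqueness come from one
  descent argument for equations \<open>w\<^sup>c = l + \<dots>\<close> with \<open>l \<noteq> 0\<close> (\<open>unramified_descent\<close>).

  \<^bold>\<open>The hull.\<close>  Summing over the \<open>n\<close> points above \<open>a \<notin> \<Delta>\<close> shows that \<open>y\<^sup>j\<close> and \<open>y\<^sup>k\<close> are orthogonal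
  unless \<open>n\<close> divides \<open>j + k\<close>, so the form pairs the component \<open>j\<close> with the component \<open>n - j\<close>, with
  weight \<open>f\<close> (the component \<open>0\<close> with itself, with weight \<open>1\<close>).  A word of the hull
  has components \<open>p\<close> that are polynomials of degree at most
  \<open>k\<^sub>j(s) = \<lfloor>(cs - dj)/n\<rfloor>\<close> and that are orthogonal to \<open>f g\<close> for all \<open>g\<close> of degree at most
  \<open>k\<^sub>n\<^sub>-\<^sub>j(s)\<close>.  They are also orthogonal to \<open>e\<^sub>\<Delta> g\<close> for \<open>deg g \<le> q - 2 - \<delta> - k\<^sub>j(s)\<close>, because a sum over
  \<open>\<F>\<^sub>q\<close> of values of a polynomial of degree below \<open>q - 1\<close> vanishes.  In the window both degree bounds
  are large enough for Bezout's identity, applied to the coprime polynomials \<open>f\<close> and \<open>e\<^sub>\<Delta>\<close>, to merge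
  the two spaces into that of all polynomials up to a degree \<open>T\<close>, and the functions orthogonal to those are \<open>e\<^sub>\<Delta> r\<close> with
  \<open>deg r \<le> q - 2 - \<delta> - T = k\<^sub>j(\<nu>)\<close> (\<open>hull_component\<close>).  So the hull is \<open>e\<^sub>\<Delta> C\<^sub>L(D, \<nu>D\<^sub>\<infinity>)\<close>; its
  dimension is the number of monomials in the basis of \<open>L(\<nu>D\<^sub>\<infinity>)\<close>, and since the degrees \<open>k\<^sub>j(\<nu>)\<close> are
  at least \<open>-1\<close> in the window, that number is \<open>c\<nu> + 1 - g\<close> by a count of residues (\<open>sum_floors\<close>).
  The remaining claims are computations with this formula and with \<open>N = n(q - \<delta>)\<close>.
\<close>

section \<open>Extending local rings to valuation rings\<close>

definition unital_subring :: "'b::field set \<Rightarrow> bool" where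
  "unital_subring S \<longleftrightarrow> 1 \<in> S \<and> (\<forall>a\<in>S. \<forall>b\<in>S. a - b \<in> S \<and> a * b \<in> S)"

definition valuation_ring :: "'b::field set \<Rightarrow> bool" where
  "valuation_ring V \<longleftrightarrow> unital_subring V \<and> (\<forall>z. z \<noteq> 0 \<longrightarrow> z \<in> V \<or> inverse z \<in> V)"

definition adjoin :: "'b::field set \<Rightarrow> 'b \<Rightarrow> 'b set" where
  "adjoin S z = {poly p z | p. \<forall>i. coeff p i \<in> S}"

lemma subring_one: "unital_subring S \<Longrightarrow> 1 \<in> S"
  and subring_mult: "unital_subring S \<Longrightarrow> a \<in> S \<Longrightarrow> b \<in> S \<Longrightarrow> a * b \<in> S"
  and subring_diff: "unital_subring S \<Longrightarrow> a \<in> S \<Longrightarrow> b \<in> S \<Longrightarrow> a - b \<in> S"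
  by (auto simp: unital_subring_def)

lemma subring_zero: "unital_subring S \<Longrightarrow> 0 \<in> S"
  using subring_diff[of S 1 1] by (simp add: subring_one)

lemma subring_uminus: "unital_subring S \<Longrightarrow> a \<in> S \<Longrightarrow> - a \<in> S"
  using subring_diff[of S 0 a] by (simp add: subring_zero)

lemma subring_add: "unital_subring S \<Longrightarrow> a \<in> S \<Longrightarrow> b \<in> S \<Longrightarrow> a + b \<in> S"
  using subring_diff[of S a "- b"] by (simp add: subring_uminus)

lemma subring_power: "unital_subring S \<Longrightarrow> a \<in> S \<Longrightarrow> a ^ k \<in> S"
  by (induction k) (auto intro: subring_one subring_mult)

lemma subring_sum: "unital_subring S \<Longrightarrow> (\<And>i. i \<in> I \<Longrightarrow> t i \<in> S) \<Longrightarrow> sum t I \<in> S"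
  by (induction I rule: infinite_finite_induct) (auto intro: subring_zero subring_add)

lemma subring_adjoin:
  assumes S: "unital_subring S" shows "unital_subring (adjoin S z)"
  unfolding unital_subring_def
proof (intro conjI ballI)
  show "1 \<in> adjoin S z"
    unfolding adjoin_def using S by (auto intro!: exI[of _ 1] simp: subring_zero subring_one coeff_1)
next
  fix a b assume "a \<in> adjoin S z" "b \<in> adjoin S z"
  then obtain p r where p: "\<forall>i. coeff p i \<in> S" "a = poly p z" and r: "\<forall>i. coeff r i \<in> S" "b = poly r z"
    by (auto simp: adjoin_def)
  have "\<forall>i. coeff (p - r) i \<in> S" using p r S by (simp add: subring_diff)
  moreover have "a - b = poly (p - r) z" using p r by simp
  ultimately show "a - b \<in> adjoin S z" unfolding adjoin_def by blast
  have "\<forall>i. coeff (p * r) i \<in> S"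
    using p r S by (simp add: coeff_mult subring_sum subring_mult)
  moreover have "a * b = poly (p * r) z" using p r by simp
  ultimately show "a * b \<in> adjoin S z" unfolding adjoin_def by blast
qed

lemma subset_adjoin: "unital_subring S \<Longrightarrow> S \<subseteq> adjoin S z"
proof
  fix a assume "unital_subring S" "a \<in> S"
  then have "\<forall>i. coeff [:a:] i \<in> S" by (simp add: coeff_pCons subring_zero split: nat.splits)
  moreover have "a = poly [:a:] z" by simp
  ultimately show "a \<in> adjoin S z" unfolding adjoin_def by blast
qed

lemma mem_adjoin: "unital_subring S \<Longrightarrow> z \<in> adjoin S z"
proof -
  assume "unital_subring S"
  then have "\<forall>i. coeff [:0, 1:] i \<in> S"
    by (simp add: coeff_pCons subring_zero subring_one split: nat.splits)
  moreover have "z = poly [:0, 1:] z" by simp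
  ultimately show "z \<in> adjoin S z" unfolding adjoin_def by blast
qed

text \<open>
  Since \<open>1 - \<pi>a\<close> is a unit, the relation in \<open>1/z\<close> can be solved for its constant term; multiplied by
  \<open>z\<^sup>k\<close> it writes \<open>z\<^sup>k\<close> as \<open>\<pi>\<close> times a combination of lower powers of \<open>z\<close>.  Substituting this for the
  leading term of the relation in \<open>z\<close> lowers the degree of that relation.
\<close>

lemma degree_reduction:
  fixes V :: "'b::field set"
  assumes V: "unital_subring V" and pV: "\<pi> \<in> V" and np: "\<forall>a\<in>V. \<pi> * a \<noteq> 1"
    and units: "\<forall>a\<in>V. inverse (1 - \<pi> * a) \<in> V"
    and p: "\<forall>i. coeff p i \<in> V" "\<pi> * poly p z = 1"
    and r: "\<forall>i. coeff r i \<in> V" "\<pi> * poly r (inverse z) = 1"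
    and z: "z \<noteq> 0" and le: "degree r \<le> degree p"
  shows "\<exists>p'. (\<forall>i. coeff p' i \<in> V) \<and> \<pi> * poly p' z = 1 \<and> degree p' < degree p"
proof -
  define k where "k = degree r"
  define m where "m = degree p"
  have k0: "k > 0"
  proof (rule ccontr)
    assume "\<not> k > 0"
    then have "degree r = 0" by (simp add: k_def)
    then obtain a where "r = [:a:]" by (rule degree_eq_zeroE)
    with r have "a \<in> V" "\<pi> * a = 1" by (auto dest: spec[of _ 0])
    then show False using np by auto
  qed
  define u where "u = inverse (1 - \<pi> * coeff r 0)"
  have u: "u \<in> V" using units r by (simp add: u_def)
  have ne: "1 - \<pi> * coeff r 0 \<noteq> 0" using np r by (metis eq_iff_diff_eq_0)
  have split: "{..k} = insert 0 {1..k}" by auto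
  have "1 = \<pi> * (\<Sum>i\<le>k. coeff r i * inverse z ^ i)"
    using r by (simp add: poly_altdef k_def)
  then have "1 - \<pi> * coeff r 0 = \<pi> * (\<Sum>i=1..k. coeff r i * inverse z ^ i)"
    unfolding split by (simp add: algebra_simps)
  then have "1 = u * (\<pi> * (\<Sum>i=1..k. coeff r i * inverse z ^ i))"
    using ne by (simp add: u_def divide_simps)
  then have "z ^ k = u * (\<pi> * (\<Sum>i=1..k. coeff r i * inverse z ^ i)) * z ^ k" by simp
  also have "\<dots> = \<pi> * (\<Sum>i=1..k. u * coeff r i * (inverse z ^ i * z ^ k))"
    by (simp add: sum_distrib_left sum_distrib_right mult_ac)
  also have "(\<Sum>i=1..k. u * coeff r i * (inverse z ^ i * z ^ k)) = (\<Sum>i=1..k. u * coeff r i * z ^ (k - i))"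
    using z by (intro sum.cong refl) (simp add: power_diff field_simps)
  finally have zk: "z ^ k = \<pi> * (\<Sum>i=1..k. u * coeff r i * z ^ (k - i))" .
  define h where "h = (\<Sum>i=1..k. monom (u * coeff r i) (k - i))"
  have hV: "\<forall>i. coeff h i \<in> V"
    using V u r by (auto simp: h_def coeff_sum intro!: subring_sum subring_mult subring_zero)
  have hz: "\<pi> * poly h z = z ^ k" unfolding zk h_def by (simp add: poly_sum poly_monom)
  have hd: "degree h \<le> k - 1" unfolding h_def
    by (intro degree_sum_le) (auto intro: order.trans[OF degree_monom_le])
  define a where "a = coeff p m"
  define p' where "p' = (p - monom a m) + smult (\<pi> * a) (monom 1 (m - k) * h)"
  have aV: "a \<in> V" using p by (simp add: a_def)
  have "\<forall>i. coeff (smult (\<pi> * a) (monom 1 (m - k) * h)) i \<in> V"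
    using V aV pV hV by (auto simp: coeff_monom_mult intro!: subring_mult subring_zero)
  moreover have "\<forall>i. coeff (p - monom a m) i \<in> V"
    using V aV p by (auto intro!: subring_diff subring_zero)
  ultimately have 1: "\<forall>i. coeff p' i \<in> V" using V unfolding p'_def by (simp add: subring_add)
  have mk: "k \<le> m" using le by (simp add: k_def m_def)
  have "poly p' z = poly p z - a * z ^ m + a * z ^ (m - k) * (\<pi> * poly h z)"
    by (simp add: p'_def poly_monom algebra_simps)
  also have "\<dots> = poly p z" using mk by (simp add: hz mult.assoc flip: power_add)
  finally have 2: "\<pi> * poly p' z = 1" using p by simp
  have "degree (p - monom a m) \<le> m - 1"
  proof (rule degree_le, intro allI impI)
    fix i assume i: "i > m - 1"
    then show "coeff (p - monom a m) i = 0"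
      by (cases "i = m") (auto simp: a_def m_def coeff_eq_0)
  qed
  moreover have "degree (smult (\<pi> * a) (monom 1 (m - k) * h)) \<le> m - 1"
    using mk k0 hd
    by (intro order.trans[OF degree_smult_le] order.trans[OF degree_mult_le])
      (simp add: degree_monom_eq)
  ultimately have "degree p' \<le> m - 1" unfolding p'_def by (rule degree_add_le)
  then have 3: "degree p' < degree p" using k0 mk by (simp add: m_def)
  show ?thesis using 1 2 3 by blast
qed

text \<open>
  The roles of \<open>z\<close> and \<open>1/z\<close> are symmetric, so the relation of larger degree can be shortened until
  a relation of degree \<open>0\<close> says that \<open>\<pi>\<close> is a unit.
\<close>

lemma no_double_relation:
  fixes V :: "'b::field set"
  assumes V: "unital_subring V" and pV: "\<pi> \<in> V" and np: "\<forall>a\<in>V. \<pi> * a \<noteq> 1"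
    and units: "\<forall>a\<in>V. inverse (1 - \<pi> * a) \<in> V"
  shows "(\<forall>i. coeff p i \<in> V) \<Longrightarrow> \<pi> * poly p z = 1 \<Longrightarrow>
    (\<forall>i. coeff r i \<in> V) \<Longrightarrow> \<pi> * poly r (inverse z) = 1 \<Longrightarrow> z \<noteq> 0 \<Longrightarrow> False"
proof (induction "degree p + degree r" arbitrary: p r rule: less_induct)
  case less
  show ?case
  proof (cases "degree r \<le> degree p")
    case True
    then obtain p' where "\<forall>i. coeff p' i \<in> V" "\<pi> * poly p' z = 1" "degree p' < degree p"
      using degree_reduction[OF V pV np units less.prems True] by blast
    then show False using less.hyps[of p' r] less.prems by simp
  next
    case False
    then obtain r' where "\<forall>i. coeff r' i \<in> V" "\<pi> * poly r' (inverse z) = 1" "degree r' < degree r"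
      using degree_reduction[OF V pV np units less.prems(3,4), of p] less.prems(1,2,5) by auto
    then show False using less.hyps[of p r'] less.prems by simp
  qed
qed

text \<open>
  A subring that is maximal among those in which \<open>\<pi>\<close> is a non-unit is a valuation ring: if
  neither \<open>z\<close> nor \<open>1/z\<close> belongs to it, adjoining either of them makes \<open>\<pi>\<close> invertible, which gives two
  relations that exclude each other.
\<close>

theorem Chevalley_extension:
  fixes R :: "'b::field set"
  assumes R: "unital_subring R" and pR: "\<pi> \<in> R" and nR: "\<forall>a\<in>R. \<pi> * a \<noteq> 1"
  shows "\<exists>V. valuation_ring V \<and> R \<subseteq> V \<and> (\<forall>a\<in>V. \<pi> * a \<noteq> 1)"
proof -
  define Q where "Q = {S. unital_subring S \<and> R \<subseteq> S \<and> (\<forall>a\<in>S. \<pi> * a \<noteq> 1)}"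
  have "\<exists>V\<in>Q. \<forall>T\<in>Q. V \<subseteq> T \<longrightarrow> T = V"
  proof (rule Zorn_Lemma2, intro ballI)
    fix C assume C: "C \<in> chains Q"
    show "\<exists>U\<in>Q. \<forall>T\<in>C. T \<subseteq> U"
    proof (cases "C = {}")
      case True
      then show ?thesis using R nR by (auto simp: Q_def)
    next
      case False
      have CQ: "T \<in> Q" if "T \<in> C" for T using that C chainsD2 by blast
      have "unital_subring (\<Union>C)"
        unfolding unital_subring_def
      proof (intro conjI ballI)
        show "1 \<in> \<Union>C" using False CQ by (fastforce simp: Q_def subring_one)
      next
        fix a b assume "a \<in> \<Union>C" "b \<in> \<Union>C"
        then obtain T Y where XY: "T \<in> C" "Y \<in> C" "a \<in> T" "b \<in> Y" by blast
        then obtain Z where Z: "Z \<in> C" "a \<in> Z" "b \<in> Z" using chainsD[OF C] by blast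
        then have "unital_subring Z" using CQ by (auto simp: Q_def)
        then show "a - b \<in> \<Union>C" "a * b \<in> \<Union>C" using Z subring_diff subring_mult by blast+
      qed
      then have "\<Union>C \<in> Q" using False CQ by (fastforce simp: Q_def)
      then show ?thesis by blast
    qed
  qed
  then obtain V where VQ: "V \<in> Q" and mx: "\<And>T. T \<in> Q \<Longrightarrow> V \<subseteq> T \<Longrightarrow> T = V" by blast
  have V: "unital_subring V" and RV: "R \<subseteq> V" and nV: "\<forall>a\<in>V. \<pi> * a \<noteq> 1"
    using VQ by (auto simp: Q_def)
  have pV: "\<pi> \<in> V" using pR RV by blast
  have ext: "z \<in> V \<or> (\<exists>p. (\<forall>i. coeff p i \<in> V) \<and> \<pi> * poly p z = 1)" for z
  proof (rule disjCI)
    assume "\<not> (\<exists>p. (\<forall>i. coeff p i \<in> V) \<and> \<pi> * poly p z = 1)"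
    then have "\<forall>a\<in>adjoin V z. \<pi> * a \<noteq> 1" by (auto simp: adjoin_def)
    then have "adjoin V z \<in> Q"
      using subring_adjoin[OF V] subset_adjoin[OF V] RV by (fastforce simp: Q_def)
    then show "z \<in> V" using mx subset_adjoin[OF V] mem_adjoin[OF V] by blast
  qed
  have units: "\<forall>a\<in>V. inverse (1 - \<pi> * a) \<in> V"
  proof (intro ballI, rule ccontr)
    fix a assume a: "a \<in> V" and n: "inverse (1 - \<pi> * a) \<notin> V"
    define u where "u = 1 - \<pi> * a"
    have u: "u \<in> V" "u \<noteq> 0"
      using a nV V pV by (auto simp: u_def subring_diff subring_one subring_mult)
    obtain p where p: "\<forall>i. coeff p i \<in> V" "\<pi> * poly p (inverse u) = 1"
      using ext n unfolding u_def by blast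
    define k where "k = degree p"
    have "u ^ k * poly p (inverse u) = (\<Sum>i\<le>k. coeff p i * (u ^ k * inverse u ^ i))"
      by (simp add: poly_altdef k_def sum_distrib_left mult_ac)
    also have "\<dots> = (\<Sum>i\<le>k. coeff p i * u ^ (k - i))"
      using u by (intro sum.cong refl) (simp add: power_diff field_simps)
    also have "\<dots> \<in> V" using V p u by (intro subring_sum subring_mult subring_power) auto
    finally have w: "u ^ k * poly p (inverse u) \<in> V" .
    have "\<exists>b\<in>V. u ^ k = 1 - \<pi> * b"
    proof (induction k)
      case 0 show ?case using V by (intro bexI[of _ 0]) (auto simp: subring_zero)
    next
      case (Suc k)
      then obtain b where b: "b \<in> V" "u ^ k = 1 - \<pi> * b" by blast
      have "u ^ Suc k = (1 - \<pi> * b) * (1 - \<pi> * a)" using b by (simp add: u_def)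
      also have "\<dots> = 1 - \<pi> * (a + b - \<pi> * a * b)" by (simp add: algebra_simps)
      finally show ?case
        by (rule bexI) (use V a b pV in \<open>simp add: subring_diff subring_add subring_mult\<close>)
    qed
    then obtain b where b: "b \<in> V" "u ^ k = 1 - \<pi> * b" by blast
    have "u ^ k = \<pi> * (u ^ k * poly p (inverse u))" using p by (simp add: mult_ac)
    then have "\<pi> * (u ^ k * poly p (inverse u) + b) = u ^ k + \<pi> * b"
      by (simp only: distrib_left)
    then have "\<pi> * (u ^ k * poly p (inverse u) + b) = 1" using b by simp
    then show False using nV w b V subring_add by blast
  qed
  have "valuation_ring V"
    unfolding valuation_ring_def
  proof (intro conjI allI impI V)
    fix z :: 'b assume "z \<noteq> 0"
    then show "z \<in> V \<or> inverse z \<in> V"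
      using ext[of z] ext[of "inverse z"] no_double_relation[OF V pV nV units] by blast
  qed
  then show ?thesis using RV nV by blast
qed

definition vunit :: "'b::field set \<Rightarrow> 'b \<Rightarrow> bool" where
  "vunit V u \<longleftrightarrow> u \<noteq> 0 \<and> u \<in> V \<and> inverse u \<in> V"

lemma vunit_mult: "unital_subring V \<Longrightarrow> vunit V a \<Longrightarrow> vunit V b \<Longrightarrow> vunit V (a * b)"
  by (simp add: vunit_def subring_mult)

lemma vunit_inverse: "vunit V a \<Longrightarrow> vunit V (inverse a)"
  by (simp add: vunit_def)

lemma vunit_divide: "unital_subring V \<Longrightarrow> vunit V a \<Longrightarrow> vunit V b \<Longrightarrow> vunit V (a / b)"
  by (simp add: divide_inverse vunit_mult vunit_inverse)

lemma vunit_one: "unital_subring V \<Longrightarrow> vunit V 1"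
  by (simp add: vunit_def subring_one)

lemma vunit_power: "unital_subring V \<Longrightarrow> vunit V a \<Longrightarrow> vunit V (a ^ k)"
  by (induction k) (use vunit_mult in \<open>auto simp: vunit_one\<close>)

text \<open>
  Of two elements of a valuation ring one divides the other, and the divisor then divides the sum.
\<close>

lemma nonunit_add:
  assumes V: "valuation_ring V" and x: "x \<in> V" "\<not> vunit V x" and y: "y \<in> V" "\<not> vunit V y"
  shows "\<not> vunit V (x + y)"
proof
  assume u: "vunit V (x + y)"
  have S: "unital_subring V" using V by (simp add: valuation_ring_def)
  have *: "False" if "a \<in> V" "\<not> vunit V b" "b \<in> V" "b \<noteq> 0" "a / b \<in> V" "vunit V (a + b)" for a b
  proof -
    have "inverse b = (1 + a / b) * inverse (a + b)"
      using that by (simp add: vunit_def field_simps)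
    also have "\<dots> \<in> V" using that S
      by (intro subring_mult subring_add subring_one) (auto simp: vunit_def)
    finally show False using that by (simp add: vunit_def)
  qed
  show False
  proof (cases "x = 0 \<or> y = 0")
    case True then show ?thesis using x y u by auto
  next
    case False
    then have "x / y \<in> V \<or> y / x \<in> V"
      using V unfolding valuation_ring_def by (metis divide_eq_0_iff inverse_divide)
    then show ?thesis using *[of x y] *[of y x] x y u False by (auto simp: add.commute)
  qed
qed

lemma nonunit_sum:
  assumes "valuation_ring V" "finite I" "\<And>i. i \<in> I \<Longrightarrow> t i \<in> V \<and> \<not> vunit V (t i)"
  shows "sum t I \<in> V \<and> \<not> vunit V (sum t I)"
  using assms(2,3)
proof (induction I)
  case empty
  then show ?case using assms(1) by (simp add: vunit_def valuation_ring_def subring_zero)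
next
  case (insert i I)
  then show ?case using assms(1) nonunit_add[OF assms(1)]
    by (simp add: valuation_ring_def subring_add)
qed

text \<open>
  Among finitely many nonzero elements there is one of least value.
\<close>

lemma valuation_ring_maximal:
  assumes V: "valuation_ring V" and "finite I" "I \<noteq> {}" "\<And>i. i \<in> I \<Longrightarrow> t i \<noteq> 0"
  shows "\<exists>i\<in>I. \<forall>j\<in>I. t j / t i \<in> V"
  using assms(2,3,4)
proof (induction I rule: finite_ne_induct)
  case (singleton x)
  then show ?case using V by (simp add: valuation_ring_def subring_one)
next
  case (insert x I)
  have S: "unital_subring V" using V by (simp add: valuation_ring_def)
  obtain i where i: "i \<in> I" "\<forall>j\<in>I. t j / t i \<in> V" using insert by auto
  have nz: "t x \<noteq> 0" "t i \<noteq> 0" using insert.prems i by auto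
  then consider "t x / t i \<in> V" | "t i / t x \<in> V"
    using V unfolding valuation_ring_def by (metis divide_eq_0_iff inverse_divide)
  then show ?case
  proof cases
    case 1 then show ?thesis using i by auto
  next
    case 2
    have "t j / t x \<in> V" if "j \<in> I" for j
      using subring_mult[OF S, of "t j / t i" "t i / t x"] that i 2 nz by auto
    moreover have "t x / t x \<in> V" using nz S by (simp add: subring_one)
    ultimately show ?thesis by auto
  qed
qed

text \<open>
  A vanishing sum cannot have a single term of least value: divided by that term it would be
  \<open>1\<close> plus non-units.
\<close>

lemma zero_sum_tie:
  assumes V: "valuation_ring V" and I: "finite I" "I \<noteq> {}" and nz: "\<And>i. i \<in> I \<Longrightarrow> t i \<noteq> 0"
    and sum: "sum t I = 0"
  shows "\<exists>i\<in>I. \<exists>j\<in>I. i \<noteq> j \<and> vunit V (t i / t j)"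
proof -
  have "\<exists>j\<in>I. \<forall>i\<in>I. t i / t j \<in> V"
    using nz by (rule valuation_ring_maximal[OF V I])
  then obtain j where j: "j \<in> I" "\<forall>i\<in>I. t i / t j \<in> V" by blast
  show ?thesis
  proof (rule ccontr)
    assume n: "\<not> ?thesis"
    have "\<not> vunit V (\<Sum>i\<in>I - {j}. t i / t j)"
      using nonunit_sum[OF V, of "I - {j}" "\<lambda>i. t i / t j"] I j n by auto
    moreover have "(\<Sum>i\<in>I. t i / t j) = 0" using sum by (simp flip: sum_divide_distrib)
    then have "(\<Sum>i\<in>I - {j}. t i / t j) = -1"
      using I j nz by (simp add: sum.remove[of I j] eq_neg_iff_add_eq_0 add.commute)
    ultimately show False
      using V subring_uminus[OF _ subring_one, of V] by (auto simp: vunit_def valuation_ring_def)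
  qed
qed

section \<open>Divisibility of polynomials over a field\<close>

text \<open>
  The Euclidean algorithm.  The common divisor is only asserted to exist, which avoids fixing a
  normalisation of gcds over an arbitrary field.
\<close>

lemma poly_bezout:
  fixes p r :: "'k::field poly"
  shows "\<exists>g a b. g dvd p \<and> g dvd r \<and> g = a * p + b * r"
proof (induction "if r = 0 then 0 else Suc (degree r)" arbitrary: p r rule: less_induct)
  case less
  show ?case
  proof (cases "r = 0")
    case True
    then show ?thesis by (intro exI[of _ p] exI[of _ 1] exI[of _ 0]) auto
  next
    case False
    have "(if p mod r = 0 then 0 else Suc (degree (p mod r))) < (if r = 0 then 0 else Suc (degree r))"
      using False degree_mod_less'[OF False] by auto
    from less.hyps[OF this, of r] obtain g a b
      where g: "g dvd r" "g dvd p mod r" "g = a * r + b * (p mod r)" by blast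
    have "g dvd p" using g by (metis dvd_mod_imp_dvd)
    moreover have "g = b * p + (a - b * (p div r)) * r"
      using g(3) by (simp add: minus_div_mult_eq_mod[symmetric] algebra_simps)
    ultimately show ?thesis using g(1) by blast
  qed
qed

lemma irreducible_bezout:
  fixes P p :: "'k::field poly"
  assumes P: "irreducible P" and n: "\<not> P dvd p"
  shows "\<exists>a b. a * p + b * P = 1"
proof -
  obtain g a b where g: "g dvd p" "g dvd P" "g = a * p + b * P" using poly_bezout by blast
  then have "is_unit g" using irreducibleD'[OF P g(2)] n dvd_trans by blast
  then obtain h where "1 = g * h" by (rule dvdE)
  then have "(h * a) * p + (h * b) * P = 1" using g(3) by (simp add: algebra_simps)
  then show ?thesis by blast
qed

lemma irreducible_degree_pos:
  fixes P :: "'k::field poly"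
  assumes "irreducible P" shows "degree P > 0"
proof -
  have "P \<noteq> 0" "\<not> is_unit P" using assms by (auto simp: irreducible_def)
  then show ?thesis using is_unit_iff_degree[of P] by simp
qed

lemma irreducible_power_decomp:
  fixes P p :: "'k::field poly"
  assumes P: "irreducible P" and p: "p \<noteq> 0"
  shows "\<exists>k p'. p = P ^ k * p' \<and> \<not> P dvd p'"
  using p
proof (induction "degree p" arbitrary: p rule: less_induct)
  case less
  show ?case
  proof (cases "P dvd p")
    case False
    then show ?thesis by (intro exI[of _ 0] exI[of _ p]) simp
  next
    case True
    then obtain p1 where p1: "p = P * p1" by (rule dvdE)
    have "degree P > 0" using P by (rule irreducible_degree_pos)
    then have "degree p1 < degree p" "p1 \<noteq> 0"
      using less.prems p1 by (auto simp: degree_mult_eq)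
    then obtain k p' where "p1 = P ^ k * p'" "\<not> P dvd p'" using less.hyps by blast
    then show ?thesis using p1 by (intro exI[of _ "Suc k"] exI[of _ p']) simp
  qed
qed

lemma irreducible_factor_exists:
  fixes p :: "'k::field poly"
  assumes "degree p > 0"
  shows "\<exists>P. irreducible P \<and> P dvd p"
  using assms
proof (induction "degree p" arbitrary: p rule: less_induct)
  case less
  show ?case
  proof (cases "irreducible p")
    case True
    then show ?thesis by (intro exI[of _ p]) simp
  next
    case False
    have "p \<noteq> 0" using less.prems by auto
    then have "\<not> is_unit p" using less.prems is_unit_iff_degree[of p] by simp
    then obtain a b where ab: "p = a * b" "\<not> is_unit a" "\<not> is_unit b"
      using False \<open>p \<noteq> 0\<close> unfolding irreducible_def by blast
    then have "a \<noteq> 0" "b \<noteq> 0" using \<open>p \<noteq> 0\<close> by auto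
    then have "degree a > 0" "degree b > 0"
      using ab is_unit_iff_degree[of a] is_unit_iff_degree[of b] by simp_all
    then have "degree a < degree p"
      using ab \<open>a \<noteq> 0\<close> \<open>b \<noteq> 0\<close> by (simp add: degree_mult_eq)
    then obtain P where "irreducible P" "P dvd a"
      using less.hyps \<open>degree a > 0\<close> by blast
    then show ?thesis using ab dvd_mult2 by blast
  qed
qed

lemma poly_fract_coprime_rep:
  fixes r :: "'k::field poly fract"
  shows "\<exists>a b u w. r = to_fract a / to_fract b \<and> b \<noteq> 0 \<and> u * a + w * b = 1"
proof -
  obtain a b where ab: "r = Fract a b" "b \<noteq> 0" by (cases r) auto
  obtain g u w where g: "g dvd a" "g dvd b" "g = u * a + w * b" using poly_bezout by blast
  obtain a' where a': "a = g * a'" using g(1) by (rule dvdE)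
  obtain b' where b': "b = g * b'" using g(2) by (rule dvdE)
  have "g \<noteq> 0" using b' ab by auto
  have "g * (u * a' + w * b') = g * 1" using g(3) a' b' by (simp add: algebra_simps)
  then have "u * a' + w * b' = 1" using \<open>g \<noteq> 0\<close> by (simp only: mult_cancel_left) simp
  moreover have "r = to_fract a' / to_fract b'"
    using ab a' b' \<open>g \<noteq> 0\<close> by (simp add: Fract_conv_to_fract)
  moreover have "b' \<noteq> 0" using b' ab by auto
  ultimately show ?thesis by blast
qed

section \<open>Finite fields\<close>

lemma finite_field_fermat:
  fixes x :: "'a::{field, finite}"
  assumes "x \<noteq> 0"
  shows "x ^ (CARD('a) - 1) = 1"
proof -
  have "(\<Prod>y\<in>UNIV-{0}. x * y) = x ^ (CARD('a) - 1) * \<Prod>(UNIV-{0})"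
    by (simp add: prod.distrib card_Diff_singleton)
  moreover have "(\<Prod>y\<in>UNIV-{0}. x * y) = \<Prod>(UNIV-{0})"
    by (rule prod.reindex_bij_witness[of _ "\<lambda>y. y / x" "\<lambda>y. x * y"]) (use assms in auto)
  moreover have "\<Prod>(UNIV-{0::'a}) \<noteq> 0" by (simp add: prod_zero_iff)
  ultimately show ?thesis by simp
qed

lemma of_nat_card_eq_0: "of_nat CARD('a) = (0 :: 'a::{field, finite})"
proof -
  have "(\<Sum>y\<in>(UNIV::'a set). y + 1) = (\<Sum>y\<in>UNIV. y)"
    by (rule sum.reindex_bij_witness[of _ "\<lambda>y. y - 1" "\<lambda>y. y + 1"]) auto
  then show ?thesis by (simp add: sum.distrib)
qed

lemma two_le_card_field: "2 \<le> CARD('a::{field, finite})"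
proof -
  have "card {0, 1 :: 'a} \<le> CARD('a)" by (rule card_mono) auto
  then show ?thesis by simp
qed

lemma of_nat_neq_0_of_dvd:
  assumes "n dvd CARD('a::{field, finite}) - 1"
  shows "(of_nat n :: 'a) \<noteq> 0"
proof
  assume n: "(of_nat n :: 'a) = 0"
  obtain m where "CARD('a) - 1 = n * m" using assms by (rule dvdE)
  then have "CARD('a) = n * m + 1" using two_le_card_field[where 'a='a] by simp
  then have "(of_nat CARD('a) :: 'a) = 1" using n by simp
  then show False by (simp add: of_nat_card_eq_0)
qed

text \<open>
  All \<open>q - 1\<close> nonzero elements are roots of \<open>X\<^sup>q\<^sup>-\<^sup>1 - 1\<close>, and the cofactor of \<open>X\<^sup>n - 1\<close> in it is too
  small to have more than \<open>q - 1 - n\<close> of them.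
\<close>

lemma card_roots_of_unity:
  assumes n: "n dvd CARD('a::{field, finite}) - 1" "n > 0"
  shows "card {z :: 'a. z ^ n = 1} = n"
proof -
  obtain m where m: "CARD('a) - 1 = n * m" using n(1) by (rule dvdE)
  define p where "p = monom (1::'a) n - 1"
  define r where "r = (\<Sum>i<m. monom (1::'a) (n * i))"
  have "m > 0" using m two_le_card_field[where 'a='a] by (cases m) auto
  have mm: "monom (1::'a) (n * i) = monom 1 n ^ i" for i by (simp add: monom_power)
  have pr: "p * r = monom 1 (n * m) - 1"
    unfolding p_def r_def mm by (rule power_diff_1_eq[symmetric])
  have dp: "degree p = n"
  proof (rule antisym)
    show "degree p \<le> n" unfolding p_def
      by (rule degree_diff_le) (auto simp: degree_monom_le)
    show "n \<le> degree p" using n by (intro le_degree) (auto simp: p_def)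
  qed
  have r0: "r \<noteq> 0"
  proof
    assume "r = 0"
    then have "monom (1::'a) (n * m) = 1" using pr by simp
    then have "degree (monom (1::'a) (n * m)) = 0" by simp
    then show False using n \<open>m > 0\<close> by (simp add: degree_monom_eq)
  qed
  have p0: "p \<noteq> 0" using dp n by auto
  have "degree (p * r) = n * m"
  proof (rule antisym)
    show "degree (p * r) \<le> n * m" unfolding pr
      by (rule degree_diff_le) (auto simp: degree_monom_le)
    show "n * m \<le> degree (p * r)" unfolding pr
      using n \<open>m > 0\<close> by (intro le_degree) auto
  qed
  then have dr: "degree r + n = n * m" using degree_mult_eq[OF p0 r0] dp by simp
  have "UNIV - {0} \<subseteq> {z. poly p z = 0} \<union> {z. poly r z = 0}"
  proof
    fix z :: 'a assume "z \<in> UNIV - {0}"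
    then have "poly (p * r) z = 0"
      using finite_field_fermat[of z] m by (simp add: pr poly_monom)
    then show "z \<in> {z. poly p z = 0} \<union> {z. poly r z = 0}" by auto
  qed
  then have "card (UNIV - {0::'a}) \<le> card ({z. poly p z = 0} \<union> {z. poly r z = 0})"
    by (rule card_mono[rotated]) simp
  also have "\<dots> \<le> card {z. poly p z = 0} + card {z. poly r z = 0}" by (rule card_Un_le)
  also have "\<dots> \<le> card {z. poly p z = 0} + degree r"
    using card_poly_roots_bound[OF r0] by simp
  finally have "n \<le> card {z. poly p z = 0}" using m dr by (simp add: card_Diff_singleton)
  moreover have "card {z. poly p z = 0} \<le> n" using card_poly_roots_bound[OF p0] dp by simp
  moreover have "{z. poly p z = 0} = {z. z ^ n = 1}" by (auto simp: p_def poly_monom)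
  ultimately show ?thesis by simp
qed

lemma card_nth_roots:
  assumes n: "n dvd CARD('a::{field, finite}) - 1" "n > 0" and b: "b \<noteq> 0"
  shows "card {z :: 'a. z ^ n = b ^ n} = n"
proof -
  have "bij_betw ((*) b) {z. z ^ n = 1} {z. z ^ n = b ^ n}"
    by (rule bij_betw_byWitness[of _ "\<lambda>z. z / b"])
      (use b in \<open>auto simp: power_mult_distrib power_divide\<close>)
  then show ?thesis using card_roots_of_unity[OF n] by (metis bij_betw_same_card)
qed

section \<open>The function field\<close>

lemma emb_simps [simp]:
  "emb 0 = 0" "emb 1 = 1" "emb (p + r) = emb p + emb r" "emb (p * r) = emb p * emb r"
  "emb (p - r) = emb p - emb r" "emb (- p) = - emb p"
  by (simp_all add: emb_def)

lemma emb_eq_iff [simp]: "emb p = emb r \<longleftrightarrow> p = r"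
  by (simp add: emb_def)

lemma emb_eq_0_iff [simp]: "emb p = 0 \<longleftrightarrow> p = 0"
  by (simp add: emb_def)

lemma emb_power: "emb (p ^ k) = emb p ^ k"
  by (induction k) auto

lemma emb_sum: "emb (sum p I) = (\<Sum>i\<in>I. emb (p i))"
  by (induction I rule: infinite_finite_induct) auto

lemma emb_prod: "emb (prod p I) = (\<Prod>i\<in>I. emb (p i))"
  by (induction I rule: infinite_finite_induct) auto

lemma cst_simps: "cst 0 = 0" "cst 1 = 1" "cst (a + b) = cst a + cst b" "cst (a * b) = cst a * cst b"
  "cst (- a) = - cst a" "cst (a - b) = cst a - cst b"
  by (simp_all add: emb_def flip: to_ac_add to_ac_mult to_ac_1 to_ac_minus to_ac_diff to_fract_add
      to_fract_mult to_fract_1 to_fract_uminus to_fract_diff)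

lemma cst_power: "cst (a ^ k) = cst a ^ k"
  by (induction k) (simp_all add: cst_simps)

lemma cst_sum: "cst (sum g I) = (\<Sum>i\<in>I. cst (g i))"
  by (induction I rule: infinite_finite_induct) (simp_all add: cst_simps)

lemma cst_inverse: "cst (inverse a) = inverse (cst a)"
proof (cases "a = 0")
  case False
  then have "cst a * cst (inverse a) = 1" by (simp add: cst_simps(2) flip: cst_simps(4))
  then show ?thesis by (metis inverse_unique)
qed (simp add: cst_simps)

lemma emb_pCons: "emb (pCons a p) = cst a + xfun * emb p"
proof -
  have "pCons a p = [:a:] + [:0, 1:] * p" by simp
  then show ?thesis by (metis emb_simps(3,4))
qed

lemma emb_altdef: "emb p = (\<Sum>i\<le>degree p. cst (coeff p i) * xfun ^ i)"
proof -
  have "emb p = emb (\<Sum>i\<le>degree p. monom (coeff p i) i)" by (simp add: poly_as_sum_of_monoms)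
  also have "\<dots> = (\<Sum>i\<le>degree p. cst (coeff p i) * xfun ^ i)"
    unfolding emb_sum by (intro sum.cong refl)
      (simp add: monom_altdef flip: emb_power emb_simps(4))
  finally show ?thesis .
qed

text \<open>
  At \<open>z = y\<close> this parametrises the function field; at its conjugates \<open>z = \<zeta>y\<close> it gives the Galois
  action.
\<close>

definition rat_eval :: "'a::{field, finite} ambient \<Rightarrow> 'a poly fract poly \<Rightarrow> 'a ambient" where
  "rat_eval z r = poly (map_poly to_ac r) z"

lemma rat_eval_0 [simp]: "rat_eval z 0 = 0"
  by (simp add: rat_eval_def)

lemma rat_eval_pCons [simp]: "rat_eval z (pCons a r) = to_ac a + z * rat_eval z r"
  by (simp add: rat_eval_def map_poly_pCons)

lemma rat_eval_1 [simp]: "rat_eval z 1 = 1"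
  by (simp add: one_pCons)

lemma rat_eval_add [simp]: "rat_eval z (r + s) = rat_eval z r + rat_eval z s"
proof (induction r arbitrary: s)
  case (pCons a r)
  then show ?case by (cases s) (simp_all add: algebra_simps)
qed simp

lemma rat_eval_smult [simp]: "rat_eval z (smult a r) = to_ac a * rat_eval z r"
  by (induction r) (simp_all add: algebra_simps)

lemma rat_eval_mult [simp]: "rat_eval z (r * s) = rat_eval z r * rat_eval z s"
  by (induction r) (simp_all add: algebra_simps)

lemma rat_eval_uminus [simp]: "rat_eval z (- r) = - rat_eval z r"
  using rat_eval_add[of z r "- r"] by (simp add: eq_neg_iff_add_eq_0 add.commute)

lemma rat_eval_diff [simp]: "rat_eval z (r - s) = rat_eval z r - rat_eval z s"
  using rat_eval_add[of z r "- s"] by simp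

lemma rat_eval_altdef: "rat_eval z r = (\<Sum>i\<le>degree r. to_ac (coeff r i) * z ^ i)"
  by (simp add: rat_eval_def poly_altdef degree_map_poly coeff_map_poly)

lemma rat_eval_altdef':
  assumes "degree r < m"
  shows "rat_eval z r = (\<Sum>i<m. to_ac (coeff r i) * z ^ i)"
  unfolding rat_eval_altdef using assms
  by (intro sum.mono_neutral_left) (auto simp: not_le coeff_eq_0)

lemma rat_eval_X: "rat_eval z [:0, 1:] = z"
  by simp

text \<open>
  A valuation ring of the ambient field that restricts to a discrete valuation ring of
  \<open>\<F>\<^sub>q(x)\<close> with uniformiser \<open>\<pi>\<close>.
\<close>

definition dominates :: "'a::{field, finite} ambient set \<Rightarrow> 'a ambient \<Rightarrow> bool" where
  "dominates V \<pi> \<longleftrightarrow> valuation_ring V \<and> \<pi> \<noteq> 0 \<and> \<pi> \<in> V \<and> inverse \<pi> \<notin> V \<and>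
     (\<forall>a. a \<noteq> 0 \<longrightarrow> vunit V (cst a)) \<and>
     (\<forall>r. r \<noteq> 0 \<longrightarrow> (\<exists>k::int. \<exists>u. vunit V u \<and> to_ac r = \<pi> powi k * u))"

lemma dominatesI:
  assumes V: "valuation_ring V" and p: "\<pi> \<noteq> 0" "\<pi> \<in> V" "inverse \<pi> \<notin> V"
    and c: "\<And>a. a \<noteq> 0 \<Longrightarrow> vunit V (cst a)"
    and e: "\<And>p. p \<noteq> 0 \<Longrightarrow> \<exists>k::int. \<exists>u. vunit V u \<and> emb p = \<pi> powi k * u"
  shows "dominates V \<pi>"
  unfolding dominates_def
proof (intro conjI allI impI)
  fix r :: "'a poly fract" assume r: "r \<noteq> 0"
  obtain a b where ab: "r = Fract a b" "b \<noteq> 0" by (cases r) auto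
  then have "a \<noteq> 0" using r by (auto simp: Fract_conv_to_fract)
  obtain k u where u: "vunit V u" "emb a = \<pi> powi k * u" using e[OF \<open>a \<noteq> 0\<close>] by blast
  obtain l w where w: "vunit V w" "emb b = \<pi> powi l * w" using e[OF ab(2)] by blast
  have "to_ac r = emb a / emb b" by (simp add: ab Fract_conv_to_fract emb_def)
  also have "\<dots> = \<pi> powi (k - l) * (u / w)" using u w p by (simp add: power_int_diff)
  finally have "to_ac r = \<pi> powi (k - l) * (u / w)" .
  moreover have "vunit V (u / w)"
    using vunit_divide[of V u w] u w V by (auto simp: valuation_ring_def)
  ultimately show "\<exists>k u. vunit V u \<and> to_ac r = \<pi> powi k * u" by blast
qed (use assms in auto)

lemma nonunit_multiple:
  assumes S: "unital_subring V" and p: "\<forall>a\<in>V. \<pi> * a \<noteq> 1" and a: "a \<in> V"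
  shows "\<not> vunit V (\<pi> * a)"
proof
  assume u: "vunit V (\<pi> * a)"
  then have "\<pi> * (a * inverse (\<pi> * a)) = 1"
    by (auto simp: vunit_def field_simps)
  moreover have "a * inverse (\<pi> * a) \<in> V"
    using S a u by (auto simp: vunit_def intro: subring_mult)
  ultimately show False using p by blast
qed

lemma subring_polys: "unital_subring (range (emb :: 'a::{field, finite} poly \<Rightarrow> _))"
  unfolding unital_subring_def by (auto simp flip: emb_simps)

text \<open>
  This is \<open>\<F>\<^sub>q[1/x]\<close>, written with numerators in \<open>x\<close> so that degrees can be read off.
\<close>

definition infinity_ring :: "'a::{field, finite} ambient set" where
  "infinity_ring = {emb p / xfun ^ m | p m. degree p \<le> m}"

lemma infinity_ringI: "degree p \<le> m \<Longrightarrow> emb p / xfun ^ m \<in> infinity_ring"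
  by (auto simp: infinity_ring_def)

lemma xfun_power: "xfun ^ m = emb (monom 1 m)"
  by (simp add: monom_altdef flip: emb_power)

lemma cst_infinity_ring: "cst a \<in> infinity_ring"
  using infinity_ringI[of "[:a:]" 0] by simp

lemma subring_infinity_ring: "unital_subring (infinity_ring :: 'a::{field, finite} ambient set)"
  unfolding unital_subring_def
proof (intro conjI ballI)
  let ?x = "xfun :: 'a ambient"
  show "1 \<in> infinity_ring" using infinity_ringI[of 1 0] by simp
  fix a b :: "'a ambient" assume "a \<in> infinity_ring" "b \<in> infinity_ring"
  then obtain p m r l where a: "a = emb p / ?x ^ m" "degree p \<le> m"
    and b: "b = emb r / ?x ^ l" "degree r \<le> l" by (auto simp: infinity_ring_def)
  have "a - b = emb (p * monom 1 l - r * monom 1 m) / ?x ^ (m + l)"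
    by (simp add: a b power_add field_simps flip: xfun_power)
  moreover have "degree (p * monom 1 l - r * monom 1 m) \<le> m + l"
    using a b by (intro degree_diff_le order.trans[OF degree_mult_le])
      (auto simp: degree_monom_eq)
  ultimately show "a - b \<in> infinity_ring" using infinity_ringI by metis
  have "a * b = emb (p * r) / ?x ^ (m + l)" by (simp add: a b power_add)
  moreover have "degree (p * r) \<le> m + l"
    using a b by (intro order.trans[OF degree_mult_le]) auto
  ultimately show "a * b \<in> infinity_ring" using infinity_ringI by metis
qed

text \<open>
  The coefficient of \<open>x\<^sup>m\<close> is the value at infinity.
\<close>

lemma infinity_ring_expand:
  assumes "degree p \<le> m"
  shows "\<exists>r'\<in>infinity_ring. emb p / xfun ^ m = cst (coeff p m) + inverse xfun * r'"
proof (cases "m = 0")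
  case True
  then obtain a where "p = [:a:]" using assms by (auto elim: degree_eq_zeroE)
  then show ?thesis using True subring_zero[OF subring_infinity_ring]
    by (intro bexI[of _ 0]) auto
next
  case False
  define r where "r = p - monom (coeff p m) m"
  have dr: "degree r \<le> m - 1"
    unfolding r_def
  proof (rule degree_le, intro allI impI)
    fix i assume "m - 1 < i"
    then show "coeff (p - monom (coeff p m) m) i = 0"
      using assms by (cases "i = m") (auto simp: coeff_eq_0)
  qed
  have "emb p = cst (coeff p m) * xfun ^ m + emb r"
    by (simp add: r_def monom_altdef flip: emb_power emb_simps(4))
  then have "emb p / xfun ^ m = cst (coeff p m) + emb r / xfun ^ m" by (simp add: add_divide_distrib)
  also have "emb r / xfun ^ m = inverse xfun * (emb r / xfun ^ (m - 1))"
    using False by (cases m) (auto simp: field_simps)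
  finally show ?thesis using infinity_ringI[OF dr] by blast
qed

text \<open>
  Chevalley's theorem for \<open>\<F>\<^sub>q[x]\<close> and \<open>\<pi> = P(x)\<close>.  Polynomials prime to \<open>P\<close> become units, because by
  Bezout they divide \<open>1\<close> up to a multiple of \<open>\<pi>\<close>.
\<close>

lemma dominating_finite:
  fixes P :: "'a::{field, finite} poly"
  assumes P: "irreducible P"
  shows "\<exists>V. dominates V (emb P) \<and> range emb \<subseteq> V \<and> (\<forall>p. \<not> P dvd p \<longrightarrow> vunit V (emb p))"
proof -
  note S = subring_polys[where 'a='a]
  have "\<not> P dvd 1" using P by (auto simp: irreducible_def)
  then have "\<forall>a\<in>range emb. emb P * a \<noteq> 1"
    by (auto simp: dvd_def simp flip: emb_simps)
  then obtain V where V: "valuation_ring V" "range (emb :: 'a poly \<Rightarrow> _) \<subseteq> V"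
      "\<forall>a\<in>V. emb P * a \<noteq> 1"
    using Chevalley_extension[OF S] by blast
  have SV: "unital_subring V" using V by (simp add: valuation_ring_def)
  have u: "vunit V (emb p)" if np: "\<not> P dvd p" for p
  proof (rule ccontr)
    assume n: "\<not> vunit V (emb p)"
    obtain a b where "a * p + b * P = 1" using irreducible_bezout[OF P np] by blast
    then have 1: "emb P * emb b + emb p * emb a = 1"
      by (metis add.commute emb_simps(2,3,4) mult.commute)
    have "\<forall>z\<in>V. emb p * z \<noteq> 1"
    proof (intro ballI notI)
      fix z assume "z \<in> V" "emb p * z = 1"
      then show False using n V(2)
        by (auto simp: vunit_def inverse_unique)
    qed
    then have "\<not> vunit V (emb p * emb a)" using nonunit_multiple[OF SV] V(2) by blast
    moreover have "\<not> vunit V (emb P * emb b)" using nonunit_multiple[OF SV V(3)] V(2) by blast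
    ultimately have "\<not> vunit V (emb P * emb b + emb p * emb a)"
      using V SV by (intro nonunit_add) (auto intro!: subring_mult)
    then show False using 1 vunit_one[OF SV] by simp
  qed
  have P0: "P \<noteq> 0" using P by auto
  have "dominates V (emb P)"
  proof (rule dominatesI[OF V(1)])
    show "emb P \<noteq> 0" "emb P \<in> V" using P0 V by auto
    show "inverse (emb P) \<notin> V" using V(3) P0 by (auto dest!: bspec)
    show "vunit V (cst a)" if "a \<noteq> 0" for a
    proof (rule u, rule)
      assume "P dvd [:a:]"
      moreover have "[:a:] dvd 1" using that by (subst is_unit_iff_degree) auto
      ultimately show False using \<open>\<not> P dvd 1\<close> dvd_trans by blast
    qed
    show "\<exists>k::int. \<exists>u. vunit V u \<and> emb p = emb P powi k * u" if p: "p \<noteq> 0" for p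
    proof -
      obtain k p' where "p = P ^ k * p'" "\<not> P dvd p'" using irreducible_power_decomp[OF P p] by blast
      then show ?thesis using u by (intro exI[of _ "int k"] exI[of _ "emb p'"]) (simp add: emb_power)
    qed
  qed
  then show ?thesis using V u by blast
qed

text \<open>
  Chevalley's theorem for \<open>\<F>\<^sub>q[1/x]\<close> and \<open>\<pi> = 1/x\<close>.  The unit that belongs to a polynomial \<open>p\<close> is
  \<open>p/x\<^sup>m\<close> with \<open>m = deg p\<close>, which differs from a nonzero constant by a multiple of \<open>1/x\<close>.
\<close>

lemma dominating_infinite:
  "\<exists>V. dominates V (inverse (xfun :: 'a::{field, finite} ambient))"
proof -
  let ?x = "xfun :: 'a ambient"
  have x0: "?x \<noteq> 0" by simp
  note S = subring_infinity_ring[where 'a='a]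
  let ?R = "infinity_ring :: 'a ambient set"
  have piR: "inverse ?x \<in> ?R" using infinity_ringI[of 1 1] by (simp add: field_simps)
  have "\<forall>a\<in>?R. inverse ?x * a \<noteq> 1"
  proof (intro ballI notI)
    fix a assume "a \<in> ?R" "inverse ?x * a = 1"
    then obtain p m where pm: "degree p \<le> m" "inverse ?x * (emb p / ?x ^ m) = 1"
      by (auto simp: infinity_ring_def)
    then have "emb p = ?x ^ Suc m" by (simp add: field_simps)
    then have "p = monom 1 (Suc m)" by (simp only: xfun_power emb_eq_iff)
    then show False using pm by (simp add: degree_monom_eq)
  qed
  then obtain V where V: "valuation_ring V" "?R \<subseteq> V" "\<forall>a\<in>V. inverse ?x * a \<noteq> 1"
    using Chevalley_extension[OF S piR] by blast
  have SV: "unital_subring V" using V by (simp add: valuation_ring_def)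
  have c: "vunit V (cst a)" if "a \<noteq> 0" for a
  proof -
    have "cst b \<in> V" for b using cst_infinity_ring V(2) by blast
    then show ?thesis using that by (simp add: vunit_def flip: cst_inverse)
  qed
  have "dominates V (inverse ?x)"
  proof (rule dominatesI[OF V(1)])
    show "inverse ?x \<noteq> 0" "inverse ?x \<in> V" using piR V x0 by auto
    show "inverse (inverse ?x) \<notin> V" using V(3) x0 by (auto dest!: bspec)
    show "vunit V (cst a)" if "a \<noteq> 0" for a using c that .
    show "\<exists>k::int. \<exists>u. vunit V u \<and> emb p = inverse ?x powi k * u" if p: "p \<noteq> 0" for p
    proof -
      define m where "m = degree p"
      define u where "u = emb p / ?x ^ m"
      have uV: "u \<in> V" using infinity_ringI[of p m] V(2) by (auto simp: u_def m_def)
      have "vunit V u"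
      proof (rule ccontr)
        assume n: "\<not> vunit V u"
        obtain r' where r': "r' \<in> ?R" "u = cst (lead_coeff p) + inverse ?x * r'"
          using infinity_ring_expand[of p m] by (auto simp: u_def m_def)
        then have rV: "- r' \<in> V" using V(2) subring_uminus[OF SV] by blast
        then have "inverse ?x * - r' \<in> V" using piR V(2) by (intro subring_mult[OF SV]) auto
        then have "\<not> vunit V (u + inverse ?x * - r')"
          using uV n nonunit_multiple[OF SV V(3) rV] by (intro nonunit_add[OF V(1)])
        then show False using c p r' by simp
      qed
      moreover have "emb p = inverse ?x powi (- int m) * u"
        using x0 by (simp add: u_def power_int_minus power_inverse)
      ultimately show ?thesis by blast
    qed
  qed
  then show ?thesis by blast
qed

lemma dominates_power_unit:
  assumes V: "dominates V \<pi>" and u: "vunit V (\<pi> powi k)"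
  shows "k = 0"
proof (rule ccontr)
  assume "k \<noteq> 0"
  have SV: "unital_subring V" and p: "\<pi> \<noteq> 0" "\<pi> \<in> V" "inverse \<pi> \<notin> V"
    using V by (auto simp: dominates_def valuation_ring_def)
  have *: False if "vunit V (\<pi> ^ m)" "m > 0" for m
  proof -
    have "inverse \<pi> = \<pi> ^ (m - 1) * inverse (\<pi> ^ m)"
      using that p by (cases m) (auto simp: field_simps)
    also have "\<dots> \<in> V" using that SV p by (intro subring_mult subring_power) (auto simp: vunit_def)
    finally show False using p by simp
  qed
  show False
  proof (cases "k > 0")
    case True
    then show False using *[of "nat k"] u by (simp add: power_int_def)
  next
    case False
    then have "vunit V (inverse (\<pi> powi k))" using u by (simp add: vunit_inverse)
    then show False using *[of "nat (- k)"] False \<open>k \<noteq> 0\<close> p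
      by (simp add: power_int_def power_inverse)
  qed
qed

lemma dominates_to_ac:
  "dominates V \<pi> \<Longrightarrow> r \<noteq> 0 \<Longrightarrow> \<exists>k::int. \<exists>u. vunit V u \<and> to_ac r = \<pi> powi k * u"
  by (simp add: dominates_def)

locale superelliptic_curve =
  fixes n d :: nat and f :: "'a::{field, finite} poly"
  assumes superelliptic: "superelliptic n d f"
begin

abbreviation y :: "'a ambient" where "y \<equiv> yfun n f"
abbreviation x :: "'a ambient" where "x \<equiv> xfun"
abbreviation K :: "'a ambient set" where "K \<equiv> function_field n f"
abbreviation place :: "'a place \<Rightarrow> bool" where "place \<equiv> is_place n f"

lemma n_ge_2: "2 \<le> n" and d_ge_3: "3 \<le> d" and n_dvd: "n dvd CARD('a) - 1"
  and degree_f: "degree f = d" and coprime_f: "coprime f (pderiv f)" and f_no_root: "poly f a \<noteq> 0"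
  using superelliptic by (auto simp: superelliptic_def)

lemma f_neq_0: "f \<noteq> 0"
  using degree_f d_ge_3 by auto

lemma of_nat_n_neq_0: "(of_nat n :: 'a) \<noteq> 0"
  using of_nat_neq_0_of_dvd[OF n_dvd] .

lemma y_power: "y ^ n = emb f"
  using n_ge_2 by (intro yfun_power) simp

lemma y_neq_0: "y \<noteq> 0"
proof
  assume "y = 0"
  then have "emb f = 0" using y_power n_ge_2 by (metis not_numeral_le_zero power_eq_0_iff power_0_left)
  then show False using f_neq_0 by simp
qed

text \<open>
  Irreducible by \<open>y_degree\<close> below, so that arithmetic in the function field is arithmetic of
  polynomials modulo this one.
\<close>

definition kummer_poly :: "'a poly fract poly" where
  "kummer_poly = monom 1 n - [:to_fract f:]"

lemma degree_kummer_poly: "degree kummer_poly = n"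
proof (rule antisym)
  show "degree kummer_poly \<le> n" unfolding kummer_poly_def
    by (rule degree_diff_le) (auto simp: degree_monom_le)
  show "n \<le> degree kummer_poly"
    using n_ge_2 by (intro le_degree) (auto simp: kummer_poly_def coeff_pCons split: nat.splits)
qed

lemma kummer_poly_neq_0: "kummer_poly \<noteq> 0"
  using degree_kummer_poly n_ge_2 by auto

lemma rat_eval_monom: "rat_eval z (monom a k) = to_ac a * z ^ k"
  by (simp add: rat_eval_def poly_monom map_poly_monom)

lemma rat_eval_kummer_poly: "z ^ n = emb f \<Longrightarrow> rat_eval z kummer_poly = 0"
  by (simp add: kummer_poly_def rat_eval_monom emb_def)

text \<open>
  Separability of \<open>f\<close> enters as squarefreeness.
\<close>

lemma irreducible_factor_f:
  assumes P: "irreducible P" and dvd: "P dvd f"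
  obtains f1 where "f = P * f1" "\<not> P dvd f1"
proof -
  obtain f1 where f1: "f = P * f1" using dvd by (rule dvdE)
  have "\<not> P dvd f1"
  proof
    assume "P dvd f1"
    then have "P dvd pderiv f" by (simp add: f1 pderiv_mult)
    then have "is_unit P" using coprime_f dvd by (auto simp: coprime_def)
    then show False using P by (simp add: irreducible_def)
  qed
  then show ?thesis using f1 that by blast
qed

text \<open>
  Let \<open>P\<close> be an irreducible factor of \<open>f\<close> and extend the valuation at \<open>P\<close> to the algebraic closure.
  As \<open>P\<close> divides \<open>f\<close> exactly once, \<open>y\<close> has value \<open>1/n\<close>, so the values of the terms
  \<open>r\<^sub>j y\<^sup>j\<close>, \<open>j < n\<close>, are distinct modulo \<open>\<int>\<close> and no two terms can tie.
\<close>

theorem y_degree: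
  assumes deg: "degree r < n" and r: "rat_eval y r = 0"
  shows "r = 0"
proof (rule ccontr)
  assume r0: "r \<noteq> 0"
  obtain P where P: "irreducible P" "P dvd f"
    using irreducible_factor_exists[of f] degree_f d_ge_3 by auto
  obtain f1 where f1: "f = P * f1" "\<not> P dvd f1" using irreducible_factor_f[OF P] .
  obtain V where V: "dominates V (emb P)" "\<And>p. \<not> P dvd p \<Longrightarrow> vunit V (emb p)"
    using dominating_finite[OF P(1)] by blast
  have VR: "valuation_ring V" and SV: "unital_subring V" and P0: "emb P \<noteq> 0"
    using V by (auto simp: dominates_def valuation_ring_def)
  define I where "I = {j. j < n \<and> coeff r j \<noteq> 0}"
  define t where "t = (\<lambda>j. to_ac (coeff r j) * y ^ j)"
  have "degree r \<in> I" using r0 deg by (simp add: I_def)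
  then have I: "finite I" "I \<noteq> {}" by (auto simp: I_def)
  have "rat_eval y r = sum t I"
    unfolding rat_eval_altdef'[OF deg] t_def I_def by (rule sum.mono_neutral_right) auto
  then have "sum t I = 0" using r by simp
  moreover have "t i \<noteq> 0" if "i \<in> I" for i using that y_neq_0 by (simp add: t_def I_def)
  ultimately obtain i j where ij: "i \<in> I" "j \<in> I" "i \<noteq> j" "vunit V (t i / t j)"
    using zero_sum_tie[OF VR I] by blast
  \<comment> \<open>The value of \<open>t i\<close> is \<open>k + i/n\<close>; the \<open>n\<close>-th power avoids the fraction.\<close>
  have tn: "\<exists>k u. vunit V u \<and> t i ^ n = emb P powi (int n * k + int i) * u" if "i \<in> I" for i
  proof -
    have "coeff r i \<noteq> 0" using that by (simp add: I_def)
    from dominates_to_ac[OF V(1) this]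
    obtain k u where u: "vunit V u" "to_ac (coeff r i) = emb P powi k * u" by blast
    have pw: "emb P powi (int n * k + int i) = (emb P powi k) ^ n * emb P ^ i"
      using P0 by (simp add: power_int_add mult.commute[of "int n"] power_int_mult)
    have "t i ^ n = (emb P powi k * u) ^ n * (y ^ n) ^ i"
      by (simp add: t_def u(2) power_mult_distrib flip: power_mult) (simp add: mult.commute)
    also have "\<dots> = (emb P powi k * u) ^ n * (emb P * emb f1) ^ i"
      unfolding y_power by (simp add: f1(1))
    also have "\<dots> = emb P powi (int n * k + int i) * (u ^ n * emb f1 ^ i)"
      unfolding pw by (simp add: power_mult_distrib mult_ac)
    finally show ?thesis
      using u V(2)[OF f1(2)] SV by (meson vunit_mult vunit_power)
  qed
  obtain k u where k: "vunit V u" "t i ^ n = emb P powi (int n * k + int i) * u"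
    using tn ij by blast
  obtain l w where l: "vunit V w" "t j ^ n = emb P powi (int n * l + int j) * w"
    using tn ij by blast
  have "vunit V ((t i / t j) ^ n * (w / u))"
    by (rule vunit_mult[OF SV vunit_power[OF SV ij(4)] vunit_divide[OF SV l(1) k(1)]])
  moreover have "(t i / t j) ^ n * (w / u) = emb P powi ((int n * k + int i) - (int n * l + int j))"
    using P0 k l by (simp add: power_divide power_int_diff vunit_def field_simps)
  ultimately have "vunit V (emb P powi ((int n * k + int i) - (int n * l + int j)))" by simp
  then have "(int n * k + int i) - (int n * l + int j) = 0"
    using dominates_power_unit[OF V(1)] by blast
  then have "int i mod int n = int j mod int n"
    by (metis add.commute eq_iff_diff_eq_0 mod_mult_self2)
  then show False using ij by (simp add: I_def)
qed

lemma function_field_eq: "K = range (rat_eval y)"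
  by (simp add: function_field_def rat_eval_def)

lemma K_mult: "g \<in> K \<Longrightarrow> h \<in> K \<Longrightarrow> g * h \<in> K"
  and K_add: "g \<in> K \<Longrightarrow> h \<in> K \<Longrightarrow> g + h \<in> K"
  and K_diff: "g \<in> K \<Longrightarrow> h \<in> K \<Longrightarrow> g - h \<in> K"
  by (auto simp: function_field_eq simp flip: rat_eval_mult rat_eval_add rat_eval_diff)

lemma K_to_ac: "to_ac r \<in> K"
proof -
  have "to_ac r = rat_eval y [:r:]" by simp
  then show ?thesis unfolding function_field_eq by blast
qed

lemma K_emb: "emb p \<in> K"
  by (simp add: emb_def K_to_ac)

lemma K_y: "y \<in> K"
  using rat_eval_X[of y] unfolding function_field_eq by (metis rangeI)

lemma K_0: "0 \<in> K" and K_1: "1 \<in> K"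
  using K_emb[of 0] K_emb[of 1] by simp_all

lemma K_uminus: "h \<in> K \<Longrightarrow> - h \<in> K"
  using K_diff[OF K_0, of h] by simp

lemma K_power: "h \<in> K \<Longrightarrow> h ^ k \<in> K"
  by (induction k) (auto intro: K_1 K_mult)

lemma K_sum: "(\<And>i. i \<in> I \<Longrightarrow> h i \<in> K) \<Longrightarrow> sum h I \<in> K"
  by (induction I rule: infinite_finite_induct) (auto intro: K_0 K_add)

lemmas K_closed = K_mult K_add K_diff K_to_ac K_emb K_y K_0 K_1 K_uminus K_power K_sum

lemma rat_eval_mod: 
  assumes "z ^ n = emb f" shows "rat_eval z (r mod kummer_poly) = rat_eval z r"
proof -
  have "rat_eval z (r div kummer_poly * kummer_poly + r mod kummer_poly) = rat_eval z r"
    by (simp only: div_mult_mod_eq)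
  then show ?thesis
    by (simp only: rat_eval_add rat_eval_mult rat_eval_kummer_poly[OF assms]) simp
qed

lemma degree_mod_kummer: "degree (r mod kummer_poly) < n"
  using degree_mod_less[OF kummer_poly_neq_0, of r] degree_kummer_poly n_ge_2 by auto

lemma K_rep:
  assumes "h \<in> K" obtains r where "degree r < n" "h = rat_eval y r"
proof -
  obtain r where "h = rat_eval y r" using assms by (auto simp: function_field_eq)
  then show ?thesis
    using that[of "r mod kummer_poly"] rat_eval_mod[OF y_power] degree_mod_kummer by simp
qed

text \<open>
  Bezout against the irreducible polynomial \<open>Y\<^sup>n - f\<close>: a common factor with a representing polynomial
  of \<open>h\<close> must be constant, as its cofactor vanishes at \<open>y\<close> and so has degree \<open>n\<close>.
\<close>

lemma K_inverse:
  assumes h: "h \<in> K" shows "inverse h \<in> K"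
proof (cases "h = 0")
  case True
  then show ?thesis using K_0 by simp
next
  case False
  obtain r where r: "h = rat_eval y r" using h by (auto simp: function_field_eq)
  obtain g a b where g: "g dvd r" "g dvd kummer_poly" "g = a * r + b * kummer_poly"
    using poly_bezout by blast
  have gy: "rat_eval y g = rat_eval y a * h"
    by (simp add: g(3) r rat_eval_kummer_poly y_power)
  obtain s where s: "r = g * s" using g(1) by (rule dvdE)
  obtain k where k: "kummer_poly = g * k" using g(2) by (rule dvdE)
  have g0: "rat_eval y g \<noteq> 0" using s r False by auto
  have "rat_eval y g * rat_eval y k = 0"
    using rat_eval_kummer_poly[OF y_power] k by (metis rat_eval_mult)
  then have ky: "rat_eval y k = 0" using g0 by simp
  have nz: "g \<noteq> 0" "k \<noteq> 0" using k kummer_poly_neq_0 by auto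
  then have "n \<le> degree k" using y_degree[OF _ ky] by force
  moreover have "degree g + degree k = n"
    using degree_kummer_poly nz by (simp add: k degree_mult_eq)
  ultimately have "degree g = 0" by simp
  then obtain c where c: "g = [:c:]" by (rule degree_eq_zeroE)
  then have "inverse h = rat_eval y a * to_ac (inverse c)"
    using gy g0 False by (simp add: field_simps)
  moreover have "rat_eval y a \<in> K" by (simp add: function_field_eq)
  ultimately show ?thesis by (simp only: K_mult K_to_ac)
qed

subsection \<open>The Galois action\<close>

text \<open>
  The substitution \<open>y \<mapsto> zy\<close>; for \<open>z\<^sup>n = 1\<close> it depends only on \<open>h\<close>, by \<open>galois_rat_eval\<close>, so the
  choice of a representing polynomial is harmless.
\<close>

definition galois :: "'a \<Rightarrow> 'a ambient \<Rightarrow> 'a ambient" where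
  "galois z h = rat_eval (cst z * y) (SOME r. h = rat_eval y r)"

lemma cst_y_power: "z ^ n = 1 \<Longrightarrow> (cst z * y) ^ n = emb f"
  by (simp add: power_mult_distrib y_power cst_simps flip: cst_power)

lemma galois_rat_eval:
  assumes z: "z ^ n = 1" shows "galois z (rat_eval y r) = rat_eval (cst z * y) r"
proof -
  define s where "s = (SOME s. rat_eval y r = rat_eval y s)"
  have "rat_eval y r = rat_eval y s" unfolding s_def by (rule someI) (rule refl)
  then have "rat_eval y ((r - s) mod kummer_poly) = 0" by (simp add: rat_eval_mod y_power)
  then have "(r - s) mod kummer_poly = 0" using y_degree degree_mod_kummer by blast
  then have "rat_eval (cst z * y) (r - s) = 0"
    using rat_eval_mod[OF cst_y_power[OF z], of "r - s"] by simp
  then show ?thesis by (simp add: galois_def s_def)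
qed

lemma galois_mult: "z ^ n = 1 \<Longrightarrow> g \<in> K \<Longrightarrow> h \<in> K \<Longrightarrow> galois z (g * h) = galois z g * galois z h"
  and galois_add: "z ^ n = 1 \<Longrightarrow> g \<in> K \<Longrightarrow> h \<in> K \<Longrightarrow> galois z (g + h) = galois z g + galois z h"
  by (auto simp: function_field_eq galois_rat_eval simp flip: rat_eval_mult rat_eval_add)

lemma galois_to_ac: "z ^ n = 1 \<Longrightarrow> galois z (to_ac r) = to_ac r"
  using galois_rat_eval[of z "[:r:]"] by simp

lemma galois_emb: "z ^ n = 1 \<Longrightarrow> galois z (emb p) = emb p"
  by (simp add: emb_def galois_to_ac)

lemma galois_0: "z ^ n = 1 \<Longrightarrow> galois z 0 = 0"
  using galois_emb[of z 0] by simp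

lemma galois_y: "z ^ n = 1 \<Longrightarrow> galois z y = cst z * y"
  using galois_rat_eval[of z "[:0, 1:]"] by simp

lemma galois_K: "z ^ n = 1 \<Longrightarrow> h \<in> K \<Longrightarrow> galois z h \<in> K"
proof -
  assume z: "z ^ n = 1" and "h \<in> K"
  then obtain r where "h = rat_eval y r" by (auto simp: function_field_eq)
  then have "galois z h = (\<Sum>i\<le>degree r. to_ac (coeff r i) * (cst z * y) ^ i)"
    using z by (simp add: galois_rat_eval rat_eval_altdef[of "cst z * y"])
  then show ?thesis by (simp add: K_closed)
qed

lemma galois_power: "z ^ n = 1 \<Longrightarrow> h \<in> K \<Longrightarrow> galois z (h ^ k) = galois z h ^ k"
  by (induction k) (use galois_emb[of z 1] in \<open>auto simp: galois_mult K_closed\<close>)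

lemma galois_sum:
  "z ^ n = 1 \<Longrightarrow> (\<And>i. i \<in> I \<Longrightarrow> h i \<in> K) \<Longrightarrow> galois z (sum h I) = (\<Sum>i\<in>I. galois z (h i))"
  by (induction I rule: infinite_finite_induct) (auto simp: galois_0 galois_add K_closed)

lemma galois_galois:
  assumes "z ^ n = 1" "w ^ n = 1" "h \<in> K" shows "galois w (galois z h) = galois (w * z) h"
proof -
  obtain r where r: "degree r < n" "h = rat_eval y r" using K_rep assms by metis
  have wz: "(w * z) ^ n = 1" using assms by (simp add: power_mult_distrib)
  have "galois z h = (\<Sum>i<n. to_ac (coeff r i) * (cst z * y) ^ i)"
    using assms r(2) by (simp add: galois_rat_eval rat_eval_altdef'[OF r(1), of "cst z * y"])
  then have "galois w (galois z h) = (\<Sum>i<n. galois w (to_ac (coeff r i) * (cst z * y) ^ i))"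
    using assms by (simp add: galois_sum K_closed)
  also have "\<dots> = (\<Sum>i<n. to_ac (coeff r i) * (cst (w * z) * y) ^ i)"
    using assms by (intro sum.cong refl)
      (simp add: galois_mult galois_power galois_to_ac galois_emb galois_y K_closed cst_simps mult_ac)
  also have "\<dots> = galois (w * z) h"
    using r(2) wz by (simp add: galois_rat_eval rat_eval_altdef'[OF r(1), of "cst (w * z) * y"])
  finally show ?thesis .
qed

lemma galois_1: "h \<in> K \<Longrightarrow> galois 1 h = h"
  by (auto simp: function_field_eq galois_rat_eval cst_simps)

lemma galois_inverse:
  assumes "z ^ n = 1" "h \<in> K" shows "galois (inverse z) (galois z h) = h"
proof -
  have "z \<noteq> 0" using assms(1) n_ge_2 by (cases "z = 0") (auto simp: power_0_left)
  then show ?thesis using assms by (subst galois_galois) (auto simp: power_inverse galois_1)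
qed

lemma galois_eq_0_iff: "z ^ n = 1 \<Longrightarrow> h \<in> K \<Longrightarrow> galois z h = 0 \<longleftrightarrow> h = 0"
  using galois_inverse[of z h] galois_0[of z] galois_0[of "inverse z"]
  by (auto simp: power_inverse)

subsection \<open>Existence of places\<close>

text \<open>
  The function field is spanned by \<open>y\<^sup>0, \<dots>, y\<^sup>n\<^sup>-\<^sup>1\<close> over \<open>\<F>\<^sub>q(x)\<close>, so \<open>h\<^sup>0, \<dots>, h\<^sup>n\<close> satisfy a linear
  relation.  Two of its terms tie, which makes a power \<open>h\<^sup>m\<close> with \<open>0 < m \<le> n\<close> associated to an element
  of \<open>\<F>\<^sub>q(x)\<close>, that is, to a power of \<open>\<pi>\<close>.
\<close>

lemma K_power_valuation:
  assumes V: "dominates V \<pi>" and h: "h \<in> K" "h \<noteq> 0"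
  shows "\<exists>m k u. 0 < m \<and> m \<le> n \<and> vunit V u \<and> h ^ m = \<pi> powi k * u"
proof -
  have VR: "valuation_ring V" and SV: "unital_subring V" and p0: "\<pi> \<noteq> 0"
    using V by (auto simp: dominates_def valuation_ring_def)
  interpret F: vector_space "\<lambda>r (z :: 'a ambient). to_ac r * z"
    by unfold_locales (auto simp: algebra_simps)
  have hy: "h ^ i \<in> F.span ((\<lambda>j. y ^ j) ` {..<n})" for i
  proof -
    obtain r where r: "degree r < n" "h ^ i = rat_eval y r" using K_rep h K_power by metis
    show ?thesis unfolding r(2) rat_eval_altdef'[OF r(1)]
      by (intro F.span_sum F.span_scale F.span_base) auto
  qed
  have *: "\<exists>i\<le>n. \<exists>j\<le>n. i \<noteq> j \<and> (\<exists>k u. vunit V u \<and> h ^ i = h ^ j * (\<pi> powi k * u))"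
  proof (cases "inj_on (\<lambda>i. h ^ i) {..n}")
    case False
    then obtain i j where "i \<le> n" "j \<le> n" "i \<noteq> j" "h ^ i = h ^ j" by (auto simp: inj_on_def)
    moreover have "h ^ i = h ^ j * (\<pi> powi 0 * 1)" using calculation by simp
    ultimately show ?thesis using vunit_one[OF SV] by blast
  next
    case True
    define S where "S = (\<lambda>i. h ^ i) ` {..n}"
    have "F.dependent S"
    proof (rule ccontr)
      assume "\<not> F.dependent S"
      then have "card S \<le> card ((\<lambda>j. y ^ j) ` {..<n})"
        using F.independent_span_bound[of "(\<lambda>j. y ^ j) ` {..<n}" S] hy by (auto simp: S_def)
      also have "\<dots> \<le> n" using card_image_le[of "{..<n}" "\<lambda>j. y ^ j"] by simp
      finally show False using True by (simp add: S_def card_image)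
    qed
    then obtain t c where t: "finite t" "t \<subseteq> S" "(\<Sum>v\<in>t. to_ac (c v) * v) = 0" "\<exists>v\<in>t. c v \<noteq> 0"
      unfolding F.dependent_explicit by blast
    define I where "I = {v \<in> t. c v \<noteq> 0}"
    have I: "finite I" "I \<noteq> {}" using t by (auto simp: I_def)
    have "(\<Sum>v\<in>I. to_ac (c v) * v) = 0"
      using t(3) by (subst (asm) sum.mono_neutral_right[of t I]) (use t(1) in \<open>auto simp: I_def\<close>)
    moreover have "to_ac (c v) * v \<noteq> 0" if "v \<in> I" for v
      using that t(2) h by (auto simp: I_def S_def)
    ultimately obtain v w where vw: "v \<in> I" "w \<in> I" "v \<noteq> w"
        "vunit V ((to_ac (c v) * v) / (to_ac (c w) * w))"
      using zero_sum_tie[OF VR I, of "\<lambda>v. to_ac (c v) * v"] by auto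
    obtain i j where ij: "i \<le> n" "j \<le> n" "v = h ^ i" "w = h ^ j"
      using vw(1,2) t(2) unfolding I_def S_def by blast
    have nz: "c w \<noteq> 0" "c v \<noteq> 0" using vw by (auto simp: I_def)
    then have "c w / c v \<noteq> 0" by simp
    from dominates_to_ac[OF V this]
    obtain k u where u: "vunit V u" "to_ac (c w / c v) = \<pi> powi k * u" by blast
    have "h ^ i = h ^ j * (to_ac (c w / c v) * ((to_ac (c v) * v) / (to_ac (c w) * w)))"
      using nz h ij by (simp add: field_simps)
    also have "\<dots> = h ^ j * (\<pi> powi k * (u * ((to_ac (c v) * v) / (to_ac (c w) * w))))"
      unfolding u(2) by (simp add: mult_ac)
    finally show ?thesis using u vw ij vunit_mult[OF SV] by blast
  qed
  obtain i j k u where ij: "i \<le> n" "j \<le> n" "i \<noteq> j" "vunit V u" "h ^ i = h ^ j * (\<pi> powi k * u)"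
    using * by blast
  show ?thesis
  proof (cases "j < i")
    case True
    then have "h ^ (i - j) = \<pi> powi k * u"
      using ij h by (simp add: power_diff)
    then show ?thesis using True ij by (intro exI[of _ "i - j"]) auto
  next
    case False
    then have "j > i" using ij by simp
    then have "h ^ (j - i) = \<pi> powi (- k) * inverse u"
      using ij(5) h p0 ij(4) by (simp add: power_diff power_int_minus vunit_def field_simps)
    then show ?thesis using \<open>j > i\<close> ij vunit_inverse[OF ij(4)] by (intro exI[of _ "j - i"]) auto
  qed
qed

text \<open>
  By the previous lemma \<open>h\<^bsup>n!\<^esup>\<close> is associated to some \<open>\<pi>\<^sup>k\<close>, and \<open>h \<mapsto> k\<close> is a valuation with values
  in \<open>\<int>\<close>.  Its value group is generated by its least positive element; dividing by that element
  makes it surjective.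
\<close>

theorem place_of_valuation_ring:
  assumes V: "dominates V \<pi>" and pK: "\<pi> \<in> K"
  shows "\<exists>v. place v \<and> (\<forall>h\<in>K. h \<noteq> 0 \<longrightarrow> (v h \<ge> 0 \<longleftrightarrow> h \<in> V))"
proof -
  have VR: "valuation_ring V" and SV: "unital_subring V"
    and p: "\<pi> \<noteq> 0" "\<pi> \<in> V" "inverse \<pi> \<notin> V" and cu: "\<And>a. a \<noteq> 0 \<Longrightarrow> vunit V (cst a)"
    using V by (auto simp: dominates_def valuation_ring_def)
  define N where "N = (fact n :: nat)"
  have N0: "N > 0" by (simp add: N_def)
  have ex: "\<exists>k u. vunit V u \<and> h ^ N = \<pi> powi k * u" if h: "h \<in> K" "h \<noteq> 0" for h
  proof -
    obtain m k u where m: "0 < m" "m \<le> n" "vunit V u" "h ^ m = \<pi> powi k * u"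
      using K_power_valuation[OF V h] by blast
    then obtain l where l: "N = m * l" unfolding N_def using dvd_fact[of m n] by (auto elim: dvdE)
    have "h ^ N = \<pi> powi (k * int l) * u ^ l"
      by (simp add: l power_mult m(4) power_mult_distrib power_int_mult)
    then show ?thesis using vunit_power[OF SV m(3)] by blast
  qed
  have uniq: "k = l" if "vunit V u" "vunit V w" "\<pi> powi k * u = \<pi> powi l * w" for k l u w
  proof -
    have "\<pi> powi (k - l) = w / u"
      using that p by (simp add: power_int_diff vunit_def field_simps)
    then have "vunit V (\<pi> powi (k - l))" using that vunit_divide[OF SV] by simp
    then show ?thesis using dominates_power_unit[OF V] by fastforce
  qed
  have mem: "h \<in> V \<longleftrightarrow> k \<ge> 0" if h: "h \<noteq> 0" "vunit V u" "h ^ N = \<pi> powi k * u" for h k u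
  proof
    assume hV: "h \<in> V"
    show "k \<ge> 0"
    proof (rule ccontr)
      assume k: "\<not> k \<ge> 0"
      define m where "m = nat (- k)"
      have m: "m > 0" using k by (simp add: m_def)
      have "\<pi> powi k = inverse \<pi> ^ m" using k p by (simp add: m_def power_int_def)
      then have "h ^ N * inverse u = inverse \<pi> ^ m" using h by (simp add: vunit_def)
      then have "inverse \<pi> = (h ^ N * inverse u) * \<pi> ^ (m - 1)"
        using m p by (cases m) (auto simp: field_simps)
      also have "\<dots> \<in> V" using hV h SV p by (intro subring_mult subring_power) (auto simp: vunit_def)
      finally show False using p by simp
    qed
  next
    assume k: "k \<ge> 0"
    show "h \<in> V"
    proof (rule ccontr)
      assume "h \<notin> V"
      then have iV: "inverse h \<in> V" using VR h by (auto simp: valuation_ring_def)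
      have "h ^ N \<in> V" using h k p SV
        by (auto simp: power_int_def vunit_def intro!: subring_mult subring_power)
      moreover have "h = h ^ N * inverse h ^ (N - 1)"
        using h(1) N0 by (cases N) (auto simp: field_simps)
      ultimately show False using \<open>h \<notin> V\<close> iV SV by (metis subring_mult subring_power)
    qed
  qed
  define W where "W = (\<lambda>h. THE k. \<exists>u. vunit V u \<and> h ^ N = \<pi> powi k * u)"
  have Weq: "W h = k" if "vunit V u" "h ^ N = \<pi> powi k * u" for h k u
    unfolding W_def
  proof (rule the_equality)
    show "\<exists>u. vunit V u \<and> h ^ N = \<pi> powi k * u" using that by blast
    show "l = k" if "\<exists>u. vunit V u \<and> h ^ N = \<pi> powi l * u" for l
      using that uniq[OF _ \<open>vunit V u\<close>, of _ l k] \<open>h ^ N = \<pi> powi k * u\<close> by auto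
  qed
  have Wex: "\<exists>u. vunit V u \<and> h ^ N = \<pi> powi W h * u" if "h \<in> K" "h \<noteq> 0" for h
    using ex[OF that] Weq by blast
  have Wmult: "W (g * h) = W g + W h" if gh: "g \<in> K" "h \<in> K" "g \<noteq> 0" "h \<noteq> 0" for g h
  proof -
    obtain u w where u: "vunit V u" "g ^ N = \<pi> powi W g * u" and w: "vunit V w" "h ^ N = \<pi> powi W h * w"
      using Wex gh by blast
    have "(g * h) ^ N = \<pi> powi (W g + W h) * (u * w)"
      using p by (simp add: power_mult_distrib u(2) w(2) power_int_add mult_ac)
    then show ?thesis using Weq vunit_mult[OF SV u(1) w(1)] by blast
  qed
  have WV: "W h \<ge> 0 \<longleftrightarrow> h \<in> V" if "h \<in> K" "h \<noteq> 0" for h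
    using Wex[OF that] mem that by blast
  have Winv: "W (inverse h) = - W h" if "h \<in> K" "h \<noteq> 0" for h
  proof -
    have "W (1::'a ambient) = 0" by (rule Weq[OF vunit_one[OF SV]]) simp
    then show ?thesis using Wmult[of h "inverse h"] that K_inverse[of h] by simp
  qed
  have Wpow: "W (h ^ m) = int m * W h" if h: "h \<in> K" "h \<noteq> 0" for h m
  proof (induction m)
    case 0
    show ?case by (simp, rule Weq[OF vunit_one[OF SV]]) simp
  next
    case (Suc m)
    then show ?case using Wmult[of h "h ^ m"] h by (simp add: K_closed algebra_simps)
  qed
  have Wadd1: "W (g + h) \<ge> W h"
    if gh: "g \<in> K" "h \<in> K" "g \<noteq> 0" "h \<noteq> 0" "g + h \<noteq> 0" "W g \<ge> W h" for g h
  proof -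
    have gV: "g * inverse h \<in> V"
      using WV[of "g * inverse h"] Wmult[of g "inverse h"] Winv[of h] gh K_inverse[of h]
      by (simp add: K_closed)
    have "(g + h) * inverse h = g * inverse h + 1" using gh by (simp add: field_simps)
    also have "\<dots> \<in> V" using gV SV by (simp add: subring_add subring_one)
    finally have "W ((g + h) * inverse h) \<ge> 0"
      using WV[of "(g + h) * inverse h"] gh K_inverse[of h] by (simp add: K_closed)
    then show ?thesis using Wmult[of "g + h" "inverse h"] Winv[of h] gh K_inverse[of h]
      by (simp add: K_closed)
  qed
  have Wadd: "W (g + h) \<ge> min (W g) (W h)"
    if "g \<in> K" "h \<in> K" "g \<noteq> 0" "h \<noteq> 0" "g + h \<noteq> 0" for g h
    using Wadd1[of g h] Wadd1[of h g] that by (cases "W g \<ge> W h") (auto simp: add.commute)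
  have Wp: "W \<pi> = int N" by (rule Weq[OF vunit_one[OF SV]]) simp
  \<comment> \<open>Normalisation: \<open>Q\<close> holds of the positive values, the least of which generates the value group.\<close>
  define Q where "Q = (\<lambda>e. e > 0 \<and> (\<exists>h\<in>K. h \<noteq> 0 \<and> W h = int e))"
  have "Q N" using Wp pK p N0 by (auto simp: Q_def)
  define e where "e = (LEAST e. Q e)"
  have Qe: "Q e" unfolding e_def using \<open>Q N\<close> by (rule LeastI)
  then obtain g where g: "g \<in> K" "g \<noteq> 0" "W g = int e" and e0: "e > 0" by (auto simp: Q_def)
  have ediv: "int e dvd W h" if h: "h \<in> K" "h \<noteq> 0" for h
  proof (rule ccontr)
    assume nd: "\<not> int e dvd W h"
    define r where "r = nat (W h mod int e)"
    have "W h mod int e \<noteq> 0" using nd by (simp add: dvd_eq_mod_eq_0)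
    moreover have "0 \<le> W h mod int e" "W h mod int e < int e" using e0 by simp_all
    ultimately have r: "r > 0" "r < e" "int r = W h mod int e"
      unfolding r_def by linarith+
    \<comment> \<open>\<open>g'\<close> removes the multiple of \<open>e\<close> from \<open>W h\<close> and leaves the remainder, which is smaller than \<open>e\<close>.\<close>
    define g' where "g' = (if W h div int e \<ge> 0 then inverse g ^ nat (W h div int e)
      else g ^ nat (- (W h div int e)))"
    have g': "g' \<in> K" "g' \<noteq> 0" "W g' = - (W h div int e) * int e"
      using g K_inverse[of g] by (auto simp: g'_def K_closed Wpow Winv)
    have "W (h * g') = int r"
      using Wmult[of h g'] h g' r minus_div_mult_eq_mod[of "W h" "int e"] by simp
    then have "Q r" unfolding Q_def using r h g' by (intro conjI bexI[of _ "h * g'"]) (auto simp: K_closed)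
    then show False using r not_less_Least[of r Q] by (simp add: e_def)
  qed
  define v where "v = (\<lambda>h. if h \<in> K \<and> h \<noteq> 0 then W h div int e else 0)"
  have vW: "W h = int e * v h" if "h \<in> K" "h \<noteq> 0" for h
    using ediv[OF that] that by (simp add: v_def)
  have "place v"
    unfolding is_place_def
  proof (intro conjI ballI impI allI)
    fix g h assume gh: "g \<in> K" "h \<in> K" "g \<noteq> 0" "h \<noteq> 0"
    have "int e * v (g * h) = int e * (v g + v h)"
      using Wmult[OF gh] gh by (simp add: vW[symmetric] K_closed distrib_left)
    then show "v (g * h) = v g + v h" using e0 by simp
    assume s: "g + h \<noteq> 0"
    have "int e * v (g + h) \<ge> min (int e * v g) (int e * v h)"
      using Wadd[OF gh s] gh s by (simp add: vW[symmetric] K_closed)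
    then show "min (v g) (v h) \<le> v (g + h)" using e0 by (simp add: min_mult_distrib_left[symmetric] min_def split: if_splits)
  next
    fix a :: 'a assume a: "a \<noteq> 0"
    have "W (cst a) = 0"
      by (rule Weq[OF vunit_power[OF SV cu[OF a], of N]]) simp
    then show "v (cst a) = 0" by (simp add: v_def)
  next
    show "\<exists>g\<in>K. g \<noteq> 0 \<and> v g = 1" using g e0 by (intro bexI[of _ g]) (auto simp: v_def)
  next
    fix h assume "h = 0 \<or> h \<notin> K"
    then show "v h = 0" by (auto simp: v_def)
  qed
  moreover have "v h \<ge> 0 \<longleftrightarrow> h \<in> V" if "h \<in> K" "h \<noteq> 0" for h
    using WV[OF that] vW[OF that] e0 by (simp add: zero_le_mult_iff)
  ultimately show ?thesis by blast
qed


subsection \<open>Calculus with places\<close>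

text \<open>
  Unlike the inequality \<open>m \<le> v h\<close>, this treats \<open>0\<close> as a function of infinite order.
\<close>

definition order_ge :: "'a place \<Rightarrow> int \<Rightarrow> 'a ambient \<Rightarrow> bool" where
  "order_ge v m h \<longleftrightarrow> h \<in> K \<and> (h = 0 \<or> v h \<ge> m)"

lemma place_mult: "place v \<Longrightarrow> g \<in> K \<Longrightarrow> h \<in> K \<Longrightarrow> g \<noteq> 0 \<Longrightarrow> h \<noteq> 0 \<Longrightarrow> v (g * h) = v g + v h"
  and place_add: "place v \<Longrightarrow> g \<in> K \<Longrightarrow> h \<in> K \<Longrightarrow> g \<noteq> 0 \<Longrightarrow> h \<noteq> 0 \<Longrightarrow> g + h \<noteq> 0 \<Longrightarrow>
    v (g + h) \<ge> min (v g) (v h)"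
  and place_outside: "place v \<Longrightarrow> h \<notin> K \<Longrightarrow> v h = 0"
  and place_uniformizer: "place v \<Longrightarrow> \<exists>g\<in>K. g \<noteq> 0 \<and> v g = 1"
  and place_0: "place v \<Longrightarrow> v 0 = 0"
  by (simp_all add: is_place_def)

lemma place_cst: "place v \<Longrightarrow> v (cst a) = 0"
  by (cases "a = 0") (auto simp: is_place_def)

lemma place_1: "place v \<Longrightarrow> v 1 = 0"
  using place_cst[of v 1] by (simp add: cst_simps)

lemma place_power: "place v \<Longrightarrow> h \<in> K \<Longrightarrow> h \<noteq> 0 \<Longrightarrow> v (h ^ k) = int k * v h"
  by (induction k) (auto simp: place_1 place_mult K_closed algebra_simps)

lemma place_divide:
  assumes "place v" "g \<in> K" "h \<in> K" "g \<noteq> 0" "h \<noteq> 0" shows "v (g / h) = v g - v h"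
proof -
  have "v (g / h * h) = v (g / h) + v h"
    using assms by (intro place_mult) (auto simp: divide_inverse K_closed K_inverse)
  then show ?thesis using assms by simp
qed

lemma order_ge_cst: "place v \<Longrightarrow> order_ge v 0 (cst a)"
  by (simp add: order_ge_def place_cst K_emb)

lemma order_ge_mult:
  "place v \<Longrightarrow> order_ge v l g \<Longrightarrow> order_ge v m h \<Longrightarrow> order_ge v (l + m) (g * h)"
  by (cases "g = 0 \<or> h = 0") (auto simp: order_ge_def K_closed place_mult)

lemma order_ge_add:
  assumes v: "place v" and g: "order_ge v m g" and h: "order_ge v m h"
  shows "order_ge v m (g + h)"
proof (cases "g = 0 \<or> h = 0 \<or> g + h = 0")
  case True
  then show ?thesis using g h by (auto simp: order_ge_def K_closed)
next
  case False
  then show ?thesis using g h place_add[OF v, of g h] by (auto simp: order_ge_def K_closed)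
qed

lemma order_ge_uminus: "place v \<Longrightarrow> order_ge v m h \<Longrightarrow> order_ge v m (- h)"
  using order_ge_mult[OF _ order_ge_cst[of v "-1"], of m h] by (simp add: cst_simps)

lemma order_ge_diff: "place v \<Longrightarrow> order_ge v m g \<Longrightarrow> order_ge v m h \<Longrightarrow> order_ge v m (g - h)"
  using order_ge_add[of v m g "- h"] by (simp add: order_ge_uminus)

lemma order_ge_0: "order_ge v m 0"
  by (simp add: order_ge_def K_closed)

lemma order_ge_sum:
  "place v \<Longrightarrow> (\<And>i. i \<in> I \<Longrightarrow> order_ge v m (h i)) \<Longrightarrow> order_ge v m (sum h I)"
  by (induction I rule: infinite_finite_induct) (auto simp: order_ge_0 order_ge_add)

lemma order_ge_mono: "order_ge v m h \<Longrightarrow> l \<le> m \<Longrightarrow> order_ge v l h"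
  by (auto simp: order_ge_def)

lemma order_ge_power: "place v \<Longrightarrow> order_ge v 0 h \<Longrightarrow> order_ge v 0 (h ^ k)"
  by (induction k) (use order_ge_cst[of v 1] order_ge_mult[of v 0 h 0] in \<open>auto simp: cst_simps\<close>)

lemma order_ge_emb: "place v \<Longrightarrow> order_ge v 0 x \<Longrightarrow> order_ge v 0 (emb p)"
  unfolding emb_altdef[of p]
  by (intro order_ge_sum) (use order_ge_mult[of v 0 _ 0] in \<open>auto simp: order_ge_cst order_ge_power\<close>)

lemma vanishes_iff: "h \<in> K \<Longrightarrow> vanishes_at v h \<longleftrightarrow> order_ge v 1 h"
  by (auto simp: vanishes_at_def order_ge_def)

lemma place_add_less:
  assumes v: "place v" and gh: "g \<in> K" "h \<in> K" "g \<noteq> 0" "h \<noteq> 0" and less: "v g < v h"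
  shows "g + h \<noteq> 0 \<and> v (g + h) = v g"
proof
  have uh: "v (- h) = v h" if "h \<in> K" "h \<noteq> 0" for h
    using place_mult[OF v, of "cst (-1)" h] place_cst[OF v, of "-1"] that
    by (simp add: K_closed cst_simps)
  show n: "g + h \<noteq> 0"
  proof
    assume "g + h = 0"
    then have "g = - h" by (simp add: eq_neg_iff_add_eq_0)
    then show False using uh[OF gh(2,4)] less by simp
  qed
  have "v (g + h) \<ge> v g" using place_add[OF v gh n] less by simp
  moreover have "v g \<ge> min (v (g + h)) (v h)"
    using place_add[OF v, of "g + h" "- h"] gh n uh by (simp add: K_closed)
  ultimately show "v (g + h) = v g" using less by simp
qed

lemma place_sum_distinct:
  assumes v: "place v" and I: "finite I" "I \<noteq> {}"
    and t: "\<And>i. i \<in> I \<Longrightarrow> t i \<in> K \<and> t i \<noteq> 0" and inj: "inj_on (\<lambda>i. v (t i)) I"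
  shows "sum t I \<noteq> 0 \<and> v (sum t I) = Min ((\<lambda>i. v (t i)) ` I)"
  using I t inj
proof (induction I rule: finite_ne_induct)
  case (singleton i)
  then show ?case by simp
next
  case (insert i I)
  have IH: "sum t I \<noteq> 0" "v (sum t I) = Min ((\<lambda>i. v (t i)) ` I)" using insert by auto
  have "Min ((\<lambda>i. v (t i)) ` I) \<in> (\<lambda>i. v (t i)) ` I"
    using insert by (intro Min_in) auto
  moreover have "v (t i) \<notin> (\<lambda>i. v (t i)) ` I" using insert.prems insert.hyps by auto
  ultimately have ne: "v (t i) \<noteq> v (sum t I)" unfolding IH(2) by metis
  have sK: "sum t I \<in> K" using insert by (intro K_sum) auto
  have "t i + sum t I \<noteq> 0 \<and> v (t i + sum t I) = min (v (t i)) (v (sum t I))"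
  proof (cases "v (t i) < v (sum t I)")
    case True
    then show ?thesis using place_add_less[OF v, of "t i" "sum t I"] sK IH(1) insert.prems by simp
  next
    case False
    then show ?thesis
      using place_add_less[OF v, of "sum t I" "t i"] ne sK IH(1) insert.prems
      by (simp add: add.commute min_def)
  qed
  then show ?case using insert.hyps by (simp add: IH(2) Min_insert)
qed

lemma place_y: "place v \<Longrightarrow> int n * v y = v (emb f)"
  using place_power[of v y n] by (simp add: K_y y_neq_0 y_power)

lemma place_emb_infinite:
  assumes v: "place v" and x: "v x < 0" and p: "p \<noteq> 0"
  shows "v (emb p) = int (degree p) * v x"
  using p
proof (induction p)
  case (pCons a p)
  show ?case
  proof (cases "p = 0")
    case True
    then show ?thesis using place_cst[OF v] by simp
  next
    case False
    have xp: "v (x * emb p) = (int (degree p) + 1) * v x"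
      using place_mult[OF v, of x "emb p"] False pCons.IH by (simp add: K_emb algebra_simps)
    then have neg: "v (x * emb p) < 0" using x by (simp add: mult_pos_neg)
    have "v (x * emb p + cst a) = v (x * emb p)"
    proof (cases "a = 0")
      case True
      then show ?thesis by (simp add: cst_simps)
    next
      case a: False
      then show ?thesis
        using place_add_less[OF v, of "x * emb p" "cst a"] False neg place_cst[OF v, of a]
        by (simp add: K_closed)
    qed
    then show ?thesis using False xp by (simp add: emb_pCons[of a p] add.commute)
  qed
qed simp

text \<open>
  Composition with an automorphism; the case distinction restores the convention that a place
  vanishes outside the function field.
\<close>

lemma place_galois:
  assumes v: "place v" and z: "z ^ n = 1"
  shows "place (\<lambda>h. if h \<in> K then v (galois z h) else 0)"
  unfolding is_place_def
proof (intro conjI ballI impI allI)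
  fix g h assume gh: "g \<in> K" "h \<in> K" "g \<noteq> 0" "h \<noteq> 0"
  then have nz: "galois z g \<noteq> 0" "galois z h \<noteq> 0" using galois_eq_0_iff[OF z] by auto
  show "(if g * h \<in> K then v (galois z (g * h)) else 0) =
      (if g \<in> K then v (galois z g) else 0) + (if h \<in> K then v (galois z h) else 0)"
    using gh nz z v by (simp add: K_closed galois_mult place_mult galois_K)
  assume "g + h \<noteq> 0"
  then have "galois z (g + h) \<noteq> 0" using galois_eq_0_iff[OF z, of "g + h"] gh by (simp add: K_closed)
  then show "min (if g \<in> K then v (galois z g) else 0) (if h \<in> K then v (galois z h) else 0)
      \<le> (if g + h \<in> K then v (galois z (g + h)) else 0)"
    using gh nz z place_add[OF v, of "galois z g" "galois z h"]
    by (simp add: K_closed galois_add galois_K)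
next
  fix a :: 'a
  show "(if cst a \<in> K then v (galois z (cst a)) else 0) = 0"
    using z by (simp add: galois_emb place_cst[OF v])
next
  obtain g where g: "g \<in> K" "g \<noteq> 0" "v g = 1" using place_uniformizer[OF v] by blast
  have iz: "(inverse z) ^ n = 1" using z by (simp add: power_inverse)
  have "galois z (galois (inverse z) g) = g" using galois_inverse[OF iz g(1)] by simp
  then show "\<exists>g\<in>K. g \<noteq> 0 \<and> (if g \<in> K then v (galois z g) else 0) = 1"
    using g iz galois_eq_0_iff[OF iz g(1)] by (intro bexI[of _ "galois (inverse z) g"]) (auto simp: galois_K)
next
  fix h assume "h = 0 \<or> h \<notin> K"
  then show "(if h \<in> K then v (galois z h) else 0) = 0" using z v by (auto simp: galois_0 place_0)
qed

theorem place_over_irreducible: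
  assumes P: "irreducible P"
  shows "\<exists>v. place v \<and> v (emb P) > 0 \<and> (\<forall>p. v (emb p) \<ge> 0) \<and> (\<forall>p. \<not> P dvd p \<longrightarrow> v (emb p) = 0)"
proof -
  obtain V where V: "dominates V (emb P)" "range emb \<subseteq> V" "\<And>p. \<not> P dvd p \<Longrightarrow> vunit V (emb p)"
    using dominating_finite[OF P] by blast
  obtain v where v: "place v" and vV: "\<And>h. h \<in> K \<Longrightarrow> h \<noteq> 0 \<Longrightarrow> (v h \<ge> 0 \<longleftrightarrow> h \<in> V)"
    using place_of_valuation_ring[OF V(1) K_emb] by blast
  have P0: "emb P \<noteq> 0" and iP: "inverse (emb P) \<notin> V" using V(1) by (auto simp: dominates_def)
  have vinv: "v (inverse h) = - v h" if "h \<in> K" "h \<noteq> 0" for h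
    using place_divide[OF v, of 1 h] that by (simp add: K_1 place_1[OF v] divide_inverse)
  have pos: "v (emb p) \<ge> 0" for p
    using vV[OF K_emb, of p] V(2) place_0[OF v] by (cases "p = 0") auto
  moreover have "v (emb P) > 0"
  proof (rule ccontr)
    assume "\<not> v (emb P) > 0"
    then have "inverse (emb P) \<in> V"
      using vV[OF K_inverse[OF K_emb], of P] vinv[OF K_emb P0] P0 by simp
    then show False using iP by simp
  qed
  moreover have "v (emb p) = 0" if "\<not> P dvd p" for p
  proof -
    have p: "emb p \<noteq> 0" "inverse (emb p) \<in> V" using V(3)[OF that] by (auto simp: vunit_def)
    then have "v (inverse (emb p)) \<ge> 0" using vV[OF K_inverse[OF K_emb], of p] by simp
    then show ?thesis using vinv[OF K_emb p(1)] pos[of p] by simp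
  qed
  ultimately show ?thesis using v by blast
qed

theorem place_over_infinity: "\<exists>v. place v \<and> v x < 0"
proof -
  obtain V where V: "dominates V (inverse x)" using dominating_infinite by blast
  obtain v where v: "place v" and vV: "\<And>h. h \<in> K \<Longrightarrow> h \<noteq> 0 \<Longrightarrow> (v h \<ge> 0 \<longleftrightarrow> h \<in> V)"
    using place_of_valuation_ring[OF V K_inverse[OF K_emb]] by blast
  have "x \<notin> V" using V by (auto simp: dominates_def)
  then have "v x < 0" using vV[OF K_emb, of "[:0, 1:]"] by simp
  then show ?thesis using v by blast
qed

end

subsection \<open>Evaluation of polynomials with constant coefficients\<close>

text \<open>
  Polynomials in \<open>w\<close> with constant coefficients represent residue classes at a place.
\<close>

definition cst_eval :: "'a::{field, finite} ambient \<Rightarrow> 'a poly \<Rightarrow> 'a ambient" where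
  "cst_eval w g = poly (map_poly cst g) w"

lemma cst_eval_0 [simp]: "cst_eval w 0 = 0"
  by (simp add: cst_eval_def)

lemma cst_eval_pCons [simp]: "cst_eval w (pCons a g) = cst a + w * cst_eval w g"
  by (simp add: cst_eval_def map_poly_pCons cst_simps)

lemma cst_eval_1 [simp]: "cst_eval w 1 = 1"
  by (simp add: cst_eval_def map_poly_1 cst_simps(2))

lemma cst_eval_add [simp]: "cst_eval w (g + h) = cst_eval w g + cst_eval w h"
proof (induction g arbitrary: h)
  case (pCons a g)
  then show ?case by (cases h) (simp_all add: algebra_simps cst_simps del: emb_simps)
qed simp

lemma cst_eval_smult [simp]: "cst_eval w (smult a g) = cst a * cst_eval w g"
  by (induction g) (simp_all add: algebra_simps cst_simps del: emb_simps)

lemma cst_eval_mult [simp]: "cst_eval w (g * h) = cst_eval w g * cst_eval w h"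
  by (induction g) (simp_all add: algebra_simps cst_simps)

lemma cst_eval_diff [simp]: "cst_eval w (g - h) = cst_eval w g - cst_eval w h"
  using cst_eval_add[of w "g - h" h] by simp

lemma cst_eval_prod: "cst_eval w (prod g I) = (\<Prod>i\<in>I. cst_eval w (g i))"
  by (induction I rule: infinite_finite_induct) auto

lemma cst_eval_monom: "cst_eval w (monom a k) = cst a * w ^ k"
  by (induction k) (simp_all add: monom_0 monom_Suc cst_simps)

context superelliptic_curve
begin

subsection \<open>Unramified places\<close>

text \<open>
  This is the statement that \<open>t\<close> generates the value group on \<open>R[w]\<close>, where \<open>t\<close> is a uniformiser below
  and \<open>w\<^sup>c\<close> is congruent to a nonzero constant \<open>l\<close>.  Modulo \<open>t\<close>, elements of \<open>R[w]\<close> are polynomials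
  in \<open>w\<close> over \<open>\<F>\<^sub>q\<close>; those vanishing at the place are the multiples of one polynomial \<open>G\<close>, which divides
  \<open>X\<^sup>c - l\<close>.  As \<open>X\<^sup>c - l\<close> is separable, its cofactor \<open>H\<close> does not vanish, whereas \<open>G(w) H(w)\<close> is a
  multiple of \<open>t\<close>.  So if \<open>h\<close> vanishes at the place then \<open>H(w) h = t h'\<close> with \<open>h'\<close> in \<open>R[w]\<close> of
  smaller order, and the process stops after finitely many steps.

  The conclusion is an identity in \<open>R[w]\<close> and not only a statement about \<open>v h\<close>, because it is used to
  compare different places and to compute residues.
\<close>

lemma unramified_descent:
  assumes v: "place v" and R: "unital_subring R" and RK: "R \<subseteq> K" and cR: "\<And>a. cst a \<in> R"
    and pos: "\<And>r. r \<in> R \<Longrightarrow> order_ge v 0 r"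
    and t: "t \<in> R" "t \<noteq> 0" "v t > 0"
    and expand: "\<And>r. r \<in> R \<Longrightarrow> \<exists>a. \<exists>r'\<in>R. r = cst a + t * r'"
    and wK: "w \<in> K" and w: "w ^ c = cst l + t * \<phi>" "\<phi> \<in> R" "l \<noteq> 0"
    and c: "(of_nat c :: 'a) \<noteq> 0"
    and h: "h \<in> adjoin R w" "h \<noteq> 0"
  shows "\<exists>k. \<exists>U\<in>adjoin R w. \<exists>A\<in>adjoin R w. U \<noteq> 0 \<and> A \<noteq> 0 \<and> v U = 0 \<and> v A = 0 \<and> U * h = t ^ k * A"
proof -
  let ?B = "adjoin R w"
  note B = subring_adjoin[OF R, of w]
  have RB: "R \<subseteq> ?B" and wB: "w \<in> ?B" using subset_adjoin[OF R] mem_adjoin[OF R] by auto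
  have c0: "c > 0" using c by (cases c) auto
  have w0: "order_ge v 0 w"
  proof (cases "w = 0")
    case False
    have "order_ge v 0 (cst l + t * \<phi>)"
      using order_ge_add[OF v order_ge_cst[OF v]] order_ge_mult[OF v pos[OF t(1)] pos[OF w(2)]] by simp
    then have "order_ge v 0 (w ^ c)" using w by simp
    then have "v (w ^ c) \<ge> 0" using False by (simp add: order_ge_def)
    then show ?thesis using place_power[OF v wK False, of c] c0 wK
      by (simp add: order_ge_def zero_le_mult_iff)
  qed (simp add: order_ge_0)
  have posB: "order_ge v 0 e" if e: "e \<in> ?B" for e
  proof -
    obtain p where p: "e = poly p w" "\<forall>i. coeff p i \<in> R" using e by (auto simp: adjoin_def)
    show ?thesis unfolding p(1) poly_altdef
      using order_ge_mult[OF v, of 0 _ 0] pos p(2) w0 by (intro order_ge_sum[OF v]) (auto simp: order_ge_power v)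
  qed
  have BK: "e \<in> K" if "e \<in> ?B" for e using posB[OF that] by (simp add: order_ge_def)
  have evB: "cst_eval w g \<in> ?B" for g
    by (induction g) (use B RB wB cR in \<open>auto intro!: subring_add subring_mult subring_zero\<close>)
  have van: "order_ge v 1 (e1 * e2)" if "order_ge v 1 e1" "e2 \<in> ?B" for e1 e2
    using order_ge_mult[OF v that(1) posB[OF that(2)]] by simp
  have tv: "order_ge v 1 t" using t RK by (auto simp: order_ge_def)
  define I where "I = {g. order_ge v 1 (cst_eval w g)}"
  have I_mult: "g * h \<in> I" if "g \<in> I" for g h
    using van[OF _ evB] that by (simp add: I_def)
  have I_diff: "g - h \<in> I" if "g \<in> I" "h \<in> I" for g h
    using that by (simp add: I_def order_ge_diff[OF v])
  have cI: "[:a:] \<notin> I" if "a \<noteq> 0" for a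
    using that place_cst[OF v, of a] by (simp add: I_def order_ge_def)
  define E where "E = monom 1 c - [:l:]"
  have Ew: "cst_eval w E = t * \<phi>" using w by (simp add: E_def cst_eval_monom cst_simps)
  have EI: "E \<in> I" unfolding I_def using Ew van[OF tv] w RB by auto
  have E0: "E \<noteq> 0"
  proof
    assume "E = 0"
    then have "coeff E c = 0" by simp
    then show False using c0 by (simp add: E_def coeff_pCons split: nat.splits)
  qed
  obtain G where G: "G \<in> I" "G \<noteq> 0" and Gmin: "\<And>g. g \<in> I \<Longrightarrow> g \<noteq> 0 \<Longrightarrow> degree G \<le> degree g"
    using ex_has_least_nat[of "\<lambda>g. g \<in> I \<and> g \<noteq> 0" E degree] EI E0 by blast
  have Gdvd: "G dvd g" if "g \<in> I" for g
  proof -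
    have "g mod G = g - G * (g div G)" by (simp add: minus_mult_div_eq_mod)
    then have "g mod G \<in> I" using I_diff[OF that I_mult[OF G(1)]] by simp
    then have "g mod G = 0"
      using Gmin degree_mod_less'[OF G(2), of g] by (metis not_le)
    then show ?thesis by (simp add: dvd_eq_mod_eq_0)
  qed
  obtain H where H: "E = G * H" using Gdvd[OF EI] by (rule dvdE)
  \<comment> \<open>Otherwise \<open>E\<close> would have a double root at the place, so its derivative and thus \<open>l\<close> would vanish there.\<close>
  have HI: "H \<notin> I"
  proof
    assume "H \<in> I"
    then have "G dvd pderiv E" using Gdvd by (simp add: H pderiv_mult)
    then have "pderiv E \<in> I" using I_mult[OF G(1)] by (auto elim!: dvdE)
    then have 1: "pderiv E * monom 1 1 \<in> I" by (rule I_mult)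
    have "pderiv E * monom 1 1 = monom (of_nat c) c"
      using c0 by (simp add: E_def pderiv_diff pderiv_monom pderiv_pCons mult_monom)
    moreover have "E * [:of_nat c:] = monom (of_nat c) c - [:of_nat c * l:]"
      by (simp add: E_def smult_diff_right smult_monom mult.commute)
    moreover have "E * [:of_nat c:] \<in> I" using EI by (rule I_mult)
    ultimately have "[:of_nat c * l:] \<in> I" using I_diff[OF 1, of "E * [:of_nat c:]"] by simp
    then show False using cI c w by simp
  qed
  have Hw: "cst_eval w H \<noteq> 0" "v (cst_eval w H) = 0"
    using HI posB[OF evB, of H] by (auto simp: I_def order_ge_def)
  have expandB: "\<exists>g. \<exists>e'\<in>?B. e = cst_eval w g + t * e'" if e: "e \<in> ?B" for e
  proof -
    obtain p where p: "e = poly p w" "\<forall>i. coeff p i \<in> R" using e by (auto simp: adjoin_def)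
    have "\<exists>g. \<exists>e'\<in>?B. poly p w = cst_eval w g + t * e'"
      using p(2)
    proof (induction p)
      case 0
      then show ?case using B by (intro exI[of _ 0] bexI[of _ 0]) (auto intro: subring_zero)
    next
      case (pCons r p)
      have "\<forall>i. coeff p i \<in> R" using pCons.prems by (metis coeff_pCons_Suc)
      then obtain g e' where g: "e' \<in> ?B" "poly p w = cst_eval w g + t * e'" using pCons.IH by blast
      have "r \<in> R" using pCons.prems by (metis coeff_pCons_0)
      then obtain a r' where r: "r' \<in> R" "r = cst a + t * r'" using expand by blast
      have "poly (pCons r p) w = cst_eval w (pCons a g) + t * (r' + w * e')"
        by (simp add: r g algebra_simps)
      moreover have "r' + w * e' \<in> ?B"
        using r g RB wB B by (auto intro!: subring_add subring_mult)
      ultimately show ?case by blast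
    qed
    then show ?thesis by (simp add: p)
  qed
  show ?thesis
    using h
  proof (induction "nat (v h)" arbitrary: h rule: less_induct)
    case less
    obtain g e where ge: "e \<in> ?B" "h = cst_eval w g + t * e" using expandB less.prems by blast
    show ?case
    proof (cases "g \<in> I")
      case False
      have "v h = 0"
      proof (rule ccontr)
        assume "v h \<noteq> 0"
        then have "order_ge v 1 h" using posB[OF less.prems(1)] less.prems by (auto simp: order_ge_def)
        then have "order_ge v 1 (h - t * e)" using van[OF tv ge(1)] by (simp add: order_ge_diff[OF v])
        then show False using ge False by (simp add: I_def)
      qed
      then show ?thesis
        using less.prems B place_1[OF v]
        by (intro exI[of _ 0] bexI[of _ 1] bexI[of _ h]) (auto simp: subring_one)
    next
      case True
      obtain g' where g': "g = G * g'" using Gdvd[OF True] by (rule dvdE)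
      define h' where "h' = \<phi> * cst_eval w g' + cst_eval w H * e"
      have "cst_eval w H * h = cst_eval w E * cst_eval w g' + t * (cst_eval w H * e)"
        by (simp add: ge g' H algebra_simps)
      then have eq: "cst_eval w H * h = t * h'" by (simp add: Ew h'_def algebra_simps)
      have h'B: "h' \<in> ?B" unfolding h'_def
        using B evB ge w RB by (intro subring_add[OF B] subring_mult[OF B]) auto
      have h'0: "h' \<noteq> 0" using eq Hw less.prems by auto
      have "v (cst_eval w H * h) = v h"
        using place_mult[OF v BK[OF evB] BK[OF less.prems(1)]] Hw less.prems by simp
      moreover have "v (t * h') = v t + v h'"
        using place_mult[OF v _ BK[OF h'B]] t RK h'0 by auto
      ultimately have "v h' < v h" using eq t by simp
      moreover have "v h' \<ge> 0" using posB[OF h'B] h'0 by (simp add: order_ge_def)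
      ultimately obtain k U A where UA: "U \<in> ?B" "A \<in> ?B" "U \<noteq> 0" "A \<noteq> 0" "v U = 0" "v A = 0" "U * h' = t ^ k * A"
        using less.hyps[of h'] h'B h'0 by auto
      have "v (U * cst_eval w H) = 0"
        using place_mult[OF v BK[OF UA(1)] BK[OF evB]] UA Hw by simp
      moreover have "(U * cst_eval w H) * h = t ^ Suc k * A"
        using eq UA(7) by (simp add: mult.assoc mult.left_commute)
      moreover have "U * cst_eval w H \<in> ?B" using UA evB B by (simp add: subring_mult)
      ultimately show ?thesis using UA Hw
        by (intro exI[of _ "Suc k"] bexI[of _ "U * cst_eval w H"] bexI[of _ A]) auto
    qed
  qed
qed


subsection \<open>Places over affine rational points\<close>

abbreviation coordinate_ring :: "'a ambient set" where
  "coordinate_ring \<equiv> adjoin (range emb) y"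

lemma subring_coordinate_ring: "unital_subring coordinate_ring"
  by (rule subring_adjoin[OF subring_polys])

lemma emb_coordinate_ring: "emb p \<in> coordinate_ring"
  using subset_adjoin[OF subring_polys] by blast

lemma y_coordinate_ring: "y \<in> coordinate_ring"
  by (rule mem_adjoin[OF subring_polys])

lemma coordinate_ring_K: "e \<in> coordinate_ring \<Longrightarrow> e \<in> K"
  unfolding adjoin_def poly_altdef by (auto intro!: K_closed) (metis K_emb rangeE)

lemma clear_denominators:
  assumes "h \<in> K"
  shows "\<exists>D. D \<noteq> 0 \<and> emb D * h \<in> coordinate_ring"
proof -
  obtain r where r: "h = rat_eval y r" using assms by (auto simp: function_field_eq)
  note S = subring_coordinate_ring
  have "\<exists>D. D \<noteq> 0 \<and> emb D * rat_eval y r \<in> coordinate_ring"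
  proof (induction r)
    case 0
    then show ?case using emb_coordinate_ring[of 0] by (intro exI[of _ 1]) simp
  next
    case (pCons c r)
    then obtain D where D: "D \<noteq> 0" "emb D * rat_eval y r \<in> coordinate_ring" by blast
    obtain a b where ab: "c = Fract a b" "b \<noteq> 0" by (cases c) auto
    have c: "emb b * to_ac c = emb a"
      using ab by (simp add: emb_def Fract_conv_to_fract)
    have "emb (D * b) * rat_eval y (pCons c r)
        = emb D * (emb b * to_ac c) + y * emb b * (emb D * rat_eval y r)"
      by (simp add: algebra_simps)
    also have "\<dots> \<in> coordinate_ring"
      unfolding c
      by (rule subring_add[OF S subring_mult[OF S emb_coordinate_ring emb_coordinate_ring]
            subring_mult[OF S subring_mult[OF S y_coordinate_ring emb_coordinate_ring] D(2)]])
    finally show ?case using D ab by (intro exI[of _ "D * b"]) simp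
  qed
  then show ?thesis by (simp add: r)
qed

lemma emb_expand: "\<exists>s. emb p = cst (poly p a) + (x - cst a) * emb s"
proof -
  have "p = [:poly p a:] + [:- a, 1:] * synthetic_div p a"
    using synthetic_div_correct'[of a p] by (simp add: add.commute)
  then have "emb p = cst (poly p a) + emb [:- a, 1:] * emb (synthetic_div p a)"
    by (metis emb_simps(3,4))
  moreover have "emb [:- a, 1:] = x - cst a" by (simp flip: emb_simps)
  ultimately show ?thesis by auto
qed

lemma x_minus_cst_neq_0: "x - cst a \<noteq> 0"
  by (simp flip: emb_simps)

lemma affine_order_ge_x:
  assumes v: "place v" and pos: "v (x - cst a) > 0" shows "order_ge v 0 x"
proof -
  have "order_ge v 0 ((x - cst a) + cst a)"
    using pos by (intro order_ge_add[OF v] order_ge_cst[OF v]) (simp add: order_ge_def K_closed)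
  then show ?thesis by simp
qed

text \<open>
  Here \<open>t = x - a\<close>, \<open>w = y\<close> and \<open>l = f(a)\<close>, which is nonzero as \<open>f\<close> has no roots in \<open>\<F>\<^sub>q\<close>.
\<close>

lemma affine_descent:
  assumes v: "place v" and pos: "v (x - cst a) > 0"
    and h: "h \<in> coordinate_ring" "h \<noteq> 0"
  shows "\<exists>k. \<exists>U\<in>coordinate_ring. \<exists>A\<in>coordinate_ring.
    U \<noteq> 0 \<and> A \<noteq> 0 \<and> v U = 0 \<and> v A = 0 \<and> U * h = (x - cst a) ^ k * A"
proof -
  obtain s where s: "emb f = cst (poly f a) + (x - cst a) * emb s" using emb_expand by blast
  show ?thesis
  proof (rule unramified_descent[OF v subring_polys _ _ _ _ x_minus_cst_neq_0 pos _ K_y _ _ f_no_root of_nat_n_neq_0 h])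
    show "range emb \<subseteq> K" by (auto simp: K_emb)
    show "order_ge v 0 r" if "r \<in> range emb" for r
      using that order_ge_emb[OF v affine_order_ge_x[OF v pos]] by auto
    show "x - cst a \<in> range emb" by (simp flip: emb_simps)
    show "\<exists>c. \<exists>r'\<in>range emb. r = cst c + (x - cst a) * r'" if "r \<in> range emb" for r
      using that emb_expand by blast
    show "y ^ n = cst (poly f a) + (x - cst a) * emb s" using s y_power by simp
  qed auto
qed

text \<open>
  The descent applied to a numerator and to a denominator of \<open>h\<close>.
\<close>

lemma affine_local_form:
  assumes v: "place v" and pos: "v (x - cst a) > 0" and h: "h \<in> K" "h \<noteq> 0"
  shows "\<exists>k l. \<exists>U\<in>coordinate_ring. \<exists>A\<in>coordinate_ring. U \<noteq> 0 \<and> A \<noteq> 0 \<and> v U = 0 \<and> v A = 0 \<and>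
    (x - cst a) ^ k * U * h = (x - cst a) ^ l * A"
proof -
  obtain D where D: "D \<noteq> 0" "emb D * h \<in> coordinate_ring" using clear_denominators h by blast
  have D0: "emb D \<noteq> 0" "emb D * h \<noteq> 0" using D h by auto
  obtain k1 U1 A1 where 1: "U1 \<in> coordinate_ring" "A1 \<in> coordinate_ring" "U1 \<noteq> 0" "A1 \<noteq> 0"
      "v U1 = 0" "v A1 = 0" "U1 * emb D = (x - cst a) ^ k1 * A1"
    using affine_descent[OF v pos emb_coordinate_ring D0(1)] by blast
  obtain k2 U2 A2 where 2: "U2 \<in> coordinate_ring" "A2 \<in> coordinate_ring" "U2 \<noteq> 0" "A2 \<noteq> 0"
      "v U2 = 0" "v A2 = 0" "U2 * (emb D * h) = (x - cst a) ^ k2 * A2"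
    using affine_descent[OF v pos D(2) D0(2)] by blast
  have "(x - cst a) ^ k1 * (A1 * U2) * h = U2 * ((x - cst a) ^ k1 * A1) * h" by (simp add: mult_ac)
  also have "\<dots> = U2 * (U1 * emb D) * h" unfolding 1(7) ..
  also have "\<dots> = U1 * (U2 * (emb D * h))" by (simp only: mult_ac)
  also have "\<dots> = (x - cst a) ^ k2 * (U1 * A2)" unfolding 2(7) by (simp add: mult_ac)
  finally have eq: "(x - cst a) ^ k1 * (A1 * U2) * h = (x - cst a) ^ k2 * (U1 * A2)" .
  have "v (A1 * U2) = 0" "v (U1 * A2) = 0"
    using 1 2 place_mult[OF v coordinate_ring_K coordinate_ring_K] by simp_all
  moreover have "A1 * U2 \<in> coordinate_ring" "U1 * A2 \<in> coordinate_ring"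
    using 1 2 subring_mult[OF subring_coordinate_ring] by auto
  ultimately show ?thesis using eq 1 2
    by (intro exI[of _ k1] exI[of _ k2] bexI[of _ "A1 * U2"] bexI[of _ "U1 * A2"]) auto
qed

lemma local_form_order:
  assumes v: "place v" and h: "h \<in> K" "h \<noteq> 0" and UA: "U \<in> coordinate_ring" "A \<in> coordinate_ring"
    "U \<noteq> 0" "A \<noteq> 0" "v U = 0" "v A = 0" and eq: "(x - cst a) ^ k * U * h = (x - cst a) ^ l * A"
  shows "v h = (int l - int k) * v (x - cst a)"
proof -
  have tK: "x - cst a \<in> K" by (simp add: K_closed)
  have "v ((x - cst a) ^ k * U * h) = int k * v (x - cst a) + v h"
    using place_mult[OF v] place_power[OF v tK x_minus_cst_neq_0] x_minus_cst_neq_0 tK h UA coordinate_ring_K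
    by (simp add: K_closed del: emb_simps)
  moreover have "v ((x - cst a) ^ l * A) = int l * v (x - cst a)"
    using place_mult[OF v] place_power[OF v tK x_minus_cst_neq_0] x_minus_cst_neq_0 tK UA coordinate_ring_K
    by (simp add: K_closed)
  ultimately show ?thesis using eq by (simp add: algebra_simps)
qed

text \<open>
  All orders are multiples of \<open>v (x - a)\<close>, and some function has order \<open>1\<close>.
\<close>

theorem place_over_finite_unramified:
  assumes v: "place v" and pos: "v (x - cst a) > 0"
  shows "v (x - cst a) = 1"
proof -
  obtain g where g: "g \<in> K" "g \<noteq> 0" "v g = 1" using place_uniformizer[OF v] by blast
  obtain k l U A where "U \<in> coordinate_ring" "A \<in> coordinate_ring" "U \<noteq> 0" "A \<noteq> 0" "v U = 0" "v A = 0"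
      "(x - cst a) ^ k * U * g = (x - cst a) ^ l * A"
    using affine_local_form[OF v pos g(1,2)] by blast
  from local_form_order[OF v g(1,2) this] have "1 = (int l - int k) * v (x - cst a)"
    using g by simp
  then have "v (x - cst a) dvd 1" by (metis dvd_triv_right)
  then show ?thesis using pos by simp
qed

definition point :: "'a place \<Rightarrow> 'a \<Rightarrow> 'a \<Rightarrow> bool" where
  "point v a b \<longleftrightarrow> place v \<and> order_ge v 1 (x - cst a) \<and> order_ge v 1 (y - cst b)"

text \<open>
  The ideal of the point \<open>(a, b)\<close> is generated by \<open>x - a\<close> and \<open>y - b\<close>.  The value \<open>c\<close> comes from
  \<open>a\<close>, \<open>b\<close> and \<open>e\<close> alone and so is common to all places at this point.
\<close>

lemma coordinate_ring_value:
  assumes "e \<in> coordinate_ring"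
  shows "\<exists>c. \<exists>e1\<in>coordinate_ring. \<exists>e2\<in>coordinate_ring. e = cst c + (x - cst a) * e1 + (y - cst b) * e2"
proof -
  obtain p where p: "e = poly p y" "\<forall>i. coeff p i \<in> range emb" using assms by (auto simp: adjoin_def)
  note S = subring_coordinate_ring
  have "\<exists>c. \<exists>e1\<in>coordinate_ring. \<exists>e2\<in>coordinate_ring. poly p y = cst c + (x - cst a) * e1 + (y - cst b) * e2"
    using p(2)
  proof (induction p)
    case 0
    then show ?case using subring_zero[OF S]
      by (intro exI[of _ 0] bexI[of _ 0]) (auto simp: cst_simps)
  next
    case (pCons r p)
    have "\<forall>i. coeff p i \<in> range emb" using pCons.prems by (metis coeff_pCons_Suc)
    then obtain c e1 e2 where e: "e1 \<in> coordinate_ring" "e2 \<in> coordinate_ring"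
        "poly p y = cst c + (x - cst a) * e1 + (y - cst b) * e2" using pCons.IH by blast
    have "r \<in> range emb" using pCons.prems by (metis coeff_pCons_0)
    then obtain r' s where r: "r = cst r' + (x - cst a) * emb s" using emb_expand by blast
    have "poly (pCons r p) y = cst (r' + b * c) + (x - cst a) * (emb s + y * e1)
        + (y - cst b) * (cst c + y * e2)"
      by (simp add: r e(3) cst_simps algebra_simps del: emb_simps)
    moreover have "emb s + y * e1 \<in> coordinate_ring" "cst c + y * e2 \<in> coordinate_ring"
      using e emb_coordinate_ring y_coordinate_ring S by (auto intro!: subring_add subring_mult)
    ultimately show ?case by blast
  qed
  then show ?thesis by (simp add: p)
qed

lemma point_x:
  assumes "point v a b" shows "v (x - cst a) > 0" "order_ge v 0 x"
proof -
  show p: "v (x - cst a) > 0"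
    using assms x_minus_cst_neq_0[of a] by (auto simp: point_def order_ge_def)
  show "order_ge v 0 x" using affine_order_ge_x[of v a] p assms by (simp add: point_def)
qed

lemma point_y: "point v a b \<Longrightarrow> order_ge v 0 y"
  using order_ge_add[of v 0 "y - cst b" "cst b"] order_ge_cst[of v b] order_ge_mono[of v 1 "y - cst b" 0]
  by (simp add: point_def)

lemma point_coordinate_ring:
  assumes pt: "point v a b" and e: "e \<in> coordinate_ring" shows "order_ge v 0 e"
proof -
  have v: "place v" using pt by (simp add: point_def)
  obtain p where p: "e = poly p y" "\<forall>i. coeff p i \<in> range emb" using e by (auto simp: adjoin_def)
  have "order_ge v 0 (coeff p i * y ^ i)" for i
  proof -
    obtain s where "coeff p i = emb s" using p(2) by blast
    then show ?thesis
      using order_ge_mult[OF v order_ge_emb[OF v point_x(2)[OF pt]] order_ge_power[OF v point_y[OF pt]]]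
      by simp
  qed
  then show ?thesis unfolding p(1) poly_altdef by (intro order_ge_sum[OF v])
qed

lemma point_value:
  assumes pt: "point v a b" and e: "e = cst c + (x - cst a) * e1 + (y - cst b) * e2"
    "e1 \<in> coordinate_ring" "e2 \<in> coordinate_ring"
  shows "order_ge v 1 (e - cst c)"
proof -
  have v: "place v" using pt by (simp add: point_def)
  have "order_ge v 1 ((x - cst a) * e1)" "order_ge v 1 ((y - cst b) * e2)"
    using pt point_coordinate_ring[OF pt] e
      order_ge_mult[OF v, of 1 "x - cst a" 0 e1] order_ge_mult[OF v, of 1 "y - cst b" 0 e2]
    by (simp_all add: point_def)
  then have "order_ge v 1 ((x - cst a) * e1 + (y - cst b) * e2)" by (rule order_ge_add[OF v])
  then show ?thesis using e by simp
qed

lemma cst_not_order_ge_1: "place v \<Longrightarrow> order_ge v 1 (cst c) \<Longrightarrow> c = 0"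
  using place_cst[of v c] by (auto simp: order_ge_def)

lemma order_0_iff:
  assumes v: "place v" and c: "order_ge v 1 (e - cst c)"
  shows "e \<noteq> 0 \<and> v e = 0 \<longleftrightarrow> c \<noteq> 0"
proof
  assume e: "e \<noteq> 0 \<and> v e = 0"
  show "c \<noteq> 0"
  proof
    assume "c = 0"
    then have "order_ge v 1 e" using c by (simp add: cst_simps)
    then show False using e by (simp add: order_ge_def)
  qed
next
  assume c0: "c \<noteq> 0"
  have *: "order_ge v 0 ((e - cst c) + cst c)"
    using c by (intro order_ge_add[OF v] order_ge_cst[OF v]) (auto intro: order_ge_mono)
  have "\<not> order_ge v 1 e"
  proof
    assume "order_ge v 1 e"
    then have "order_ge v 1 (e - (e - cst c))" using c order_ge_diff[OF v] by blast
    then show False using cst_not_order_ge_1[OF v] c0 by simp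
  qed
  then show "e \<noteq> 0 \<and> v e = 0" using * by (auto simp: order_ge_def)
qed

text \<open>
  The place enters the local form of \<open>h\<close> only through the condition that \<open>U\<close> and \<open>A\<close> do not vanish,
  which depends on \<open>(a, b)\<close> alone.
\<close>

theorem point_unique:
  assumes 1: "point v a b" and 2: "point v' a b"
  shows "v = v'"
proof
  fix h
  have v: "place v" "place v'" using 1 2 by (auto simp: point_def)
  have pos: "v (x - cst a) > 0" "v' (x - cst a) > 0" using point_x(1) 1 2 by auto
  show "v h = v' h"
  proof (cases "h \<in> K \<and> h \<noteq> 0")
    case False
    then show ?thesis using v place_outside place_0 by metis
  next
    case True
    then have h: "h \<in> K" "h \<noteq> 0" by auto
    obtain k l U A where UA: "U \<in> coordinate_ring" "A \<in> coordinate_ring" "U \<noteq> 0" "A \<noteq> 0" "v U = 0" "v A = 0"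
      "(x - cst a) ^ k * U * h = (x - cst a) ^ l * A"
      using affine_local_form[OF v(1) pos(1) h] by blast
    have same: "v' e = 0" if e0: "e \<in> coordinate_ring" "e \<noteq> 0" "v e = 0" for e
    proof -
      obtain c e1 e2 where e: "e1 \<in> coordinate_ring" "e2 \<in> coordinate_ring"
          "e = cst c + (x - cst a) * e1 + (y - cst b) * e2"
        using coordinate_ring_value[OF e0(1)] by blast
      have "c \<noteq> 0" using order_0_iff[OF v(1) point_value[OF 1 e(3,1,2)]] e0 by simp
      then show ?thesis using order_0_iff[OF v(2) point_value[OF 2 e(3,1,2)]] by simp
    qed
    have "v h = int l - int k"
      using local_form_order[OF v(1) h UA] place_over_finite_unramified[OF v(1) pos(1)] by simp
    moreover have "v' h = int l - int k"
      using local_form_order[OF v(2) h UA(1-4) same same UA(7)] UA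
        place_over_finite_unramified[OF v(2) pos(2)] by simp
    ultimately show ?thesis by simp
  qed
qed

text \<open>
  If \<open>v h \<ge> 0\<close>, the local form reads \<open>U h = (x - a)\<^sup>k A\<close> with \<open>k \<ge> 0\<close>, so \<open>h\<close> has the value
  \<open>r/u\<close>, where \<open>r\<close> and \<open>u \<noteq> 0\<close> are the values of the right-hand side and of \<open>U\<close>.
\<close>

theorem point_residue_field:
  assumes pt: "point v a b" and h: "h \<in> K" "order_ge v 0 h"
  shows "\<exists>c. order_ge v 1 (h - cst c)"
proof (cases "h = 0")
  case True
  then show ?thesis by (intro exI[of _ 0]) (simp add: cst_simps order_ge_0)
next
  case False
  have v: "place v" and pos: "v (x - cst a) > 0" using pt point_x by (auto simp: point_def)
  obtain k l U A where UA: "U \<in> coordinate_ring" "A \<in> coordinate_ring" "U \<noteq> 0" "A \<noteq> 0" "v U = 0" "v A = 0"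
      "(x - cst a) ^ k * U * h = (x - cst a) ^ l * A"
    using affine_local_form[OF v pos h(1) False] by blast
  have "v h = int l - int k"
    using local_form_order[OF v h(1) False UA] place_over_finite_unramified[OF v pos] by simp
  then have kl: "k \<le> l" using h False by (simp add: order_ge_def)
  have "(x - cst a) ^ k * (U * h) = (x - cst a) ^ k * ((x - cst a) ^ (l - k) * A)"
    using UA(7) kl by (simp add: mult.assoc flip: power_add mult.assoc)
  then have Uh: "U * h = (x - cst a) ^ (l - k) * A"
    using x_minus_cst_neq_0 by (simp only: mult_cancel_left power_eq_0_iff) simp
  have val: "\<exists>c. order_ge v 1 (e - cst c)" if "e \<in> coordinate_ring" for e
    using coordinate_ring_value[OF that] point_value[OF pt] by blast
  have "U * h \<in> coordinate_ring" unfolding Uh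
    using UA subring_coordinate_ring emb_coordinate_ring
    by (intro subring_mult subring_power subring_diff) auto
  then obtain r where r: "order_ge v 1 (U * h - cst r)" using val by blast
  obtain u where u: "order_ge v 1 (U - cst u)" using val UA by blast
  have u0: "u \<noteq> 0" using order_0_iff[OF v u] UA by simp
  define c where "c = r / u"
  have "U * (h - cst c) = (U * h - cst r) - (U - cst u) * cst c"
    using u0 by (simp add: c_def algebra_simps flip: cst_simps(4))
  moreover have "order_ge v 1 ((U - cst u) * cst c)"
    using order_ge_mult[OF v u order_ge_cst[OF v, of c]] by simp
  ultimately have ge: "order_ge v 1 (U * (h - cst c))" using order_ge_diff[OF v r] by simp
  have hc: "h - cst c \<in> K" using h by (simp add: K_closed)
  have "order_ge v 1 (h - cst c)"
  proof (cases "h - cst c = 0")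
    case False
    then show ?thesis
      using ge place_mult[OF v coordinate_ring_K[OF UA(1)] hc UA(3)] UA hc by (simp add: order_ge_def)
  qed (simp add: order_ge_0)
  then show ?thesis by blast
qed

lemma value_at_eq:
  assumes v: "place v" and h: "order_ge v 1 (h - cst c)"
  shows "value_at v h = c"
  unfolding value_at_def
proof (rule the_equality)
  have hK: "h \<in> K" using h K_add[of "h - cst c" "cst c"] by (simp add: order_ge_def K_emb)
  have van: "vanishes_at v (h - cst a) \<longleftrightarrow> order_ge v 1 (h - cst a)" for a
    using hK by (intro vanishes_iff) (simp add: K_closed)
  show "vanishes_at v (h - cst c)" using h van by simp
  fix a assume "vanishes_at v (h - cst a)"
  then have "order_ge v 1 ((h - cst c) - (h - cst a))" using van by (intro order_ge_diff[OF v h]) simp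
  moreover have "(h - cst c) - (h - cst a) = cst (a - c)" unfolding cst_simps by simp
  ultimately have "order_ge v 1 (cst (a - c))" by simp
  then show "a = c" using cst_not_order_ge_1[OF v] by fastforce
qed

lemma point_is_rational:
  assumes pt: "point v a b" shows "is_rational n f v" "v x \<ge> 0"
proof -
  have v: "place v" using pt by (simp add: point_def)
  show "is_rational n f v"
    unfolding is_rational_def
  proof (intro conjI ballI impI v)
    fix h assume h: "h \<in> K" "v h \<ge> 0"
    then have "order_ge v 0 h" by (simp add: order_ge_def)
    then show "\<exists>a. vanishes_at v (h - cst a)"
      using point_residue_field[OF pt h(1)] vanishes_iff[OF K_diff[OF h(1) K_emb]] by blast
  qed
  show "v x \<ge> 0" using point_x(2)[OF pt] by (simp add: order_ge_def)
qed

lemma point_on_curve: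
  "point v a b \<Longrightarrow> b ^ n = poly f a"
proof -
  assume pt: "point v a b"
  have v: "place v" using pt by (simp add: point_def)
  obtain s where s: "emb f = cst (poly f a) + (x - cst a) * emb s" using emb_expand by blast
  have "order_ge v (1 + 0) ((x - cst a) * emb s)"
    using pt point_coordinate_ring[OF pt emb_coordinate_ring]
    by (intro order_ge_mult[OF v]) (auto simp: point_def simp del: emb_simps)
  then have 1: "order_ge v 1 (y ^ n - cst (poly f a))" using s y_power by simp
  have "order_ge v (1 + 0) ((y - cst b) * (\<Sum>i<n. cst b ^ (n - Suc i) * y ^ i))"
  proof (intro order_ge_mult[OF v] order_ge_sum[OF v])
    show "order_ge v 1 (y - cst b)" using pt by (simp add: point_def)
    show "order_ge v 0 (cst b ^ (n - Suc i) * y ^ i)" for i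
      using order_ge_mult[OF v order_ge_cst[OF v, of "b ^ (n - Suc i)"] order_ge_power[OF v point_y[OF pt], of i]]
      by (simp add: cst_power)
  qed
  then have 2: "order_ge v 1 (y ^ n - cst (b ^ n))" by (simp add: power_diff_sumr2 cst_power)
  have "order_ge v 1 ((y ^ n - cst (poly f a)) - (y ^ n - cst (b ^ n)))"
    using 1 2 order_ge_diff[OF v] by blast
  then have "order_ge v 1 (cst (b ^ n - poly f a))" by (simp add: cst_simps del: emb_simps)
  then show ?thesis using cst_not_order_ge_1[OF v] by fastforce
qed

lemma point_of_rational:
  assumes r: "is_rational n f v" and x0: "v x \<ge> 0"
  shows "\<exists>a b. point v a b"
proof -
  have v: "place v" using r by (simp add: is_rational_def)
  have xge: "order_ge v 0 x" using x0 by (simp add: order_ge_def K_closed)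
  obtain a where "vanishes_at v (x - cst a)" using r x0 by (auto simp: is_rational_def K_closed)
  then have a: "order_ge v 1 (x - cst a)" using vanishes_iff[of "x - cst a"] by (simp add: K_closed)
  have "v (emb f) \<ge> 0" using order_ge_emb[OF v xge, of f] f_neq_0 by (simp add: order_ge_def)
  then have "int n * v y \<ge> 0" using place_y[OF v] by simp
  then have "v y \<ge> 0" using n_ge_2 by (simp add: zero_le_mult_iff)
  then obtain b where "vanishes_at v (y - cst b)" using r K_y by (auto simp: is_rational_def)
  then have "order_ge v 1 (y - cst b)" using vanishes_iff[of "y - cst b"] by (simp add: K_closed)
  then show ?thesis using a v by (auto simp: point_def)
qed

lemma affine_points_eq: "v \<in> affine_points n f \<longleftrightarrow> (\<exists>a b. point v a b)"
  using point_is_rational point_of_rational by (auto simp: affine_points_def)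

text \<open>
  \<open>X\<^sup>n - b\<^sup>n\<close> has \<open>n\<close> distinct roots in \<open>\<F>\<^sub>q\<close>.
\<close>

lemma kummer_factorization:
  assumes b: "b \<noteq> 0"
  shows "\<exists>k. k \<noteq> 0 \<and> monom 1 n - [:b ^ n:] = (\<Prod>z\<in>{z. z ^ n = b ^ n}. [:- z, 1:]) * [:k::'a:]"
proof -
  define p where "p = monom 1 n - [:b ^ n:]"
  have dp: "degree p = n"
  proof (rule antisym)
    show "degree p \<le> n" unfolding p_def
      by (rule degree_diff_le) (auto simp: degree_monom_le)
    show "n \<le> degree p"
      using n_ge_2 by (intro le_degree) (auto simp: p_def coeff_pCons split: nat.splits)
  qed
  have root: "poly p z = 0" if "z ^ n = b ^ n" for z using that by (simp add: p_def poly_monom)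
  have "\<exists>k. p = (\<Prod>z\<in>S. [:- z, 1:]) * k" if "finite S" "S \<subseteq> {z. z ^ n = b ^ n}" for S
    using that
  proof (induction S)
    case (insert z S)
    then obtain k where k: "p = (\<Prod>z\<in>S. [:- z, 1:]) * k" by auto
    have "poly (\<Prod>z\<in>S. [:- z, 1:]) z \<noteq> 0" using insert by (auto simp: poly_prod)
    then have "poly k z = 0" using root[of z] insert k by auto
    then have "[:- z, 1:] dvd k" by (simp add: poly_eq_0_iff_dvd)
    then obtain k' where "k = [:- z, 1:] * k'" by (rule dvdE)
    then have "p = ([:- z, 1:] * (\<Prod>z\<in>S. [:- z, 1:])) * k'" using k by (simp only: mult_ac)
    then show ?case unfolding prod.insert[OF insert.hyps] by blast
  qed simp
  from this[of "{z. z ^ n = b ^ n}"] obtain k where k: "p = (\<Prod>z\<in>{z. z ^ n = b ^ n}. [:- z, 1:]) * k"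
    by auto
  have "k \<noteq> 0" using k dp n_ge_2 by auto
  moreover have "(\<Prod>z\<in>{z::'a. z ^ n = b ^ n}. [:- z, 1:]) \<noteq> 0" by simp
  moreover have "degree (\<Prod>z\<in>{z::'a. z ^ n = b ^ n}. [:- z, 1:]) = n"
    using card_nth_roots[OF n_dvd _ b] n_ge_2 by (simp add: degree_prod_eq_sum_degree)
  ultimately have "degree k = 0" using dp k by (simp add: degree_mult_eq)
  then obtain k' where "k = [:k':]" by (rule degree_eq_zeroE)
  then show ?thesis using k \<open>k \<noteq> 0\<close> unfolding p_def by auto
qed

text \<open>
  \<open>y\<^sup>n - f(a)\<close> vanishes at the place and is a product of factors \<open>y - z\<close>; one of them vanishes.
\<close>

lemma place_over_split_point:
  assumes v: "place v" and pos: "v (x - cst a) > 0" and ab: "b ^ n = poly f a"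
  shows "\<exists>z. z ^ n = b ^ n \<and> point v a z"
proof -
  have b0: "b \<noteq> 0" using ab f_no_root[of a] n_ge_2 by (auto simp: power_0_left)
  have xge: "order_ge v 0 x" using affine_order_ge_x[OF v] pos by simp
  have xv: "order_ge v 1 (x - cst a)" using pos by (simp add: order_ge_def K_closed)
  obtain s where s: "emb f = cst (poly f a) + (x - cst a) * emb s" using emb_expand by blast
  have "order_ge v (1 + 0) ((x - cst a) * emb s)"
    by (rule order_ge_mult[OF v xv order_ge_emb[OF v xge]])
  then have 1: "order_ge v 1 (y ^ n - cst (b ^ n))" using s y_power ab by simp
  obtain k where k: "k \<noteq> 0" "monom 1 n - [:b ^ n:] = (\<Prod>z\<in>{z. z ^ n = b ^ n}. [:- z, 1:]) * [:k:]"
    using kummer_factorization[OF b0] by blast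
  have "y ^ n - cst (b ^ n) = cst_eval y (monom 1 n - [:b ^ n:])"
    by (simp add: cst_eval_monom cst_simps)
  also have "\<dots> = (\<Prod>z\<in>{z. z ^ n = b ^ n}. y - cst z) * cst k"
    unfolding k(2) by (simp add: cst_eval_prod cst_simps algebra_simps del: emb_simps)
  finally have prod: "y ^ n - cst (b ^ n) = (\<Prod>z\<in>{z. z ^ n = b ^ n}. y - cst z) * cst k" .
  have "int n * v y \<ge> 0"
    using place_y[OF v] order_ge_emb[OF v xge, of f] f_neq_0 by (simp add: order_ge_def)
  then have yge: "order_ge v 0 y" using n_ge_2 by (simp add: order_ge_def K_y zero_le_mult_iff)
  have yz: "order_ge v 0 (y - cst z)" for z
    using yge order_ge_cst[OF v] by (rule order_ge_diff[OF v])
  have "\<exists>z. z ^ n = b ^ n \<and> order_ge v 1 (y - cst z)"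
  proof (rule ccontr)
    assume n: "\<not> ?thesis"
    have "(\<Prod>z\<in>S. y - cst z) \<in> K \<and> (\<Prod>z\<in>S. y - cst z) \<noteq> 0 \<and> v (\<Prod>z\<in>S. y - cst z) = 0"
      if "finite S" "S \<subseteq> {z. z ^ n = b ^ n}" for S
      using that
    proof (induction S)
      case empty
      then show ?case by (simp add: K_closed place_1[OF v])
    next
      case (insert z S)
      then have "\<not> order_ge v 1 (y - cst z)" using n by auto
      then have "y - cst z \<noteq> 0" "v (y - cst z) = 0" "y - cst z \<in> K"
        using yz[of z] by (auto simp: order_ge_def)
      then show ?case using insert place_mult[OF v, of "y - cst z" "\<Prod>z\<in>S. y - cst z"]
        by (simp add: K_closed)
    qed
    from this[of "{z. z ^ n = b ^ n}"]
    have P: "(\<Prod>z\<in>{z. z ^ n = b ^ n}. y - cst z) \<in> K" "(\<Prod>z\<in>{z. z ^ n = b ^ n}. y - cst z) \<noteq> 0"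
        "v (\<Prod>z\<in>{z. z ^ n = b ^ n}. y - cst z) = 0"
      by auto
    have "v (y ^ n - cst (b ^ n)) = 0" "y ^ n - cst (b ^ n) \<noteq> 0"
      unfolding prod using place_mult[OF v P(1) K_emb P(2), of "[:k:]"] k(1) P place_cst[OF v, of k] by auto
    then show False using 1 by (simp add: order_ge_def)
  qed
  then show ?thesis using v xv by (auto simp: point_def)
qed

text \<open>
  Some place over \<open>a\<close> is a point \<open>(a, z)\<close> with \<open>z\<^sup>n = b\<^sup>n\<close>; the automorphism \<open>y \<mapsto> (b/z) y\<close> moves it to
  \<open>(a, b)\<close>.
\<close>

theorem point_exists:
  assumes ab: "b ^ n = poly f a"
  shows "\<exists>v. point v a b"
proof -
  have b0: "b \<noteq> 0" using ab f_no_root[of a] n_ge_2 by (auto simp: power_0_left)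
  have "irreducible [:- a, 1:]" by (rule irreducible_linear_field_poly) simp
  then obtain v where v: "place v" and "v (emb [:- a, 1:]) > 0"
    using place_over_irreducible by blast
  moreover have X: "emb [:- a, 1:] = x - cst a" by (simp flip: emb_simps)
  ultimately have pos: "v (x - cst a) > 0" by simp
  obtain z where z: "z ^ n = b ^ n" "order_ge v 1 (y - cst z)"
    using place_over_split_point[OF v pos ab] by (auto simp: point_def)
  have z0: "z \<noteq> 0" using z b0 n_ge_2 by (auto simp: power_0_left)
  define w where "w = b / z"
  have w: "w ^ n = 1" "w \<noteq> 0" "w * z = b" using z z0 b0 by (auto simp: w_def power_divide)
  let ?v = "\<lambda>h. if h \<in> K then v (galois w h) else 0"
  have gx: "galois w (x - cst a) = x - cst a"
    using w galois_emb[of w "[:- a, 1:]"] X by simp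
  have "galois w (y - cst b) = galois w (y + cst (- b))" by (simp add: cst_simps)
  also have "\<dots> = cst w * y - cst b"
    unfolding galois_add[OF w(1) K_y K_emb] galois_y[OF w(1)] galois_emb[OF w(1)]
    by (simp add: cst_simps)
  also have "\<dots> = cst w * (y - cst z)"
    unfolding w(3)[symmetric] by (simp add: cst_simps algebra_simps del: emb_simps)
  finally have gy: "galois w (y - cst b) = cst w * (y - cst z)" .
  have "order_ge v (0 + 1) (cst w * (y - cst z))" by (rule order_ge_mult[OF v order_ge_cst[OF v] z(2)])
  then have gy': "order_ge v 1 (galois w (y - cst b))" unfolding gy by simp
  have "point ?v a b"
    unfolding point_def
  proof (intro conjI)
    show "place ?v" using place_galois[OF v w(1)] .
    show "order_ge ?v 1 (x - cst a)" using pos X gx by (auto simp: order_ge_def K_closed simp del: emb_simps)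
    show "order_ge ?v 1 (y - cst b)"
      using gy' galois_eq_0_iff[OF w(1), of "y - cst b"] by (auto simp: order_ge_def K_closed)
  qed
  then show ?thesis by blast
qed

subsection \<open>Places at infinity\<close>

text \<open>
  Up to a power of \<open>1/x\<close>, which clears the poles of polynomials in \<open>x\<close>, the powers \<open>y\<^sup>i\<close> with \<open>i < n'\<close>
  generate the coordinate ring over \<open>\<F>\<^sub>q[1/x, w]\<close>, as \<open>y\<^bsup>n'\<^esup> = w x\<^bsup>d'\<^esup>\<close>.
\<close>

lemma infinity_decomposition:
  fixes n' d' :: nat
  assumes e: "e \<in> coordinate_ring" and n': "n' > 0"
  defines "w \<equiv> y ^ n' / x ^ d'"
  shows "\<exists>L A. (\<forall>i. A i \<in> adjoin infinity_ring w) \<and> inverse x ^ L * e = (\<Sum>i<n'. y ^ i * A i)"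
proof -
  let ?B = "adjoin infinity_ring w"
  note S = subring_adjoin[OF subring_infinity_ring, of w]
  have RB: "infinity_ring \<subseteq> ?B" and wB: "w \<in> ?B"
    using subset_adjoin[OF subring_infinity_ring] mem_adjoin[OF subring_infinity_ring] by auto
  have x0: "x \<noteq> 0" by simp
  have tB: "inverse x \<in> ?B" using infinity_ringI[of 1 1] RB by (auto simp: divide_inverse)
  define Q where "Q = (\<lambda>e. \<exists>L A. (\<forall>i. A i \<in> ?B) \<and> inverse x ^ L * e = (\<Sum>i<n'. y ^ i * A i))"
  have Qadd: "Q (e1 + e2)" if "Q e1" "Q e2" for e1 e2
  proof -
    obtain L A where 1: "\<forall>i. A i \<in> ?B" "inverse x ^ L * e1 = (\<Sum>i<n'. y ^ i * A i)"
      using \<open>Q e1\<close> unfolding Q_def by blast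
    obtain L' A' where 2: "\<forall>i. A' i \<in> ?B" "inverse x ^ L' * e2 = (\<Sum>i<n'. y ^ i * A' i)"
      using \<open>Q e2\<close> unfolding Q_def by blast
    have "inverse x ^ (L + L') * (e1 + e2)
        = inverse x ^ L' * (inverse x ^ L * e1) + inverse x ^ L * (inverse x ^ L' * e2)"
      by (simp add: power_add algebra_simps)
    also have "\<dots> = (\<Sum>i<n'. y ^ i * (inverse x ^ L' * A i + inverse x ^ L * A' i))"
      unfolding 1(2) 2(2) by (simp add: sum_distrib_left sum.distrib algebra_simps)
    finally have "inverse x ^ (L + L') * (e1 + e2)
        = (\<Sum>i<n'. y ^ i * (inverse x ^ L' * A i + inverse x ^ L * A' i))" .
    moreover have "inverse x ^ L' * A i + inverse x ^ L * A' i \<in> ?B" for i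
      using 1 2 tB S by (intro subring_add subring_mult subring_power) auto
    ultimately show ?thesis unfolding Q_def
      by (intro exI[of _ "L + L'"] exI[of _ "\<lambda>i. inverse x ^ L' * A i + inverse x ^ L * A' i"]) auto
  qed
  have Qmonom: "Q (emb r * y ^ j)" for r j
  proof -
    define i k where "i = j mod n'" and "k = j div n'"
    have j: "j = i + n' * k" by (simp add: i_def k_def)
    have i: "i < n'" using n' by (simp add: i_def)
    define a where "a = (emb r / x ^ degree r) * w ^ k"
    have aB: "a \<in> ?B" unfolding a_def
      using infinity_ringI[of r "degree r"] RB wB S by (intro subring_mult subring_power) auto
    have "y ^ n' = w * x ^ d'" using x0 by (simp add: w_def)
    then have "y ^ j = y ^ i * (w ^ k * (x ^ d') ^ k)" by (simp add: j power_add power_mult power_mult_distrib)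
    then have "inverse x ^ (degree r + d' * k) * (emb r * y ^ j) = y ^ i * a"
      using x0 by (simp add: a_def power_add power_mult power_inverse field_simps)
    also have "\<dots> = (\<Sum>l<n'. y ^ l * (if l = i then a else 0))"
      using i by (simp add: if_distrib sum.delta cong: if_cong)
    finally show ?thesis unfolding Q_def using aB subring_zero[OF S]
      by (intro exI[of _ "degree r + d' * k"] exI[of _ "\<lambda>l. if l = i then a else 0"]) auto
  qed
  have Q0: "Q 0" unfolding Q_def using subring_zero[OF S] by (intro exI[of _ 0] exI[of _ "\<lambda>_. 0"]) auto
  have Qsum: "Q (sum g I)" if "\<And>i. i \<in> I \<Longrightarrow> Q (g i)" for g and I :: "nat set"
    using that by (induction I rule: infinite_finite_induct) (auto simp: Q0 Qadd)
  obtain p where p: "e = poly p y" "\<forall>i. coeff p i \<in> range emb" using e by (auto simp: adjoin_def)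
  have "Q e" unfolding p(1) poly_altdef
  proof (rule Qsum)
    fix i obtain r where "coeff p i = emb r" using p(2) by blast
    then show "Q (coeff p i * y ^ i)" using Qmonom by simp
  qed
  then show ?thesis by (simp add: Q_def)
qed

text \<open>
  Write \<open>n = n'c\<close> and \<open>d = d'c\<close>.  From \<open>n v(y) = d v(x)\<close> one gets \<open>v(x) = -n'e\<close> and \<open>v(y) = -d'e\<close> for some
  \<open>e > 0\<close>, and \<open>e = 1\<close> has to be shown.  The function \<open>w = y\<^bsup>n'\<^esup>/x\<^bsup>d'\<^esup>\<close> satisfies \<open>w\<^sup>c = f/x\<^sup>d\<close>, whose
  value at infinity is the leading coefficient of \<open>f\<close>; so by the descent the orders on
  \<open>\<F>\<^sub>q[1/x, w]\<close> are multiples of \<open>n'e\<close>.  The terms \<open>y\<^sup>i A\<^sub>i\<close>, \<open>i < n'\<close>, of a function then have orders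
  that are multiples of \<open>e\<close> and distinct modulo \<open>n'e\<close>, since \<open>d'\<close> is prime to \<open>n'\<close>.  So every order is
  a multiple of \<open>e\<close>, and \<open>e\<close> divides \<open>1\<close>.
\<close>

theorem place_at_infinity:
  assumes v: "place v" and neg: "v x < 0"
  shows "v x = - int (n div gcd n d)"
proof -
  define c n' d' where "c = gcd n d" and "n' = n div c" and "d' = d div c"
  have c0: "c > 0" using n_ge_2 by (simp add: c_def)
  have nd: "n = n' * c" "d = d' * c" by (simp_all add: c_def n'_def d'_def)
  have n'0: "n' > 0" using nd n_ge_2 by (cases n') auto
  have cop: "coprime n' d'"
    unfolding n'_def d'_def c_def using n_ge_2 by (intro div_gcd_coprime) simp
  have x0: "x \<noteq> 0" by simp
  have "int n * v y = int d * v x"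
    using place_y[OF v] place_emb_infinite[OF v neg f_neq_0] degree_f by simp
  then have "int c * (int n' * v y) = int c * (int d' * v x)" by (simp add: nd algebra_simps)
  then have rel: "int n' * v y = int d' * v x" using c0 by simp
  have "int n' dvd int d' * v x" using rel by (metis dvd_triv_left)
  then have "int n' dvd v x" using cop by (simp add: coprime_dvd_mult_right_iff)
  then obtain e' where e': "v x = int n' * e'" by (rule dvdE)
  define e0 where "e0 = - e'"
  have vx: "v x = - (int n' * e0)" by (simp add: e' e0_def)
  have "int n' * v y = int n' * - (int d' * e0)" using rel by (simp add: vx mult.left_commute)
  then have vy: "v y = - (int d' * e0)" using n'0 by (simp only: mult_cancel_left) simp
  define w where "w = y ^ n' / x ^ d'"
  have wK: "w \<in> K" unfolding w_def divide_inverse by (intro K_mult K_power K_y K_inverse K_emb)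
  have ix: "inverse x \<in> K" using K_inverse[OF K_emb] .
  have vt: "v (inverse x) = int n' * e0"
    using place_divide[OF v K_1 K_emb, of "[:0, 1:]"] place_1[OF v] vx by (simp add: divide_inverse)
  have vinv: "v (emb p / x ^ m) \<ge> 0" if "degree p \<le> m" "p \<noteq> 0" for p m
  proof -
    have "v (emb p / x ^ m) = int (degree p) * v x - int m * v x"
      using place_divide[OF v K_emb K_power[OF K_emb], of p "[:0, 1:]" m] that
        place_power[OF v K_emb, of "[:0, 1:]" m] place_emb_infinite[OF v neg that(2)] by simp
    also have "\<dots> = (int m - int (degree p)) * (- v x)" by (simp add: algebra_simps)
    also have "\<dots> \<ge> 0" using that neg by (intro mult_nonneg_nonneg) auto
    finally show ?thesis .
  qed
  obtain \<phi> where phi: "\<phi> \<in> infinity_ring" "emb f / x ^ d = cst (coeff f d) + inverse x * \<phi>"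
    using infinity_ring_expand[of f d] degree_f by auto
  have wc: "w ^ c = cst (coeff f d) + inverse x * \<phi>"
    unfolding phi(2)[symmetric] w_def using nd y_power by (simp add: power_divide flip: power_mult)
  have descent: "\<exists>k::int. v A = k * (int n' * e0)" if A: "A \<in> adjoin infinity_ring w" "A \<noteq> 0" for A
  proof -
    have RK: "infinity_ring \<subseteq> K"
      by (auto simp: infinity_ring_def divide_inverse intro!: K_closed K_inverse)
    have ord: "order_ge v 0 r" if r: "r \<in> infinity_ring" for r
    proof -
      obtain p m where "degree p \<le> m" "r = emb p / x ^ m" using r by (auto simp: infinity_ring_def)
      then show ?thesis using r RK vinv[of p m] by (cases "p = 0") (auto simp: order_ge_def)
    qed
    have "\<exists>k. \<exists>U\<in>adjoin infinity_ring w. \<exists>A'\<in>adjoin infinity_ring w.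
        U \<noteq> 0 \<and> A' \<noteq> 0 \<and> v U = 0 \<and> v A' = 0 \<and> U * A = inverse x ^ k * A'"
    proof (rule unramified_descent[OF v subring_infinity_ring RK cst_infinity_ring ord _ _ _ _ wK wc phi(1) _ _ A])
      show "inverse x \<in> infinity_ring" using infinity_ringI[of 1 1] by (simp add: divide_inverse)
      show "inverse x \<noteq> 0" by simp
      show "v (inverse x) > 0" using vt vx neg by simp
      show "\<exists>a. \<exists>r'\<in>infinity_ring. r = cst a + inverse x * r'" if r: "r \<in> infinity_ring" for r
      proof -
        obtain p m where pm: "degree p \<le> m" "r = emb p / x ^ m" using r by (auto simp: infinity_ring_def)
        show ?thesis unfolding pm(2) using infinity_ring_expand[OF pm(1)] by blast
      qed
      show "coeff f d \<noteq> 0" using degree_f f_neq_0 by auto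
      show "(of_nat c :: 'a) \<noteq> 0" using of_nat_n_neq_0 nd by auto
    qed
    then obtain k U A' where U: "U \<in> adjoin infinity_ring w" "A' \<in> adjoin infinity_ring w"
        "U \<noteq> 0" "A' \<noteq> 0" "v U = 0" "v A' = 0" "U * A = inverse x ^ k * A'" by blast
    have BK: "b \<in> K" if "b \<in> adjoin infinity_ring w" for b
    proof -
      obtain p where p: "b = poly p w" "\<forall>i. coeff p i \<in> infinity_ring"
        using \<open>b \<in> adjoin infinity_ring w\<close> by (auto simp: adjoin_def)
      then show ?thesis unfolding p(1) poly_altdef using RK wK by (intro K_sum K_mult K_power) auto
    qed
    have "v (U * A) = v A" using place_mult[OF v BK BK, of U A] U A by simp
    moreover have "v (inverse x ^ k * A') = int k * v (inverse x)"
      using place_mult[OF v K_power[OF ix] BK, of A' k] place_power[OF v ix, of k] U by simp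
    ultimately have "v A = int k * (int n' * e0)" using U vt by simp
    then show ?thesis by blast
  qed
  have BK: "b \<in> K" if "b \<in> adjoin infinity_ring w" for b
  proof -
    obtain p where p: "b = poly p w" "\<forall>i. coeff p i \<in> infinity_ring"
      using \<open>b \<in> adjoin infinity_ring w\<close> by (auto simp: adjoin_def)
    have RK: "infinity_ring \<subseteq> K"
      by (auto simp: infinity_ring_def divide_inverse intro!: K_closed K_inverse)
    show ?thesis unfolding p(1) poly_altdef using RK wK p by (intro K_sum K_mult K_power) auto
  qed
  obtain h where h: "h \<in> K" "h \<noteq> 0" "v h = 1" using place_uniformizer[OF v] by blast
  obtain D where D: "D \<noteq> 0" "emb D * h \<in> coordinate_ring" using clear_denominators h by blast
  obtain L A where A: "\<And>i. A i \<in> adjoin infinity_ring w"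
      "inverse x ^ L * (emb D * h) = (\<Sum>i<n'. y ^ i * A i)"
    using infinity_decomposition[OF D(2) n'0, of d'] unfolding w_def by blast
  define I where "I = {i. i < n' \<and> A i \<noteq> 0}"
  define t where "t = (\<lambda>i. y ^ i * A i)"
  have sum: "inverse x ^ L * (emb D * h) = sum t I"
    unfolding A(2) t_def I_def by (rule sum.mono_neutral_right) auto
  have lhs0: "inverse x ^ L * (emb D * h) \<noteq> 0" using D h by simp
  have "sum t I \<noteq> 0" using sum lhs0 by simp
  then have I: "finite I" "I \<noteq> {}" by (auto simp only: sum.empty) (simp add: I_def)
  have tK: "t i \<in> K \<and> t i \<noteq> 0" if "i \<in> I" for i
    using that BK[OF A(1)] y_neq_0 by (simp add: t_def I_def K_closed)
  have vti: "\<exists>k::int. v (t i) = e0 * (k * int n' - int i * int d')" if "i \<in> I" for i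
  proof -
    have Ai: "A i \<noteq> 0" using that by (simp add: I_def)
    obtain k where k: "v (A i) = k * (int n' * e0)" using descent[OF A(1) Ai] by blast
    have "v (t i) = int i * v y + v (A i)"
      using place_mult[OF v K_power[OF K_y] BK[OF A(1)], of i i] place_power[OF v K_y y_neq_0] Ai y_neq_0
      by (simp add: t_def)
    then have "v (t i) = e0 * (k * int n' - int i * int d')" by (simp add: vy k algebra_simps)
    then show ?thesis by blast
  qed
  have e0: "e0 > 0" using vx neg n'0 by (simp add: zero_less_mult_iff)
  have inj: "inj_on (\<lambda>i. v (t i)) I"
  proof (rule inj_onI)
    fix i j assume ij: "i \<in> I" "j \<in> I" "v (t i) = v (t j)"
    obtain k l where "v (t i) = e0 * (k * int n' - int i * int d')" "v (t j) = e0 * (l * int n' - int j * int d')"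
      using vti ij by meson
    then have "k * int n' - int i * int d' = l * int n' - int j * int d'" using ij e0 by simp
    then have "(int i - int j) * int d' = (k - l) * int n'" by (simp add: algebra_simps)
    then have "int n' dvd (int i - int j) * int d'" by simp
    then have "int n' dvd int i - int j" using cop by (simp add: coprime_dvd_mult_left_iff)
    then have "int i mod int n' = int j mod int n'" by (simp add: mod_eq_dvd_iff)
    then show "i = j" using ij by (simp add: I_def)
  qed
  have "v (sum t I) = Min ((\<lambda>i. v (t i)) ` I)" using place_sum_distinct[OF v I tK inj] by blast
  moreover have "Min ((\<lambda>i. v (t i)) ` I) \<in> (\<lambda>i. v (t i)) ` I" using I by (intro Min_in) auto
  ultimately obtain i where "i \<in> I" "v (sum t I) = v (t i)" by auto
  then have dvd1: "e0 dvd v (inverse x ^ L * (emb D * h))" using vti sum by (metis dvd_triv_left)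
  have "v (inverse x ^ L * (emb D * h)) = int L * v (inverse x) + (v (emb D) + v h)"
    using place_mult[OF v K_power[OF ix] K_mult[OF K_emb h(1)], of L D] place_mult[OF v K_emb h(1), of D]
      place_power[OF v ix, of L] D h by simp
  also have "\<dots> = e0 * (int L * int n' - int (degree D) * int n') + 1"
    using place_emb_infinite[OF v neg D(1)] by (simp add: vt vx h algebra_simps)
  finally have "e0 dvd e0 * (int L * int n' - int (degree D) * int n') + 1" using dvd1 by simp
  then have "e0 dvd 1" by (simp add: dvd_add_right_iff)
  then have "e0 = 1" using e0 by simp
  then show ?thesis using vx by (simp add: n'_def c_def)
qed


section \<open>Riemann-Roch spaces\<close>

abbreviation c :: nat where "c \<equiv> gcd n d"

lemma c_pos: "c > 0"
  using n_ge_2 by simp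

lemma int_n_eq: "int n = int (n div c) * int c" and int_d_eq: "int d = int (d div c) * int c"
  by (simp_all flip: of_nat_mult)

lemma ninf_eq: "ninf n f = int c"
  by (simp add: ninf_def degree_f)

lemma Delta_iff: "a \<notin> Delta n f \<longleftrightarrow> (\<exists>b. b ^ n = poly f a)"
proof -
  have "b \<noteq> 0" if "b ^ n = poly f a" for b
    using that f_no_root[of a] n_ge_2 by (auto simp: power_0_left)
  then show ?thesis by (auto simp: Delta_def) metis
qed

lemma place_y_infinite:
  assumes v: "place v" and neg: "v x < 0" shows "v y = - int (d div c)"
proof -
  have "int n * v y = int d * v x"
    using place_y[OF v] place_emb_infinite[OF v neg f_neq_0] degree_f by simp
  also have "\<dots> = int n * - int (d div c)"
    unfolding place_at_infinity[OF v neg] using int_n_eq int_d_eq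
    by (metis mult.commute mult.left_commute mult_minus_right)
  finally have "int n * v y = int n * - int (d div c)" .
  then show ?thesis using n_ge_2 by (simp only: mult_cancel_left) simp
qed

text \<open>
  A family \<open>P\<close> of polynomials stands for the function \<open>\<Sum>\<^sub>j P\<^sub>j(x) y\<^sup>j\<close>; the monomials
  \<open>x\<^sup>i y\<^sup>j\<close> of a bounded family have pole order at most \<open>s\<close> at infinity.
\<close>

definition bounded :: "int \<Rightarrow> (nat \<Rightarrow> 'a poly) \<Rightarrow> bool" where
  "bounded s P \<longleftrightarrow> (\<forall>i j. coeff (P j) i \<noteq> 0 \<longrightarrow> j < n \<and> int n * int i + int d * int j \<le> int c * s)"

definition function_of :: "(nat \<Rightarrow> 'a poly) \<Rightarrow> 'a ambient" where
  "function_of P = (\<Sum>j<n. emb (P j) * y ^ j)"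

abbreviation Lspace :: "int \<Rightarrow> 'a ambient set" where
  "Lspace s \<equiv> riemann_roch_space n f (\<lambda>v. s * div_inf n f v)"

lemma function_of_K: "function_of P \<in> K"
  by (simp add: function_of_def K_closed)

lemma Lspace_iff:
  "h \<in> Lspace s \<longleftrightarrow> h \<in> K \<and> (\<forall>v. place v \<longrightarrow> order_ge v (if v x < 0 then - s else 0) h)"
  by (auto simp: riemann_roch_space_def order_ge_def div_inf_def)

lemma finite_place_y:
  assumes v: "place v" and xge: "v x \<ge> 0" shows "order_ge v 0 y" "order_ge v 0 (emb p)"
proof -
  have x: "order_ge v 0 x" using xge by (simp add: order_ge_def K_emb)
  show "order_ge v 0 (emb p)" for p using order_ge_emb[OF v x] .
  from this[of f] have "int n * v y \<ge> 0" using place_y[OF v] f_neq_0 by (simp add: order_ge_def)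
  then show "order_ge v 0 y" using n_ge_2 by (simp add: order_ge_def K_y zero_le_mult_iff)
qed

lemma place_monomial_infinite:
  assumes v: "place v" and neg: "v x < 0" and p: "p \<noteq> 0"
  shows "int c * v (emb p * y ^ j) = - (int n * int (degree p) + int d * int j)"
proof -
  have "v (emb p * y ^ j) = int (degree p) * v x + int j * v y"
    using place_mult[OF v K_emb K_power[OF K_y], of p j] place_power[OF v K_y y_neq_0] p y_neq_0
      place_emb_infinite[OF v neg p] by simp
  also have "\<dots> = - (int (degree p) * int (n div c) + int j * int (d div c))"
    using place_at_infinity[OF v neg] place_y_infinite[OF v neg] by simp
  finally have "int c * v (emb p * y ^ j)
      = - ((int (n div c) * int c) * int (degree p) + (int (d div c) * int c) * int j)"
    by (simp only: minus_mult_right[symmetric] distrib_left mult_ac)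
  then show ?thesis unfolding int_n_eq[symmetric] int_d_eq[symmetric] .
qed

lemma bounded_in_Lspace:
  assumes P: "bounded s P" shows "function_of P \<in> Lspace s"
  unfolding Lspace_iff
proof (intro conjI allI impI function_of_K)
  fix v assume v: "place v"
  show "order_ge v (if v x < 0 then - s else 0) (function_of P)"
    unfolding function_of_def
  proof (rule order_ge_sum[OF v])
    fix j
    show "order_ge v (if v x < 0 then - s else 0) (emb (P j) * y ^ j)"
    proof (cases "v x < 0 \<and> P j \<noteq> 0")
      case True
      then have "coeff (P j) (degree (P j)) \<noteq> 0" by simp
      then have "int n * int (degree (P j)) + int d * int j \<le> int c * s"
        using P by (auto simp: bounded_def)
      then have "int c * (- s) \<le> int c * v (emb (P j) * y ^ j)"
        using place_monomial_infinite[OF v, of "P j" j] True by simp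
      then have "- s \<le> v (emb (P j) * y ^ j)"
        by (rule mult_left_le_imp_le) (use c_pos in simp)
      then show ?thesis using True by (simp add: order_ge_def K_closed)
    next
      case False
      then show ?thesis
      proof (cases "P j = 0")
        case False
        then have "v x \<ge> 0" using \<open>\<not> (v x < 0 \<and> P j \<noteq> 0)\<close> by simp
        then show ?thesis
          using order_ge_mult[OF v finite_place_y(2)[OF v, of "P j"] order_ge_power[OF v finite_place_y(1)[OF v], of j]]
          by simp
      qed (simp add: order_ge_0)
    qed
  qed
qed

lemma roots_of_unity_sum:
  assumes jm: "j < n" "m < n" "j \<noteq> m"
  shows "(\<Sum>z\<in>{z::'a. z ^ n = 1}. z ^ j * inverse z ^ m) = 0"
proof -
  have "\<exists>w::'a. w ^ n = 1 \<and> w ^ j \<noteq> w ^ m"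
  proof (rule ccontr)
    assume no: "\<not> ?thesis"
    define p where "p = monom (1::'a) j - monom 1 m"
    have "coeff p j = 1" using jm by (simp add: p_def)
    then have p0: "p \<noteq> 0" by auto
    have "{z::'a. z ^ n = 1} \<subseteq> {z. poly p z = 0}" using no by (auto simp: p_def poly_monom)
    then have "n \<le> card {z. poly p z = 0}"
      using card_mono[OF poly_roots_finite[OF p0], of "{z. z ^ n = 1}"] card_roots_of_unity[OF n_dvd] n_ge_2
      by simp
    also have "\<dots> \<le> degree p" by (rule card_poly_roots_bound[OF p0])
    also have "degree p \<le> n - 1" unfolding p_def
      using jm by (intro degree_diff_le) (simp_all add: degree_monom_eq)
    also have "n - 1 < n" using jm by simp
    finally show False by simp
  qed
  then obtain w :: 'a where w: "w ^ n = 1" "w ^ j \<noteq> w ^ m" by blast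
  have w0: "w \<noteq> 0" using w n_ge_2 by (auto simp: power_0_left)
  let ?S = "\<Sum>z\<in>{z::'a. z ^ n = 1}. z ^ j * inverse z ^ m"
  have "?S = (\<Sum>z\<in>{z. z ^ n = 1}. (w * z) ^ j * inverse (w * z) ^ m)"
    by (rule sum.reindex_bij_witness[of _ "\<lambda>z. w * z" "\<lambda>z. z / w"])
      (use w w0 in \<open>auto simp: power_mult_distrib power_divide\<close>)
  also have "\<dots> = (w ^ j * inverse w ^ m) * ?S"
    by (simp add: sum_distrib_left power_mult_distrib mult_ac)
  finally have "(w ^ j * inverse w ^ m - 1) * ?S = 0" by (simp add: algebra_simps)
  moreover have "w ^ j * inverse w ^ m \<noteq> 1" using w w0 by (simp add: power_inverse field_simps)
  ultimately show ?thesis by simp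
qed

text \<open>
  Orthogonality of the characters \<open>z \<mapsto> z\<^sup>j\<close> isolates one component.
\<close>

lemma galois_average:
  assumes r: "degree r < n" and m: "m < n"
  shows "(\<Sum>z\<in>{z. z ^ n = 1}. cst (inverse z ^ m) * galois z (rat_eval y r))
    = cst (of_nat n) * (to_ac (coeff r m) * y ^ m)"
proof -
  have "(\<Sum>z\<in>{z. z ^ n = 1}. cst (inverse z ^ m) * galois z (rat_eval y r))
      = (\<Sum>z\<in>{z. z ^ n = 1}. \<Sum>j<n. cst (z ^ j * inverse z ^ m) * (to_ac (coeff r j) * y ^ j))"
  proof (intro sum.cong refl)
    fix z :: 'a assume "z \<in> {z. z ^ n = 1}"
    then have "galois z (rat_eval y r) = (\<Sum>j<n. to_ac (coeff r j) * (cst z * y) ^ j)"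
      by (simp add: galois_rat_eval rat_eval_altdef'[OF r, of "cst z * y"])
    then show "cst (inverse z ^ m) * galois z (rat_eval y r)
        = (\<Sum>j<n. cst (z ^ j * inverse z ^ m) * (to_ac (coeff r j) * y ^ j))"
      by (simp only: sum_distrib_left cst_simps(4) cst_power power_mult_distrib mult_ac)
  qed
  also have "\<dots> = (\<Sum>j<n. cst (\<Sum>z\<in>{z. z ^ n = 1}. z ^ j * inverse z ^ m) * (to_ac (coeff r j) * y ^ j))"
  proof (subst sum.swap, intro sum.cong refl)
    fix j
    show "(\<Sum>z\<in>{z. z ^ n = 1}. cst (z ^ j * inverse z ^ m) * (to_ac (coeff r j) * y ^ j))
        = cst (\<Sum>z\<in>{z. z ^ n = 1}. z ^ j * inverse z ^ m) * (to_ac (coeff r j) * y ^ j)"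
      by (simp only: sum_distrib_right cst_sum)
  qed
  also have "\<dots> = (\<Sum>j<n. if j = m then cst (of_nat n) * (to_ac (coeff r m) * y ^ m) else 0)"
  proof (intro sum.cong refl)
    fix j assume j: "j \<in> {..<n}"
    show "cst (\<Sum>z\<in>{z. z ^ n = 1}. z ^ j * inverse z ^ m) * (to_ac (coeff r j) * y ^ j)
        = (if j = m then cst (of_nat n) * (to_ac (coeff r m) * y ^ m) else 0)"
    proof (cases "j = m")
      case True
      have "z ^ m * inverse z ^ m = 1" if "z ^ n = 1" for z :: 'a
        using that n_ge_2 by (cases "z = 0") (auto simp: power_0_left simp flip: power_mult_distrib)
      then have "(\<Sum>z\<in>{z::'a. z ^ n = 1}. z ^ m * inverse z ^ m) = of_nat n"
        using card_roots_of_unity[OF n_dvd] n_ge_2 by simp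
      then show ?thesis using True by simp
    next
      case False
      then show ?thesis using roots_of_unity_sum[of j m] j m by (simp add: cst_simps)
    qed
  qed
  also have "\<dots> = cst (of_nat n) * (to_ac (coeff r m) * y ^ m)" using m by simp
  finally show ?thesis .
qed

text \<open>
  \<open>L(sD\<^sub>\<infinity>)\<close> is stable under the automorphisms, as they fix \<open>x\<close> and so permute the places at infinity.
\<close>

lemma Lspace_component:
  assumes h: "rat_eval y r \<in> Lspace s" and r: "degree r < n" and m: "m < n"
  shows "to_ac (coeff r m) * y ^ m \<in> Lspace s"
  unfolding Lspace_iff
proof (intro conjI allI impI)
  show K: "to_ac (coeff r m) * y ^ m \<in> K" by (simp add: K_closed)
  fix v assume v: "place v"
  define b where "b = (if v x < 0 then - s else 0)"
  have hK: "rat_eval y r \<in> K" using h by (simp add: Lspace_iff)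
  have gal: "order_ge v b (galois z (rat_eval y r))" if z: "z ^ n = 1" for z
  proof -
    define v' where "v' = (\<lambda>h. if h \<in> K then v (galois z h) else 0)"
    have "v' x = v x" using galois_emb[OF z, of "[:0, 1:]"] by (simp add: v'_def K_emb)
    moreover have "place v'" unfolding v'_def by (rule place_galois[OF v z])
    then have "order_ge v' (if v' x < 0 then - s else 0) (rat_eval y r)"
      using h unfolding Lspace_iff by blast
    ultimately have "order_ge v' b (rat_eval y r)" by (simp add: b_def)
    then show ?thesis using hK galois_eq_0_iff[OF z hK] galois_K[OF z hK]
      by (auto simp: order_ge_def v'_def)
  qed
  have "order_ge v b (cst (inverse z ^ m) * galois z (rat_eval y r))" if "z ^ n = 1" for z
    using order_ge_mult[OF v order_ge_cst[OF v] gal[OF that]] by simp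
  then have "order_ge v b (cst (of_nat n) * (to_ac (coeff r m) * y ^ m))"
    unfolding galois_average[OF r m, symmetric] by (intro order_ge_sum[OF v]) auto
  from order_ge_mult[OF v order_ge_cst[OF v] this, of "inverse (of_nat n)"]
  show "order_ge v (if v x < 0 then - s else 0) (to_ac (coeff r m) * y ^ m)"
    using of_nat_n_neq_0 by (simp add: b_def cst_inverse mult.assoc[symmetric])
qed

text \<open>
  If \<open>r\<close> had a pole at \<open>P\<close>, then at a place over \<open>P\<close> the order of \<open>r\<close> would be at most \<open>- v(P)\<close>, whereas
  \<open>n v(y) = v(f) \<le> v(P)\<close> because \<open>f\<close> is squarefree; \<open>m < n\<close> factors \<open>y\<close> cannot compensate.  So \<open>r\<close> is
  a polynomial, and its degree is bounded by the order at infinity.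
\<close>

lemma Lspace_monomial:
  assumes h: "to_ac r * y ^ m \<in> Lspace s" and m: "m < n"
  shows "\<exists>p. r = to_fract p \<and> (p \<noteq> 0 \<longrightarrow> int n * int (degree p) + int d * int m \<le> int c * s)"
proof -
  obtain a b u w where ab: "r = to_fract a / to_fract b" "b \<noteq> 0" "u * a + w * b = 1"
    using poly_fract_coprime_rep by blast
  have deg: "degree b = 0"
  proof (rule ccontr)
    assume "degree b \<noteq> 0"
    then obtain P where P: "irreducible P" "P dvd b" using irreducible_factor_exists by blast
    obtain v where v: "place v" "v (emb P) > 0" "\<And>p. v (emb p) \<ge> 0" "\<And>p. \<not> P dvd p \<Longrightarrow> v (emb p) = 0"
      using place_over_irreducible[OF P(1)] by blast
    have na: "\<not> P dvd a"
    proof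
      assume "P dvd a"
      then have "P dvd 1" using P(2) ab(3) by (metis dvd_add dvd_mult)
      then show False using P by (simp add: irreducible_def)
    qed
    then have a0: "a \<noteq> 0" by auto
    obtain b' where b': "b = P * b'" using P(2) by (rule dvdE)
    have "P \<noteq> 0" "b' \<noteq> 0" using b' ab by auto
    then have vb: "v (emb b) \<ge> v (emb P)"
      using place_mult[OF v(1) K_emb K_emb, of P b'] v(3)[of b'] by (simp add: b')
    have vf: "v (emb f) \<le> v (emb P)"
    proof (cases "P dvd f")
      case True
      obtain f1 where f1: "f = P * f1" "\<not> P dvd f1" using irreducible_factor_f[OF P(1) True] .
      then have "f1 \<noteq> 0" by auto
      then show ?thesis
        using place_mult[OF v(1) K_emb K_emb, of P f1] v(4)[OF f1(2)] \<open>P \<noteq> 0\<close> by (simp add: f1(1))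
    next
      case False
      then show ?thesis using v by simp
    qed
    have r: "to_ac r = emb a / emb b" by (simp add: ab emb_def)
    have r0: "to_ac r \<noteq> 0" using a0 ab by (simp add: r)
    have "v (to_ac r) = v (emb a) - v (emb b)"
      unfolding r by (rule place_divide[OF v(1)]) (use a0 ab in \<open>auto simp: K_emb\<close>)
    then have vr: "v (to_ac r) \<le> - v (emb P)" using v(4)[OF na] vb by simp
    have "v x \<ge> 0" using v(3) .
    then have "v (to_ac r * y ^ m) \<ge> 0"
      using h v(1) r0 y_neq_0 unfolding Lspace_iff by (auto simp: order_ge_def)
    then have "v (to_ac r) + int m * v y \<ge> 0"
      using place_mult[OF v(1) K_to_ac K_power[OF K_y] r0, of m] place_power[OF v(1) K_y y_neq_0, of m] y_neq_0
      by simp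
    then have "0 \<le> int n * (v (to_ac r) + int m * v y)" by simp
    also have "\<dots> = int n * v (to_ac r) + int m * v (emb f)"
      using place_y[OF v(1)] by (simp add: algebra_simps)
    also have "\<dots> \<le> int n * - v (emb P) + int m * v (emb P)"
      using vr vf by (intro add_mono mult_left_mono) auto
    also have "\<dots> = (int m - int n) * v (emb P)" by (simp add: algebra_simps)
    also have "\<dots> < 0" using m v(2) by (simp add: mult_neg_pos)
    finally show False by simp
  qed
  then obtain b0 where b0: "b = [:b0:]" by (rule degree_eq_zeroE)
  define p where "p = smult (inverse b0) a"
  have bp: "b * p = a" using ab(2) by (simp add: p_def b0)
  have rp: "r = to_fract p" using ab(2) by (simp add: ab(1) bp[symmetric])
  have "int n * int (degree p) + int d * int m \<le> int c * s" if p: "p \<noteq> 0"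
  proof -
    obtain v where v: "place v" "v x < 0" using place_over_infinity by blast
    have "emb p * y ^ m \<in> Lspace s" using h by (simp add: rp emb_def)
    then have "v (emb p * y ^ m) \<ge> - s"
      using v p y_neq_0 unfolding Lspace_iff by (auto simp: order_ge_def)
    then have "int c * - s \<le> int c * v (emb p * y ^ m)" by (intro mult_left_mono) auto
    then show ?thesis using place_monomial_infinite[OF v p, of m] by simp
  qed
  then show ?thesis using rp by blast
qed

theorem Lspace_eq: "Lspace s = function_of ` {P. bounded s P}"
proof
  show "function_of ` {P. bounded s P} \<subseteq> Lspace s" using bounded_in_Lspace by blast
  show "Lspace s \<subseteq> function_of ` {P. bounded s P}"
  proof
    fix h assume h: "h \<in> Lspace s"
    then have "h \<in> K" by (simp add: Lspace_iff)
    then obtain r where r: "degree r < n" "h = rat_eval y r" using K_rep by blast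
    have "\<forall>m\<in>{..<n}. \<exists>p. coeff r m = to_fract p \<and>
        (p \<noteq> 0 \<longrightarrow> int n * int (degree p) + int d * int m \<le> int c * s)"
      using Lspace_monomial Lspace_component[OF _ r(1)] h r(2) by (meson lessThan_iff)
    then obtain p where p: "\<And>m. m < n \<Longrightarrow> coeff r m = to_fract (p m)"
      "\<And>m. m < n \<Longrightarrow> p m \<noteq> 0 \<Longrightarrow> int n * int (degree (p m)) + int d * int m \<le> int c * s"
      by (metis lessThan_iff)
    define P where "P = (\<lambda>j. if j < n then p j else 0)"
    have "h = function_of P"
      unfolding r(2) rat_eval_altdef'[OF r(1)] function_of_def P_def
      by (intro sum.cong refl) (simp add: p(1) emb_def)
    moreover have "bounded s P"
      unfolding bounded_def
    proof (intro allI impI)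
      fix i j assume "coeff (P j) i \<noteq> 0"
      then have j: "j < n" "p j \<noteq> 0" "i \<le> degree (p j)"
        by (auto simp: P_def le_degree split: if_splits)
      have "int n * int i \<le> int n * int (degree (p j))" using j(3) by (intro mult_left_mono) auto
      then have "int n * int i + int d * int j \<le> int c * s" using p(2)[OF j(1,2)] by linarith
      then show "j < n \<and> int n * int i + int d * int j \<le> int c * s" using j(1) by blast
    qed
    ultimately show "h \<in> function_of ` {P. bounded s P}" by blast
  qed
qed

subsection \<open>The divisor of the function \<open>e\<^sub>\<Delta>\<close>\<close>

abbreviation \<Delta> :: "'a set" where "\<Delta> \<equiv> Delta n f"

definition e_poly :: "'a poly" where "e_poly = (\<Prod>a\<in>\<Delta>. [:- a, 1:])"

lemma e_Delta_eq: "e_Delta n f = emb e_poly"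
  by (simp add: e_Delta_def e_poly_def)

lemma e_poly_neq_0: "e_poly \<noteq> 0"
  by (simp add: e_poly_def)

lemma degree_e_poly: "degree e_poly = delta n f"
  by (simp add: e_poly_def delta_def degree_prod_eq_sum_degree)

lemma poly_e_poly_eq_0: "poly e_poly a = 0 \<longleftrightarrow> a \<in> \<Delta>"
  by (auto simp: e_poly_def poly_prod)

lemma emb_linear: "emb [:- a, 1:] = x - cst a"
  by (simp flip: emb_simps)

lemma place_e_poly:
  assumes v: "place v" shows "v (emb e_poly) = (\<Sum>a\<in>\<Delta>. v (x - cst a))"
proof -
  have "v (\<Prod>a\<in>S. x - cst a) = (\<Sum>a\<in>S. v (x - cst a)) \<and> (\<Prod>a\<in>S. x - cst a) \<in> K \<and> (\<Prod>a\<in>S. x - cst a) \<noteq> 0"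
    if "finite S" for S
    using that
  proof (induction S)
    case empty
    then show ?case by (simp add: place_1[OF v] K_1)
  next
    case (insert a S)
    then show ?case
      using place_mult[OF v K_emb, of "\<Prod>a\<in>S. x - cst a" "[:- a, 1:]"]
      by (simp add: emb_linear K_closed x_minus_cst_neq_0)
  qed
  then show ?thesis by (simp add: e_poly_def emb_prod emb_linear)
qed

lemma place_linear_distinct:
  assumes v: "place v" and a: "v (x - cst a) > 0" and b: "b \<noteq> a"
  shows "v (x - cst b) = 0"
proof -
  have eq: "x - cst b = cst (a - b) + (x - cst a)" by (simp add: cst_simps del: emb_simps)
  have "v (cst (a - b)) < v (x - cst a)" using place_cst[OF v, of "a - b"] a by simp
  then have "v (cst (a - b) + (x - cst a)) = v (cst (a - b))"
    using place_add_less[OF v K_emb, of "x - cst a" "[:a - b:]"] b x_minus_cst_neq_0[of a]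
    by (simp add: K_closed)
  then show ?thesis unfolding eq using place_cst[OF v] by simp
qed

text \<open>
  At a place over \<open>a \<notin> \<Delta>\<close> the local parameter \<open>x - a\<close> has order \<open>1\<close> and the place is rational, so the
  pullback of \<open>a\<close> and \<open>D\<close> cancel there; what remains is the pullback of \<open>\<Delta>\<close>.
\<close>

lemma div_E_eq:
  assumes v: "place v"
  shows "div_E n f v = (if v x < 0 then 0 else v (emb e_poly))"
proof (cases "v x < 0")
  case True
  have "v (x - cst a) < 0" for a
    using place_emb_infinite[OF v True, of "[:- a, 1:]"] True by (simp add: emb_linear)
  then have "pullback_point n f a v = 0" for a by (simp add: pullback_point_def max_def less_le_not_le)
  moreover have "div_D n f v = 0" using True by (simp add: div_D_def affine_points_def)
  ultimately show ?thesis using True by (simp add: div_E_def)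
next
  case False
  then have fin: "v x \<ge> 0" by simp
  have nonneg: "v (x - cst a) \<ge> 0" for a
    using finite_place_y(2)[OF v fin, of "[:- a, 1:]"] by (simp add: emb_linear order_ge_def x_minus_cst_neq_0)
  have pull: "pullback_point n f a v = v (x - cst a)" for a
    using v nonneg[of a] by (simp add: pullback_point_def)
  have sum: "(\<Sum>a\<in>UNIV. v (x - cst a)) = v (emb e_poly) + (\<Sum>a\<in>UNIV - \<Delta>. v (x - cst a))"
    unfolding place_e_poly[OF v] by (subst sum.subset_diff[of \<Delta>]) auto
  have "(\<Sum>a\<in>UNIV - \<Delta>. v (x - cst a)) = div_D n f v"
  proof (cases "v \<in> affine_points n f")
    case True
    then obtain a b where pt: "point v a b" using affine_points_eq by blast
    have pos: "v (x - cst a) > 0" using point_x[OF pt] by simp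
    have "a \<notin> \<Delta>" using point_on_curve[OF pt] Delta_iff by blast
    then have "(\<Sum>a\<in>UNIV - \<Delta>. v (x - cst a)) = v (x - cst a) + (\<Sum>a\<in>UNIV - \<Delta> - {a}. v (x - cst a))"
      by (subst sum.remove[of _ a]) auto
    also have "(\<Sum>a\<in>UNIV - \<Delta> - {a}. v (x - cst a)) = 0"
      using place_linear_distinct[OF v pos] by (intro sum.neutral) auto
    finally show ?thesis using True place_over_finite_unramified[OF v pos] by (simp add: div_D_def)
  next
    case notin: False
    have "v (x - cst a) = 0" if "a \<notin> \<Delta>" for a
    proof (rule ccontr)
      assume "v (x - cst a) \<noteq> 0"
      then have "v (x - cst a) > 0" using nonneg[of a] by simp
      moreover obtain b where "b ^ n = poly f a" using \<open>a \<notin> \<Delta>\<close> Delta_iff by blast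
      ultimately show False using place_over_split_point[OF v] notin affine_points_eq by blast
    qed
    then show ?thesis using notin by (simp add: div_D_def)
  qed
  then show ?thesis using False by (simp add: div_E_def pull sum)
qed

lemma delta_le: "delta n f \<le> CARD('a)"
  by (simp add: delta_def card_mono)

lemma nu_eq: "nu n f s = mu n f s - int (n div c) * int (delta n f)"
proof -
  note e = int_n_eq
  have "int n * int (delta n f) = int (n div c) * int (delta n f) * int c"
    by (metis e mult.assoc mult.commute)
  moreover have "int (n div c) * int (delta n f) * int c div int c = int (n div c) * int (delta n f)"
    using c_pos by (intro nonzero_mult_div_cancel_right) simp
  ultimately show ?thesis by (simp only: nu_def ninf_eq)
qed

text \<open>
  Over the affine line \<open>E\<close> is the divisor of \<open>e\<^sub>\<Delta>\<close>; at infinity \<open>e\<^sub>\<Delta>\<close> has order \<open>- \<delta>n/c = \<nu> - \<mu>\<close>.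
\<close>

theorem riemann_roch_minus_E:
  "riemann_roch_space n f (\<lambda>v. mu n f s * div_inf n f v - div_E n f v)
    = (\<lambda>h. emb e_poly * h) ` Lspace (nu n f s)"
proof -
  define R where "R = riemann_roch_space n f (\<lambda>v. mu n f s * div_inf n f v - div_E n f v)"
  have e0: "emb e_poly \<noteq> 0" using e_poly_neq_0 by simp
  have val: "v (emb e_poly * h) + (mu n f s * div_inf n f v - div_E n f v) = v h + nu n f s * div_inf n f v"
    if v: "place v" and h: "h \<in> K" "h \<noteq> 0" for v h
  proof -
    have "v (emb e_poly * h) = v (emb e_poly) + v h" using place_mult[OF v K_emb h(1) e0 h(2)] .
    moreover have "v (emb e_poly) = - (int (n div c) * int (delta n f))" if neg: "v x < 0"
      using place_emb_infinite[OF v neg e_poly_neq_0] place_at_infinity[OF v neg] degree_e_poly by simp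
    ultimately show ?thesis using v by (simp add: div_E_eq[OF v] div_inf_def nu_eq)
  qed
  have iff: "emb e_poly * h \<in> R \<longleftrightarrow> h \<in> Lspace (nu n f s)" if h: "h \<in> K" for h
    using h val e0 by (auto simp: R_def riemann_roch_space_def K_mult K_emb)
  have "R = (\<lambda>h. emb e_poly * h) ` Lspace (nu n f s)"
  proof (intro equalityI subsetI)
    fix g assume g: "g \<in> R"
    then have "g \<in> K" by (simp add: R_def riemann_roch_space_def)
    define h where "h = inverse (emb e_poly) * g"
    have hK: "h \<in> K" unfolding h_def using \<open>g \<in> K\<close> by (intro K_mult K_inverse K_emb)
    have eq: "g = emb e_poly * h" using e0 by (simp add: h_def mult.assoc[symmetric])
    then have "h \<in> Lspace (nu n f s)" using g iff[OF hK] by simp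
    then show "g \<in> (\<lambda>h. emb e_poly * h) ` Lspace (nu n f s)" using eq by blast
  next
    fix g assume "g \<in> (\<lambda>h. emb e_poly * h) ` Lspace (nu n f s)"
    then show "g \<in> R" using iff by (auto simp: riemann_roch_space_def)
  qed
  then show ?thesis by (simp add: R_def)
qed

section \<open>Words\<close>

definition point_pairs :: "('a \<times> 'a) set" where
  "point_pairs = {(a, b). b ^ n = poly f a}"

definition place_of :: "'a \<times> 'a \<Rightarrow> 'a place" where
  "place_of = (\<lambda>(a, b). THE v. point v a b)"

definition eval_family :: "(nat \<Rightarrow> 'a poly) \<Rightarrow> 'a \<times> 'a \<Rightarrow> 'a" where
  "eval_family P = (\<lambda>(a, b). \<Sum>j<n. poly (P j) a * b ^ j)"

lemma point_place_of: "b ^ n = poly f a \<Longrightarrow> point (place_of (a, b)) a b"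
proof -
  assume "b ^ n = poly f a"
  then obtain v where v: "point v a b" using point_exists by blast
  then have "place_of (a, b) = v" using point_unique by (auto simp: place_of_def)
  then show ?thesis using v by simp
qed

lemma value_at_function_of:
  assumes pt: "point v a b" shows "value_at v (function_of P) = eval_family P (a, b)"
proof (rule value_at_eq)
  show v: "place v" using pt by (simp add: point_def)
  have e: "order_ge v 1 (emb p - cst (poly p a))" for p
  proof -
    obtain s where "emb p = cst (poly p a) + (x - cst a) * emb s" using emb_expand by blast
    then have "emb p - cst (poly p a) = (x - cst a) * emb s" by simp
    moreover have "order_ge v (1 + 0) ((x - cst a) * emb s)"
      using pt point_coordinate_ring[OF pt emb_coordinate_ring]
      by (intro order_ge_mult[OF v]) (simp_all add: point_def)
    ultimately show ?thesis by simp
  qed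
  have yj: "order_ge v 1 (y ^ j - cst (b ^ j))" for j
  proof -
    have "order_ge v (1 + 0) ((y - cst b) * (\<Sum>i<j. cst (b ^ (j - Suc i)) * y ^ i))"
    proof (intro order_ge_mult[OF v] order_ge_sum[OF v])
      show "order_ge v 1 (y - cst b)" using pt by (simp add: point_def)
      show "order_ge v 0 (cst (b ^ (j - Suc i)) * y ^ i)" for i
        using order_ge_mult[OF v order_ge_cst[OF v, of "b ^ (j - Suc i)"] order_ge_power[OF v point_y[OF pt], of i]]
        by simp
    qed
    then show ?thesis by (simp add: power_diff_sumr2 cst_power)
  qed
  have "order_ge v 1 (emb (P j) * y ^ j - cst (poly (P j) a * b ^ j))" for j
  proof -
    have "emb (P j) * y ^ j - cst (poly (P j) a * b ^ j)
        = (emb (P j) - cst (poly (P j) a)) * y ^ j + cst (poly (P j) a) * (y ^ j - cst (b ^ j))"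
      unfolding cst_simps by (simp add: algebra_simps)
    moreover have "order_ge v 1 ((emb (P j) - cst (poly (P j) a)) * y ^ j)"
      using order_ge_mult[OF v e[of "P j"] order_ge_power[OF v point_y[OF pt], of j]] by simp
    moreover have "order_ge v 1 (cst (poly (P j) a) * (y ^ j - cst (b ^ j)))"
      using order_ge_mult[OF v order_ge_cst[OF v] yj[of j]] by simp
    ultimately show ?thesis using order_ge_add[OF v] by simp
  qed
  then have "order_ge v 1 (\<Sum>j<n. emb (P j) * y ^ j - cst (poly (P j) a * b ^ j))"
    by (rule order_ge_sum[OF v])
  then show "order_ge v 1 (function_of P - cst (eval_family P (a, b)))"
    by (simp add: function_of_def eval_family_def sum_subtractf cst_sum)
qed

lemma point_coords_unique:
  assumes "point v a b" "point v a' b'" shows "a = a'" "b = b'"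
proof -
  have v: "place v" using assms by (simp add: point_def)
  have "order_ge v 1 ((x - cst a') - (x - cst a))" "order_ge v 1 ((y - cst b') - (y - cst b))"
    using assms order_ge_diff[OF v, of 1 "x - cst a'" "x - cst a"]
      order_ge_diff[OF v, of 1 "y - cst b'" "y - cst b"] by (simp_all only: point_def)
  moreover have "(x - cst a') - (x - cst a) = cst (a - a')" "(y - cst b') - (y - cst b) = cst (b - b')"
    unfolding cst_simps by simp_all
  ultimately show "a = a'" "b = b'" using cst_not_order_ge_1[OF v] by fastforce+
qed

lemma bij_place_of: "bij_betw place_of point_pairs (affine_points n f)"
  unfolding bij_betw_def
proof
  show "inj_on place_of point_pairs"
    using point_place_of point_coords_unique by (auto simp: inj_on_def point_pairs_def) metis+
  show "place_of ` point_pairs = affine_points n f"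
  proof
    show "place_of ` point_pairs \<subseteq> affine_points n f"
      using point_place_of affine_points_eq by (fastforce simp: point_pairs_def)
    show "affine_points n f \<subseteq> place_of ` point_pairs"
    proof
      fix v assume "v \<in> affine_points n f"
      then obtain a b where pt: "point v a b" using affine_points_eq by blast
      then have ab: "b ^ n = poly f a" by (rule point_on_curve)
      then have "place_of (a, b) = v" using point_unique point_place_of pt by blast
      then show "v \<in> place_of ` point_pairs" using ab by (force simp: point_pairs_def)
    qed
  qed
qed

lemma affine_pointE:
  assumes "v \<in> affine_points n f"
  obtains a b where "(a, b) \<in> point_pairs" "v = place_of (a, b)"
proof -
  have "v \<in> place_of ` point_pairs" using assms bij_betw_imp_surj_on[OF bij_place_of] by simp
  then show ?thesis using that by auto
qed

lemma card_fiber: "a \<notin> \<Delta> \<Longrightarrow> card {b. b ^ n = poly f a} = n"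
proof -
  assume "a \<notin> \<Delta>"
  then obtain b where b: "b ^ n = poly f a" using Delta_iff by blast
  then have "b \<noteq> 0" using f_no_root[of a] n_ge_2 by (auto simp: power_0_left)
  then show ?thesis using card_nth_roots[OF n_dvd] n_ge_2 b by (metis pos2 order_less_le_trans)
qed

lemma point_pairs_Sigma: "point_pairs = (SIGMA a : UNIV - \<Delta>. {b. b ^ n = poly f a})"
  using Delta_iff by (auto simp: point_pairs_def)

lemma num_points_eq: "num_points n f = n * (CARD('a) - delta n f)"
proof -
  have "num_points n f = card point_pairs"
    using bij_betw_same_card[OF bij_place_of] by (simp add: num_points_def)
  also have "\<dots> = (\<Sum>a\<in>UNIV - \<Delta>. n)" unfolding point_pairs_Sigma
    by (subst card_SigmaI) (auto intro!: sum.cong simp: card_fiber)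
  also have "\<dots> = n * (CARD('a) - delta n f)" by (simp add: delta_def card_Diff_subset)
  finally show ?thesis .
qed

definition word :: "(nat \<Rightarrow> 'a poly) \<Rightarrow> 'a word" where
  "word P v = (if v \<in> affine_points n f then value_at v (function_of P) else 0)"

lemma word_place_of: "p \<in> point_pairs \<Longrightarrow> word P (place_of p) = eval_family P p"
  using value_at_function_of[OF point_place_of] bij_betwE[OF bij_place_of]
  by (auto simp: word_def point_pairs_def)

lemma word_outside: "v \<notin> affine_points n f \<Longrightarrow> word P v = 0"
  by (simp add: word_def)

lemma word_eqI:
  assumes "\<And>v. v \<notin> affine_points n f \<Longrightarrow> w v = 0" "\<And>p. p \<in> point_pairs \<Longrightarrow> w (place_of p) = eval_family P p"
  shows "w = word P"
proof
  fix v show "w v = word P v"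
  proof (cases "v \<in> affine_points n f")
    case True
    then obtain a b where "(a, b) \<in> point_pairs" "v = place_of (a, b)" by (rule affine_pointE)
    then show ?thesis using assms(2) word_place_of by simp
  qed (use assms word_outside in simp)
qed

lemma code_eq: "C_L n f (\<lambda>v. s * div_inf n f v) = word ` {P. bounded s P}"
  unfolding C_L_def Lspace_eq word_def[abs_def] by (simp add: image_image)

lemma function_of_e_poly: "emb e_poly * function_of P = function_of (\<lambda>j. e_poly * P j)"
  for P :: "nat \<Rightarrow> 'a poly"
  by (simp add: function_of_def sum_distrib_left mult.assoc)

lemma code_minus_E_eq:
  "C_L n f (\<lambda>v. mu n f s * div_inf n f v - div_E n f v)
    = (\<lambda>P. word (\<lambda>j. e_poly * P j)) ` {P. bounded (nu n f s) P}"
  unfolding C_L_def riemann_roch_minus_E Lspace_eq word_def[abs_def]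
  by (simp add: image_image function_of_e_poly)

lemma eval_family_e_poly:
  "eval_family (\<lambda>j. e_poly * P j) (a, b) = poly e_poly a * eval_family P (a, b)"
  by (simp add: eval_family_def sum_distrib_left mult.assoc)

lemma value_at_e_Delta:
  assumes "(a, b) \<in> point_pairs"
  shows "value_at (place_of (a, b)) (e_Delta n f) = poly e_poly a"
proof -
  define P where "P = (\<lambda>j::nat. if j = 0 then e_poly else (0 :: 'a poly))"
  have "function_of P = (\<Sum>j<n. if j = 0 then emb e_poly else 0)"
    unfolding function_of_def P_def by (intro sum.cong) auto
  also have "\<dots> = emb e_poly" using n_ge_2 by simp
  finally have "function_of P = e_Delta n f" by (simp add: e_Delta_eq)
  moreover have "eval_family P (a, b) = (\<Sum>j<n. if j = 0 then poly e_poly a else 0)"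
    unfolding eval_family_def P_def prod.case by (intro sum.cong) auto
  then have "eval_family P (a, b) = poly e_poly a" using n_ge_2 by simp
  ultimately show ?thesis
    using value_at_function_of[OF point_place_of, of b a P] assms by (simp add: point_pairs_def)
qed

lemma value_at_e_Delta_neq_0:
  assumes "v \<in> affine_points n f" shows "value_at v (e_Delta n f) \<noteq> 0"
proof -
  obtain a b where ab: "(a, b) \<in> point_pairs" "v = place_of (a, b)"
    using assms by (rule affine_pointE)
  then have "a \<notin> \<Delta>" using Delta_iff by (auto simp: point_pairs_def)
  then show ?thesis using value_at_e_Delta ab poly_e_poly_eq_0 by simp
qed

lemma word_e_poly: "word (\<lambda>j. e_poly * P j) = (\<lambda>v. value_at v (e_Delta n f) * word P v)"
proof (rule word_eqI[symmetric])
  show "value_at v (e_Delta n f) * word P v = 0" if "v \<notin> affine_points n f" for v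
    using that by (simp add: word_outside)
  show "value_at (place_of p) (e_Delta n f) * word P (place_of p) = eval_family (\<lambda>j. e_poly * P j) p"
    if "p \<in> point_pairs" for p
    using that by (cases p) (simp add: value_at_e_Delta word_place_of eval_family_e_poly)
qed

theorem monomial_equivalence:
  "bij_betw (\<lambda>w v. value_at v (e_Delta n f) * w v)
     (C_L n f (\<lambda>v. nu n f s * div_inf n f v))
     (C_L n f (\<lambda>v. mu n f s * div_inf n f v - div_E n f v))"
  unfolding bij_betw_def
proof
  show "inj_on (\<lambda>w v. value_at v (e_Delta n f) * w v) (C_L n f (\<lambda>v. nu n f s * div_inf n f v))"
  proof (rule inj_onI)
    fix w w' assume ww': "w \<in> C_L n f (\<lambda>v. nu n f s * div_inf n f v)" "w' \<in> C_L n f (\<lambda>v. nu n f s * div_inf n f v)"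
      and eq: "(\<lambda>v. value_at v (e_Delta n f) * w v) = (\<lambda>v. value_at v (e_Delta n f) * w' v)"
    show "w = w'"
    proof
      fix v
      show "w v = w' v"
      proof (cases "v \<in> affine_points n f")
        case True
        then show ?thesis using fun_cong[OF eq, of v] value_at_e_Delta_neq_0[OF True] by simp
      next
        case False
        then show ?thesis using ww' by (auto simp: C_L_def)
      qed
    qed
  qed
  show "(\<lambda>w v. value_at v (e_Delta n f) * w v) ` C_L n f (\<lambda>v. nu n f s * div_inf n f v)
      = C_L n f (\<lambda>v. mu n f s * div_inf n f v - div_E n f v)"
    unfolding code_eq code_minus_E_eq by (simp add: image_image word_e_poly)
qed

end

section \<open>Duality for polynomial evaluation on subsets of a finite field\<close>

text \<open>
  For \<open>i = 0\<close> the sum is \<open>q = 0\<close>.  For \<open>i > 0\<close>, multiplication by some nonzero \<open>g\<close> with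
  \<open>g\<^sup>i \<noteq> 1\<close> permutes the field and multiplies the sum by \<open>g\<^sup>i\<close>; such a \<open>g\<close> exists because \<open>X\<^sup>i - 1\<close> has
  fewer than \<open>q - 1\<close> roots.
\<close>

lemma sum_power_eq_0:
  assumes i: "i < CARD('a::{field, finite}) - 1"
  shows "(\<Sum>a\<in>UNIV. (a::'a) ^ i) = 0"
proof (cases "i = 0")
  case True
  then show ?thesis by (simp add: of_nat_card_eq_0)
next
  case False
  have "\<exists>g::'a. g \<noteq> 0 \<and> g ^ i \<noteq> 1"
  proof (rule ccontr)
    assume n: "\<not> ?thesis"
    define p where "p = monom (1::'a) i - 1"
    have "coeff p i = 1" using False by (simp add: p_def)
    then have p0: "p \<noteq> 0" by auto
    have "UNIV - {0} \<subseteq> {z. poly p z = 0}" using n by (auto simp: p_def poly_monom)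
    then have "card (UNIV - {0::'a}) \<le> card {z. poly p z = 0}" by (intro card_mono poly_roots_finite p0)
    also have "\<dots> \<le> degree p" by (rule card_poly_roots_bound[OF p0])
    also have "\<dots> \<le> i" unfolding p_def by (intro degree_diff_le) (auto simp: degree_monom_le)
    finally show False using i by (simp add: card_Diff_singleton)
  qed
  then obtain g :: 'a where g: "g \<noteq> 0" "g ^ i \<noteq> 1" by blast
  have "(\<Sum>a\<in>UNIV. a ^ i) = (\<Sum>a\<in>UNIV. (g * a) ^ i)"
    by (rule sum.reindex_bij_witness[of _ "\<lambda>a. g * a" "\<lambda>a. a / g"]) (use g in auto)
  also have "\<dots> = g ^ i * (\<Sum>a\<in>UNIV. a ^ i)" by (simp add: power_mult_distrib sum_distrib_left)
  finally have "(g ^ i - 1) * (\<Sum>a\<in>UNIV. a ^ i) = 0" by (simp add: algebra_simps)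
  then show ?thesis using g by simp
qed

lemma sum_power_card_minus_1: "(\<Sum>a\<in>UNIV. (a::'a::{field, finite}) ^ (CARD('a) - 1)) = -1"
proof -
  have q: "CARD('a) \<ge> 2" by (rule two_le_card_field)
  have "(\<Sum>a\<in>UNIV. (a::'a) ^ (CARD('a) - 1)) = (\<Sum>a\<in>UNIV - {0::'a}. a ^ (CARD('a) - 1))"
    using q by (subst sum.remove[of _ 0]) (auto simp: power_0_left)
  also have "\<dots> = (\<Sum>a\<in>UNIV - {0::'a}. 1)" by (intro sum.cong refl) (simp add: finite_field_fermat del: One_nat_def)
  also have "\<dots> = of_nat (CARD('a) - 1)" by (simp add: card_Diff_singleton)
  also have "\<dots> = -1" using q by (simp add: of_nat_diff of_nat_card_eq_0)
  finally show ?thesis .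
qed

lemma sum_poly_eq:
  fixes p :: "'a::{field, finite} poly"
  assumes "degree p \<le> CARD('a) - 1"
  shows "(\<Sum>a\<in>UNIV. poly p a) = - coeff p (CARD('a) - 1)"
proof -
  let ?m = "CARD('a) - 1"
  have poly: "poly p a = (\<Sum>i\<le>?m. coeff p i * a ^ i)" for a
    unfolding poly_altdef using assms by (intro sum.mono_neutral_left) (auto simp: not_le coeff_eq_0)
  have "(\<Sum>a\<in>UNIV. poly p a) = (\<Sum>i\<le>?m. coeff p i * (\<Sum>a\<in>UNIV. a ^ i))"
    unfolding poly by (subst sum.swap) (simp add: sum_distrib_left)
  also have "\<dots> = (\<Sum>i\<le>?m. if i = ?m then - coeff p ?m else 0)"
    by (intro sum.cong refl) (simp add: sum_power_eq_0 sum_power_card_minus_1 del: One_nat_def)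
  also have "\<dots> = - coeff p ?m" by simp
  finally show ?thesis .
qed

lemma interpolation:
  fixes A :: "'a::field set"
  assumes "finite A"
  shows "\<exists>r. (r = 0 \<or> degree r < card A) \<and> (\<forall>a\<in>A. poly r a = g a)"
  using assms
proof (induction A)
  case (insert a A)
  then obtain r where r: "r = 0 \<or> degree r < card A" "\<And>b. b \<in> A \<Longrightarrow> poly r b = g b" by blast
  define p where "p = (\<Prod>b\<in>A. [:- b, 1:])"
  define k where "k = (g a - poly r a) / poly p a"
  have pa: "poly p a \<noteq> 0" using insert by (auto simp: p_def poly_prod)
  have dp: "degree p = card A" by (simp add: p_def degree_prod_eq_sum_degree)
  have "degree (r + smult k p) \<le> card A"
    using r dp by (intro degree_add_le) (auto intro: order.trans[OF degree_smult_le])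
  then have "degree (r + smult k p) < card (insert a A)" using insert.hyps by simp
  moreover have "poly (r + smult k p) b = g b" if "b \<in> insert a A" for b
  proof (cases "b = a")
    case True
    then show ?thesis using pa by (simp add: k_def)
  next
    case False
    then have "b \<in> A" using that by simp
    then have "poly p b = 0" using insert.hyps by (auto simp: p_def poly_prod)
    then show ?thesis using r \<open>b \<in> A\<close> by simp
  qed
  ultimately show ?case by blast
qed auto

text \<open>A degree bound that may be negative, in which case the polynomial vanishes.\<close>

definition deg_le :: "'b::zero poly \<Rightarrow> int \<Rightarrow> bool" where
  "deg_le p k \<longleftrightarrow> p = 0 \<or> int (degree p) \<le> k"

lemma deg_le_iff: "deg_le p k \<longleftrightarrow> (\<forall>i. coeff p i \<noteq> 0 \<longrightarrow> int i \<le> k)"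
proof (cases "p = 0")
  case False
  then have "coeff p (degree p) \<noteq> 0" by simp
  then show ?thesis unfolding deg_le_def using False
    by (auto dest: le_degree intro: order.trans[rotated])
qed (simp add: deg_le_def)

lemma deg_le_mult: "deg_le p k \<Longrightarrow> deg_le r l \<Longrightarrow> deg_le (p * r) (k + l)"
  for p r :: "'b::field poly"
  by (cases "p = 0 \<or> r = 0") (auto simp: deg_le_def degree_mult_eq)

lemma deg_le_diff: "deg_le p k \<Longrightarrow> deg_le r k \<Longrightarrow> deg_le (p - r) k"
  for p r :: "'b::field poly"
  unfolding deg_le_iff by (metis coeff_diff diff_0_right)

lemma deg_le_mono: "deg_le p k \<Longrightarrow> k \<le> l \<Longrightarrow> deg_le p l"
  by (auto simp: deg_le_def)

lemma deg_le_degree: "deg_le p (int (degree p))"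
  by (simp add: deg_le_def)

text \<open>
  Stated for a product of linear factors, where coprimality is just the absence of common roots and the
  coefficients can be built one factor at a time.
\<close>

lemma linear_factors_bezout:
  fixes F :: "'b::field poly"
  assumes "finite S" "\<And>a. a \<in> S \<Longrightarrow> poly F a \<noteq> 0"
  shows "\<exists>u w. u * F + w * (\<Prod>a\<in>S. [:- a, 1:]) = 1"
  using assms
proof (induction S)
  case empty
  then show ?case by (intro exI[of _ 0] exI[of _ 1]) simp
next
  case (insert a S)
  then obtain u w where uw: "u * F + w * (\<Prod>a\<in>S. [:- a, 1:]) = 1" by auto
  have Fa: "poly F a \<noteq> 0" using insert.prems by simp
  define G where "G = synthetic_div F a"
  have F: "F = [:poly F a:] + [:- a, 1:] * G"
    using synthetic_div_correct'[of a F] by (simp add: G_def add.commute)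
  define k where "k = [:inverse (poly F a):]"
  have "k * [:poly F a:] = 1" using Fa by (simp add: k_def one_pCons)
  then have 1: "k * F - k * [:- a, 1:] * G = 1"
    by (subst F) (simp add: algebra_simps del: mult_pCons_left mult_pCons_right)
  have "(u + w * (\<Prod>a\<in>S. [:- a, 1:]) * k) * F + (- w * k * G) * ([:- a, 1:] * (\<Prod>a\<in>S. [:- a, 1:]))
      = u * F + w * (\<Prod>a\<in>S. [:- a, 1:]) * (k * F - k * [:- a, 1:] * G)"
    by (simp add: algebra_simps del: mult_pCons_left mult_pCons_right)
  also have "\<dots> = 1" using 1 uw by simp
  finally show ?case unfolding prod.insert[OF insert.hyps] by blast
qed

text \<open>
  Start from any Bezout representation of \<open>p\<close> and reduce the coefficient of \<open>e\<close> modulo \<open>F\<close>; the bounds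
  on \<open>k\<close> and \<open>m\<close> leave room for the remainder.
\<close>

lemma bounded_bezout:
  fixes F e :: "'b::field poly"
  assumes F: "F \<noteq> 0" and uw: "u * F + w * e = 1"
    and p: "deg_le p (k + int (degree F))"
    and k: "int (degree e) - 1 \<le> k" and m: "int (degree F) - 1 \<le> m"
  shows "\<exists>A B. p = F * A + e * B \<and> deg_le A k \<and> deg_le B m"
proof -
  define B where "B = (p * w) mod F"
  have dB: "deg_le B (int (degree F) - 1)"
    using degree_mod_less[OF F, of "p * w"] by (auto simp: B_def deg_le_def)
  define A where "A = p * u + e * ((p * w) div F)"
  have "F * A + e * B = p * (u * F) + e * ((p * w) div F * F + (p * w) mod F)"
    by (simp only: A_def B_def algebra_simps)
  also have "\<dots> = p * (u * F + w * e)" by (simp add: algebra_simps)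
  also have "\<dots> = p" by (simp add: uw)
  finally have eq: "p = F * A + e * B" by simp
  have "deg_le (e * B) (k + int (degree F))"
    using deg_le_mult[OF deg_le_degree dB, of e] k by (rule_tac deg_le_mono) auto
  then have "deg_le (p - e * B) (k + int (degree F))" by (rule deg_le_diff[OF p])
  then have "deg_le (F * A) (k + int (degree F))" using eq by simp
  then have "deg_le A k" using F by (cases "A = 0") (auto simp: deg_le_def degree_mult_eq)
  moreover have "deg_le B m" using dB m by (rule deg_le_mono)
  ultimately show ?thesis using eq by blast
qed

lemma neg_div_eq:
  fixes z m k :: int
  assumes "k dvd z" "k dvd m" "k > 0" "m > 0"
  shows "(- k - z) div m = - 1 - z div m"
proof -
  define r where "r = z mod m"
  have "k dvd r" using assms by (simp add: r_def dvd_mod)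
  then have "k dvd m - r" using assms by simp
  moreover have r: "0 \<le> r" "r < m" using assms by (simp_all add: r_def)
  ultimately have "k \<le> m - r" using zdvd_imp_le[of k "m - r"] by simp
  moreover have "z = m * (z div m) + r" by (simp add: r_def)
  ultimately show ?thesis
    using r assms by (intro int_div_pos_eq[of _ _ _ "m - k - r"]) (auto simp: algebra_simps)
qed

lemma le_div_iff:
  fixes i z m :: int assumes "m > 0" shows "i \<le> z div m \<longleftrightarrow> m * i \<le> z"
proof
  assume "i \<le> z div m"
  then have "m * i \<le> m * (z div m)" using assms by simp
  also have "\<dots> \<le> z" using pos_mod_sign[OF assms, of z] minus_mod_eq_mult_div[of z m] by linarith
  finally show "m * i \<le> z" .
next
  assume "m * i \<le> z"
  then have "(m * i) div m \<le> z div m" using assms by (intro zdiv_mono1)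
  then show "i \<le> z div m" using assms by simp
qed

section \<open>Counting lattice points\<close>

text \<open>
  Let \<open>r(j)\<close> be the residue for \<open>j\<close>.  Choosing \<open>t\<close> with \<open>d t \<equiv> k(2s + 1)\<close>, the involution
  \<open>j \<mapsto> t - j\<close> modulo \<open>n\<close> satisfies \<open>r(j) + r(t - j) \<equiv> -k\<close>; both residues are multiples of \<open>k\<close>
  between \<open>0\<close> and \<open>n - k\<close>, so their sum is \<open>n - k\<close>.
\<close>

lemma sum_residues:
  fixes n d :: nat and s :: int
  assumes n: "n > 0"
  defines "k \<equiv> int (gcd n d)"
  shows "2 * (\<Sum>j<n. (k * s - int d * int j) mod int n) = int n * (int n - k)"
proof -
  have k0: "k > 0" using n by (simp add: k_def)
  have kn: "k dvd int n" and kd: "k dvd int d" by (simp_all add: k_def)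
  obtain t0 :: int where t0: "[int d * t0 = k] (mod int n)"
    using cong_solve_int[of "int d" "int n"] by (auto simp: k_def gcd.commute)
  define t where "t = t0 * (2 * s + 1)"
  have "[int d * t0 * (2 * s + 1) = k * (2 * s + 1)] (mod int n)" using t0 by (rule cong_scalar_right)
  then have t: "[int d * t = k * (2 * s + 1)] (mod int n)" by (simp add: t_def mult.assoc)
  define r where "r = (\<lambda>j. (k * s - int d * j) mod int n)"
  \<comment> \<open>The involution \<open>j \<mapsto> t - j\<close> on the representatives \<open>0, \<dots>, n - 1\<close>.\<close>
  define \<tau> where "\<tau> = (\<lambda>j. nat ((t - int j) mod int n))"
  have tau: "int (\<tau> j) = (t - int j) mod int n" "\<tau> j < n" for j
    using n by (simp_all add: \<tau>_def nat_less_iff)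
  have invol: "\<tau> (\<tau> j) = j" if "j < n" for j
  proof -
    have "int (\<tau> (\<tau> j)) = (t - (t - int j)) mod int n" unfolding tau(1) by (simp add: mod_diff_right_eq)
    then show ?thesis using that by simp
  qed
  have pair: "r (int j) + r (int (\<tau> j)) = int n - k" for j
  proof -
    have dv: "k dvd r i" and lo: "0 \<le> r i" and hi: "r i < int n" for i
      using n kn kd by (auto simp: r_def dvd_mod)
    have up: "r i \<le> int n - k" for i
      using zdvd_imp_le[of k "int n - r i"] dv[of i] hi[of i] kn by simp
    have "[r (int j) + r (int (\<tau> j)) = (k * s - int d * int j) + (k * s - int d * (t - int j))] (mod int n)"
      unfolding r_def tau(1)
      by (intro cong_add) (auto simp: cong_def mod_diff_right_eq mod_mult_right_eq intro: mod_diff_cong)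
    also have "(k * s - int d * int j) + (k * s - int d * (t - int j)) = 2 * k * s - int d * t"
      by (simp add: algebra_simps)
    also have "[2 * k * s - int d * t = 2 * k * s - k * (2 * s + 1)] (mod int n)"
      using t by (intro cong_diff) auto
    also have "2 * k * s - k * (2 * s + 1) = - k" by (simp add: algebra_simps)
    finally have "[r (int j) + r (int (\<tau> j)) = - k] (mod int n)" .
    then have "int n dvd r (int j) + r (int (\<tau> j)) + k" by (simp add: cong_iff_dvd_diff)
    then obtain l where l: "r (int j) + r (int (\<tau> j)) + k = int n * l" by (rule dvdE)
    have "0 < int n * l" using l lo[of "int j"] lo[of "int (\<tau> j)"] k0 by linarith
    moreover have "int n * l < int n * 2" using l up[of "int j"] up[of "int (\<tau> j)"] k0 by linarith
    ultimately have "l = 1" using n by (simp add: zero_less_mult_iff)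
    then show ?thesis using l by simp
  qed
  have "(\<Sum>j<n. r (int j)) = (\<Sum>j<n. r (int (\<tau> j)))"
    by (rule sum.reindex_bij_witness[of _ \<tau> \<tau>]) (auto simp: invol tau)
  then have "2 * (\<Sum>j<n. r (int j)) = (\<Sum>j<n. r (int j) + r (int (\<tau> j)))" by (simp add: sum.distrib)
  also have "\<dots> = int n * (int n - k)" by (simp add: pair)
  finally show ?thesis by (simp add: r_def)
qed

text \<open>
  The number of lattice points \<open>(i, j)\<close> with \<open>0 \<le> j < n\<close> and \<open>0 \<le> i \<le> (ks - dj)/n\<close>, provided that no
  summand is negative.  Doubled, to stay within the integers.
\<close>

lemma sum_floors:
  fixes n d :: nat and s :: int
  assumes n: "n > 0"
  defines "k \<equiv> int (gcd n d)"
  shows "2 * (\<Sum>j<n. (k * s - int d * int j) div int n + 1) = 2 * k * s - int n * int d + int n + int d + k"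
proof -
  let ?z = "\<lambda>j. k * s - int d * int j"
  have gauss: "2 * (\<Sum>j<n. int j) = int n * (int n - 1)"
    by (induction n) (simp_all add: algebra_simps)
  have "int n * (2 * (\<Sum>j<n. ?z j div int n)) = 2 * (\<Sum>j<n. ?z j - ?z j mod int n)"
    by (simp add: sum_distrib_left minus_mod_eq_mult_div mult_ac)
  also have "\<dots> = 2 * (\<Sum>j<n. ?z j) - int n * (int n - k)"
    using sum_residues[OF n, of d s] by (simp add: sum_subtractf k_def)
  also have "2 * (\<Sum>j<n. ?z j) = 2 * int n * k * s - int d * (2 * (\<Sum>j<n. int j))"
    by (simp add: sum_subtractf sum_distrib_left algebra_simps)
  finally have "int n * (2 * (\<Sum>j<n. ?z j div int n)) = int n * (2 * k * s - int d * (int n - 1) - (int n - k))"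
    unfolding gauss by (simp add: algebra_simps)
  then have "2 * (\<Sum>j<n. ?z j div int n) = 2 * k * s - int d * (int n - 1) - (int n - k)"
    using n by simp
  then show ?thesis by (simp add: sum.distrib algebra_simps)
qed

section \<open>Dimension of a parametrised code\<close>

lemma sum_fun_apply: "(\<Sum>i\<in>I. g i) v = (\<Sum>i\<in>I. g i v)"
  for g :: "'i \<Rightarrow> 'b \<Rightarrow> 'c::comm_monoid_add"
  by (induction I rule: infinite_finite_induct) (auto simp: plus_fun_def zero_fun_def)

text \<open>
  The family \<open>b\<close> is injective by the independence assumption, so its image is a basis.
\<close>

lemma code_dim_parametrised:
  fixes b :: "'i \<Rightarrow> 'a::{field, finite} word"
  assumes I: "finite I"
    and ind: "\<And>k. (\<And>v. (\<Sum>i\<in>I. k i * b i v) = 0) \<Longrightarrow> \<forall>i\<in>I. k i = 0"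
  shows "code_dim (range (\<lambda>k v. \<Sum>i\<in>I. k i * b i v)) = card I"
proof -
  interpret V: vector_space "\<lambda>a (w :: 'a word) v. a * w v"
    by unfold_locales (auto simp: algebra_simps plus_fun_def)
  have inj: "inj_on b I"
  proof (rule inj_onI, rule ccontr)
    fix i j assume ij: "i \<in> I" "j \<in> I" "b i = b j" "i \<noteq> j"
    define k where "k = (\<lambda>l. if l = i then 1 else if l = j then -1 else (0 :: 'a))"
    have "(\<Sum>l\<in>I. k l * b l v) = 0" for v
    proof -
      have "(\<Sum>l\<in>I. k l * b l v) = (\<Sum>l\<in>{i, j}. k l * b l v)"
        using ij I by (intro sum.mono_neutral_right) (auto simp: k_def)
      then show ?thesis using ij by (simp add: k_def)
    qed
    then show False using ind[of k] ij by (auto simp: k_def)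
  qed
  define B where "B = b ` I"
  have comb: "(\<Sum>w\<in>B. (\<lambda>v. u w * w v)) = (\<lambda>v. \<Sum>i\<in>I. u (b i) * b i v)" for u
    unfolding B_def by (rule ext) (simp add: sum_fun_apply sum.reindex[OF inj] del: sum.reindex)
  have "\<not> V.dependent B"
  proof
    assume "V.dependent B"
    then obtain u where u: "\<exists>w\<in>B. u w \<noteq> 0" "(\<Sum>w\<in>B. (\<lambda>v. u w * w v)) = 0"
      using V.dependent_finite[of B] I by (auto simp: B_def)
    then have "(\<Sum>i\<in>I. u (b i) * b i v) = 0" for v
      unfolding comb by (simp add: fun_eq_iff)
    then have "\<forall>i\<in>I. u (b i) = 0" by (rule ind)
    then show False using u by (auto simp: B_def)
  qed
  moreover have "V.span B = range (\<lambda>k v. \<Sum>i\<in>I. k i * b i v)"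
  proof
    have "V.span B = range (\<lambda>u. \<Sum>w\<in>B. (\<lambda>v. u w * w v))"
      using V.span_finite[of B] I by (simp add: B_def)
    then show "V.span B \<subseteq> range (\<lambda>k v. \<Sum>i\<in>I. k i * b i v)"
      unfolding comb
    proof (elim ssubst, intro image_subsetI)
      fix u show "(\<lambda>v. \<Sum>i\<in>I. u (b i) * b i v) \<in> range (\<lambda>k v. \<Sum>i\<in>I. k i * b i v)"
        by (rule range_eqI[of _ _ "\<lambda>i. u (b i)"]) simp
    qed
    show "range (\<lambda>k v. \<Sum>i\<in>I. k i * b i v) \<subseteq> V.span B"
    proof
      fix w assume "w \<in> range (\<lambda>k v. \<Sum>i\<in>I. k i * b i v)"
      then obtain k where w: "w = (\<lambda>v. \<Sum>i\<in>I. k i * b i v)" by blast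
      have "w = (\<Sum>i\<in>I. (\<lambda>v. k i * b i v))" unfolding w by (rule ext) (simp add: sum_fun_apply)
      also have "\<dots> \<in> V.span B" by (intro V.span_sum V.span_scale V.span_base) (auto simp: B_def)
      finally show "w \<in> V.span B" .
    qed
  qed
  ultimately have "V.dim (range (\<lambda>k v. \<Sum>i\<in>I. k i * b i v)) = card B"
    using V.dim_span_eq_card_independent[of B] by simp
  then show ?thesis by (simp add: code_dim_def B_def card_image[OF inj])
qed

context superelliptic_curve
begin

section \<open>The hull\<close>

abbreviation \<delta> :: nat where "\<delta> \<equiv> delta n f"

text \<open>
  The degree up to which the component at \<open>y\<^sup>j\<close> of a function in \<open>L(sD\<^sub>\<infinity>)\<close> may grow; the division
  rounds down, and a negative bound forces the component to vanish.
\<close>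

definition degree_bound :: "int \<Rightarrow> nat \<Rightarrow> int" where
  "degree_bound s j = (int c * s - int d * int j) div int n"

lemma bounded_iff:
  "bounded s P \<longleftrightarrow> (\<forall>j. (j < n \<longrightarrow> deg_le (P j) (degree_bound s j)) \<and> (j \<ge> n \<longrightarrow> P j = 0))"
proof -
  have *: "int n * int i + int d * int j \<le> int c * s \<longleftrightarrow> int i \<le> degree_bound s j" for i j
    unfolding degree_bound_def using n_ge_2 by (subst le_div_iff) auto
  have "bounded s P \<longleftrightarrow> (\<forall>j i. coeff (P j) i \<noteq> 0 \<longrightarrow> j < n \<and> int i \<le> degree_bound s j)"
    unfolding bounded_def * by blast
  also have "\<dots> \<longleftrightarrow> (\<forall>j. (j < n \<longrightarrow> deg_le (P j) (degree_bound s j)) \<and> (j \<ge> n \<longrightarrow> P j = 0))"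
    unfolding deg_le_iff by (metis coeff_0 leading_coeff_0_iff not_le)
  finally show ?thesis .
qed

abbreviation M :: int where "M \<equiv> Mbound n f"

lemma c_times_M: "int c * (M + 1) = (int CARD('a) - 1) * int n"
proof -
  have "(int CARD('a) - 1) * int n = ((int CARD('a) - 1) * int (n div c)) * int c"
    using int_n_eq by (metis mult.assoc)
  then have "(int CARD('a) - 1) * int n div int c * int c = (int CARD('a) - 1) * int n"
    by simp
  then show ?thesis by (simp add: Mbound_def ninf_eq mult.commute)
qed

text \<open>The conjugate component: \<open>y\<^sup>j\<close> pairs non-trivially only with \<open>y\<^sup>k\<close> for \<open>n \<mid> j + k\<close>.\<close>

definition dual_index :: "nat \<Rightarrow> nat" where
  "dual_index j = (if j = 0 then 0 else n - j)"

definition dual_factor :: "nat \<Rightarrow> 'a poly" where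
  "dual_factor j = (if j = 0 then 1 else f)"

lemma dual_index_less: "j < n \<Longrightarrow> dual_index j < n"
  using n_ge_2 by (simp add: dual_index_def)

lemma dual_index_dual_index: "j < n \<Longrightarrow> dual_index (dual_index j) = j"
  by (simp add: dual_index_def)

lemma dual_factor_neq_0: "dual_factor j \<noteq> 0"
  by (simp add: dual_factor_def f_neq_0)

text \<open>
  This is the duality \<open>s \<leftrightarrow> M - s\<close> on the level of components: the three degrees add up to the largest
  degree \<open>q - 2\<close> for which the sum of a polynomial over \<open>\<F>\<^sub>q\<close> is certain to vanish.
\<close>

lemma degree_bound_dual:
  assumes j: "j < n"
  shows "degree_bound (M - s) j + degree_bound s (dual_index j) + int (degree (dual_factor j)) = int CARD('a) - 2"
proof -
  define D where "D = int (degree (dual_factor j))"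
  define z where "z = int c * s - int d * int (dual_index j)"
  have D: "int d * int (dual_index j) = int n * D - int d * int j"
    using j degree_f by (simp add: D_def dual_index_def dual_factor_def of_nat_diff algebra_simps)
  have n0: "int n > 0" using n_ge_2 by simp
  have "int c * (M - s) - int d * int j = (int CARD('a) - 1 - D) * int n + (- int c - z)"
    using c_times_M D by (simp add: z_def algebra_simps)
  then have "degree_bound (M - s) j = (int CARD('a) - 1 - D) + (- int c - z) div int n"
    using n0 by (simp add: degree_bound_def)
  also have "(- int c - z) div int n = - 1 - z div int n"
    by (rule neg_div_eq) (use n_ge_2 in \<open>auto simp: z_def\<close>)
  finally show ?thesis by (simp add: degree_bound_def z_def D_def)
qed

lemma degree_bound_nu: "degree_bound (nu n f s) j = degree_bound (mu n f s) j - int \<delta>"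
proof -
  have "int c * nu n f s = int c * mu n f s - int n * int \<delta>"
    unfolding nu_eq using int_n_eq by (metis mult.assoc mult.commute right_diff_distrib)
  then have "int c * nu n f s - int d * int j = (int c * mu n f s - int d * int j) + (- int \<delta>) * int n"
    by (simp add: algebra_simps)
  then have "degree_bound (nu n f s) j
      = ((int c * mu n f s - int d * int j) + (- int \<delta>) * int n) div int n"
    by (simp only: degree_bound_def)
  also have "\<dots> = - int \<delta> + (int c * mu n f s - int d * int j) div int n"
    using n_ge_2 by (intro div_mult_self1) simp
  finally show ?thesis by (simp add: degree_bound_def)
qed

lemma degree_bound_mono: "s \<le> s' \<Longrightarrow> degree_bound s j \<le> degree_bound s' j"
  unfolding degree_bound_def using n_ge_2 by (intro zdiv_mono1) (auto intro: mult_left_mono)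

lemma degree_bound_mu: "degree_bound (mu n f s) j = min (degree_bound s j) (degree_bound (M - s) j)"
  using degree_bound_mono[of s "M - s" j] degree_bound_mono[of "M - s" s j]
  by (auto simp: mu_def min_def)

lemma genus_exact: "2 * genus n f = (int n - 1) * (int d - 1) + 1 - int c"
proof -
  have "even ((int n - 1) * (int d - 1) + 1 - int c)"
  proof (cases "even n \<and> even d")
    case True
    then have "even c" by simp
    then show ?thesis using True by simp
  next
    case False
    then have "odd c" by auto
    then show ?thesis using False by auto
  qed
  then show ?thesis by (simp add: genus_def degree_f ninf_eq)
qed

lemma genus_pos: "genus n f \<ge> 1"
proof -
  have cn: "int c \<le> int n" using n_ge_2 by (simp add: gcd_le1_nat)
  have "int c \<le> int n" using cn .
  also have "\<dots> \<le> (int n - 1) * 2" using n_ge_2 by simp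
  also have "\<dots> \<le> (int n - 1) * (int d - 1)"
    using n_ge_2 d_ge_3 by (intro mult_left_mono) auto
  finally have "int c \<le> (int n - 1) * (int d - 1)" .
  then have "2 * genus n f > 0" unfolding genus_exact by linarith
  then show ?thesis by simp
qed

text \<open>
  In the window \<open>c \<mu>(s) > 2g - 2 + n\<delta>\<close>.  Both sides are multiples of \<open>c\<close>, so they differ by at least
  \<open>c\<close>, and \<open>2g - 2 + c = nd - n - d\<close>.
\<close>

lemma window_bound:
  assumes "tnum n f s < 0"
  shows "int n * int \<delta> + int n * int d - int n - int d \<le> int c * mu n f s"
proof -
  let ?z = "int c * mu n f s - (int n * int \<delta> + int n * int d - int n - int d)"
  have "2 * genus n f = int n * int d - int n - int d + 2 - int c"
    unfolding genus_exact by (simp add: algebra_simps)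
  then have "?z > - int c" using assms by (simp add: tnum_def ninf_eq)
  moreover have "int c dvd ?z" by (intro dvd_diff dvd_add) (auto intro: dvd_mult2)
  then obtain k where k: "?z = int c * k" by (rule dvdE)
  ultimately have "int c * (k + 1) > 0" by (simp add: algebra_simps)
  then have "k \<ge> 0" using c_pos by (simp add: zero_less_mult_iff)
  then have "?z \<ge> 0" using k by simp
  then show ?thesis by simp
qed

lemma window_degree_bound:
  assumes t: "tnum n f s < 0" and j: "j < n"
  shows "int \<delta> - 1 \<le> degree_bound (mu n f s) j"
proof -
  have "int d * int j \<le> int d * (int n - 1)" using j by (intro mult_left_mono) auto
  then have "int n * (int \<delta> - 1) \<le> int c * mu n f s - int d * int j"
    using window_bound[OF t] by (simp add: algebra_simps)
  then show ?thesis unfolding degree_bound_def using n_ge_2 by (subst le_div_iff) auto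
qed

lemma e_poly_bezout: "\<exists>u w. u * dual_factor j + w * e_poly = 1"
  unfolding e_poly_def using f_no_root
  by (intro linear_factors_bezout) (auto simp: dual_factor_def)

text \<open>
  The factor \<open>e\<^sub>\<Delta>\<close> extends the sum to the whole field.
\<close>

lemma sum_outside_Delta:
  assumes "deg_le p (int CARD('a) - 2 - int \<delta>)"
  shows "(\<Sum>a\<in>UNIV - \<Delta>. poly e_poly a * poly p a) = 0"
proof -
  have "(\<Sum>a\<in>UNIV - \<Delta>. poly e_poly a * poly p a) = (\<Sum>a\<in>UNIV. poly (e_poly * p) a)"
    by (intro sum.mono_neutral_cong_left) (auto simp: poly_e_poly_eq_0)
  also have "\<dots> = 0"
  proof (cases "p = 0")
    case False
    have "degree (e_poly * p) = \<delta> + degree p"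
      using False e_poly_neq_0 by (simp add: degree_mult_eq degree_e_poly)
    then have "int (degree (e_poly * p)) \<le> int CARD('a) - 2"
      using assms False by (simp add: deg_le_def)
    then have deg: "degree (e_poly * p) < CARD('a) - 1" by linarith
    then show ?thesis using sum_poly_eq[of "e_poly * p"] coeff_eq_0[OF deg] by simp
  qed simp
  finally show ?thesis .
qed

text \<open>
  Interpolate \<open>g/e\<^sub>\<Delta>\<close> outside \<open>\<Delta>\<close> by a polynomial \<open>r\<close> of degree below \<open>q - \<delta>\<close>.  If its degree were too
  large, \<open>i\<close> could be chosen so that \<open>e\<^sub>\<Delta> r x\<^sup>i\<close> has degree exactly \<open>q - 1\<close>; the sum of its values is
  minus the leading coefficient, but it vanishes by orthogonality.
\<close>

lemma evaluation_dual:
  assumes orth: "\<And>i. int i \<le> T \<Longrightarrow> (\<Sum>a\<in>UNIV - \<Delta>. g a * a ^ i) = 0"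
  shows "\<exists>r. (\<forall>a\<in>UNIV - \<Delta>. g a = poly e_poly a * poly r a) \<and> deg_le r (int CARD('a) - 2 - int \<delta> - T)"
proof -
  obtain r where r: "r = 0 \<or> degree r < card (UNIV - \<Delta>)"
      "\<forall>a\<in>UNIV - \<Delta>. poly r a = g a / poly e_poly a"
    using interpolation[of "UNIV - \<Delta>" "\<lambda>a. g a / poly e_poly a"] by auto
  have card: "card (UNIV - \<Delta>) = CARD('a) - \<delta>" by (simp add: delta_def card_Diff_subset)
  have gr: "\<forall>a\<in>UNIV - \<Delta>. g a = poly e_poly a * poly r a"
    using r(2) by (auto simp: poly_e_poly_eq_0)
  have "deg_le r (int CARD('a) - 2 - int \<delta> - T)"
  proof (rule ccontr)
    assume "\<not> deg_le r (int CARD('a) - 2 - int \<delta> - T)"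
    then have r0: "r \<noteq> 0" and big: "int (degree r) > int CARD('a) - 2 - int \<delta> - T" by (auto simp: deg_le_def)
    have dr: "degree r + \<delta> < CARD('a)" using r r0 card by auto
    define i where "i = CARD('a) - 1 - \<delta> - degree r"
    have "int i \<le> T" using big dr by (simp add: i_def)
    from orth[OF this] have "(\<Sum>a\<in>UNIV - \<Delta>. poly (e_poly * r * monom 1 i) a) = 0"
      using gr by (simp add: poly_monom)
    moreover have "(\<Sum>a\<in>UNIV - \<Delta>. poly (e_poly * r * monom 1 i) a) = (\<Sum>a\<in>UNIV. poly (e_poly * r * monom 1 i) a)"
      by (intro sum.mono_neutral_left) (auto simp: poly_e_poly_eq_0)
    moreover have deg: "degree (e_poly * r * monom 1 i) = CARD('a) - 1"
      using e_poly_neq_0 r0 dr by (simp add: degree_mult_eq degree_monom_eq degree_e_poly i_def)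
    ultimately have "coeff (e_poly * r * monom 1 i) (CARD('a) - 1) = 0"
      using sum_poly_eq[of "e_poly * r * monom 1 i"] by simp
    then have "e_poly * r * monom 1 i = 0" using deg by (metis leading_coeff_0_iff)
    then show False using e_poly_neq_0 r0 by simp
  qed
  then show ?thesis using gr by blast
qed

subsection \<open>The bilinear form\<close>

text \<open>
  The points over \<open>a\<close> form an orbit of the \<open>n\<close>-th roots of unity, so only exponents divisible by \<open>n\<close>
  contribute; for \<open>j, k < n\<close> these are \<open>0\<close> and \<open>n\<close>.
\<close>

lemma fiber_power_sum:
  assumes a: "a \<notin> \<Delta>" and jk: "j < n" "k < n"
  shows "(\<Sum>b\<in>{b. b ^ n = poly f a}. b ^ (j + k))
    = (if k = dual_index j then of_nat n * poly (dual_factor j) a else 0)"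
proof -
  obtain b0 where b0: "b0 ^ n = poly f a" using a Delta_iff by blast
  then have b00: "b0 \<noteq> 0" using f_no_root[of a] n_ge_2 by (auto simp: power_0_left)
  have "(\<Sum>b\<in>{b. b ^ n = poly f a}. b ^ (j + k)) = (\<Sum>z\<in>{z. z ^ n = 1}. (z * b0) ^ (j + k))"
    by (rule sum.reindex_bij_witness[of _ "\<lambda>z. z * b0" "\<lambda>b. b / b0"])
      (use b0 b00 in \<open>auto simp: power_mult_distrib power_divide f_no_root\<close>)
  also have "\<dots> = b0 ^ (j + k) * (\<Sum>z\<in>{z. z ^ n = 1}. z ^ (j + k))"
    by (simp add: power_mult_distrib sum_distrib_left mult.commute)
  also have "\<dots> = (if k = dual_index j then of_nat n * poly (dual_factor j) a else 0)"
  proof (cases "k = dual_index j")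
    case True
    then have jk_eq: "j + k = (if j = 0 then 0 else n)" using jk by (auto simp: dual_index_def)
    then have 1: "(\<Sum>z\<in>{z::'a. z ^ n = 1}. z ^ (j + k)) = of_nat n"
      using card_roots_of_unity[OF n_dvd] n_ge_2 by auto
    have 2: "b0 ^ (j + k) = poly (dual_factor j) a" using b0 by (simp add: jk_eq dual_factor_def)
    show ?thesis unfolding 1 2 using True by (simp add: mult.commute)
  next
    case False
    define l where "l = dual_index k"
    have l: "l < n" "l \<noteq> j" using False jk dual_index_less dual_index_dual_index by (auto simp: l_def)
    have "z ^ (j + k) = z ^ j * inverse z ^ l" if "z ^ n = 1" for z :: 'a
    proof -
      have "z \<noteq> 0" using that n_ge_2 by (auto simp: power_0_left)
      moreover have "z ^ k * z ^ l = 1"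
        using jk that by (simp add: l_def dual_index_def flip: power_add)
      ultimately show ?thesis by (simp add: power_add power_inverse field_simps)
    qed
    then have "(\<Sum>z\<in>{z::'a. z ^ n = 1}. z ^ (j + k)) = (\<Sum>z\<in>{z. z ^ n = 1}. z ^ j * inverse z ^ l)"
      by (intro sum.cong) auto
    also have "\<dots> = 0" using roots_of_unity_sum[of j l] jk l by auto
    finally show ?thesis using False by simp
  qed
  finally show ?thesis .
qed

theorem word_product:
  "(\<Sum>v\<in>affine_points n f. word P v * word R v)
    = of_nat n * (\<Sum>j<n. \<Sum>a\<in>UNIV - \<Delta>. poly (P j) a * poly (R (dual_index j)) a * poly (dual_factor j) a)"
proof -
  have "(\<Sum>v\<in>affine_points n f. word P v * word R v) = (\<Sum>p\<in>point_pairs. eval_family P p * eval_family R p)"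
    unfolding sum.reindex_bij_betw[OF bij_place_of, symmetric]
    by (intro sum.cong) (auto simp: word_place_of)
  also have "\<dots> = (\<Sum>a\<in>UNIV - \<Delta>. \<Sum>b\<in>{b. b ^ n = poly f a}. eval_family P (a, b) * eval_family R (a, b))"
    unfolding point_pairs_Sigma by (subst sum.Sigma) (auto simp: split_def)
  also have "\<dots> = (\<Sum>a\<in>UNIV - \<Delta>. \<Sum>j<n. of_nat n * (poly (P j) a * poly (R (dual_index j)) a * poly (dual_factor j) a))"
  proof (intro sum.cong refl)
    fix a assume a: "a \<in> UNIV - \<Delta>"
    let ?B = "{b. b ^ n = poly f a}"
    have "(\<Sum>b\<in>?B. eval_family P (a, b) * eval_family R (a, b))
        = (\<Sum>b\<in>?B. \<Sum>j<n. \<Sum>k<n. poly (P j) a * poly (R k) a * b ^ (j + k))"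
      by (simp add: eval_family_def sum_product power_add mult_ac)
    also have "\<dots> = (\<Sum>j<n. \<Sum>k<n. poly (P j) a * poly (R k) a * (\<Sum>b\<in>?B. b ^ (j + k)))"
      by (subst sum.swap, intro sum.cong refl, subst sum.swap) (simp add: sum_distrib_left)
    also have "\<dots> = (\<Sum>j<n. \<Sum>k<n. if k = dual_index j then
        of_nat n * (poly (P j) a * poly (R (dual_index j)) a * poly (dual_factor j) a) else 0)"
      using a by (intro sum.cong refl) (auto simp: fiber_power_sum mult_ac)
    also have "\<dots> = (\<Sum>j<n. of_nat n * (poly (P j) a * poly (R (dual_index j)) a * poly (dual_factor j) a))"
      by (intro sum.cong refl) (simp add: dual_index_less)
    finally show "(\<Sum>b\<in>?B. eval_family P (a, b) * eval_family R (a, b)) = \<dots>" .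
  qed
  finally show ?thesis by (subst (asm) sum.swap) (simp add: sum_distrib_left)
qed

lemma word_cong:
  assumes "\<And>j a. j < n \<Longrightarrow> a \<notin> \<Delta> \<Longrightarrow> poly (P j) a = poly (R j) a"
  shows "word P = word R"
proof (rule word_eqI)
  show "word P (place_of p) = eval_family R p" if p: "p \<in> point_pairs" for p
  proof -
    obtain a b where ab: "p = (a, b)" by (cases p)
    then have "a \<notin> \<Delta>" using p Delta_iff by (auto simp: point_pairs_def)
    then show ?thesis unfolding word_place_of[OF p] using assms by (simp add: ab eval_family_def)
  qed
qed (rule word_outside)

lemma superelliptic_code_eq: "superelliptic_code n f s = word ` {P. bounded s P}"
  by (simp add: superelliptic_code_def code_eq)

text \<open>
  In the notation of the proof, \<open>p\<close> is orthogonal to \<open>F A\<close> for \<open>deg A \<le> k\<close> by assumption, and to \<open>e\<^sub>\<Delta> B\<close> for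
  \<open>deg B \<le> m\<close> because \<open>deg (p e\<^sub>\<Delta> B) \<le> q - 2\<close>.  The window inequality for \<open>\<mu> \<le> s\<close> gives
  \<open>\<delta> - 1 \<le> k\<close>, and for \<open>\<mu> \<le> M - s\<close> it gives \<open>deg F - 1 \<le> m\<close>, so every polynomial of degree at most \<open>T\<close>
  is a sum \<open>F A + e\<^sub>\<Delta> B\<close> of this kind.  Hence \<open>p\<close> agrees outside \<open>\<Delta>\<close> with \<open>e\<^sub>\<Delta> r\<close>, where the degree
  of \<open>r\<close> is bounded by the smaller of the bounds for \<open>s\<close> and \<open>M - s\<close>, reduced by \<open>\<delta>\<close>.
\<close>

lemma hull_component:
  assumes t: "tnum n f s < 0" and j: "j < n"
    and p: "deg_le p (degree_bound s j)"
    and orth: "\<And>i. int i \<le> degree_bound s (dual_index j) \<Longrightarrow>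
      (\<Sum>a\<in>UNIV - \<Delta>. poly p a * poly (dual_factor j) a * a ^ i) = 0"
  shows "\<exists>r. (\<forall>a\<in>UNIV - \<Delta>. poly p a = poly e_poly a * poly r a) \<and> deg_le r (degree_bound (nu n f s) j)"
proof -
  define F where "F = dual_factor j"
  define k where "k = degree_bound s (dual_index j)"
  define m where "m = int CARD('a) - 2 - int \<delta> - degree_bound s j"
  define T where "T = max (k + int (degree F)) (m + int \<delta>)"
  have dual: "degree_bound (M - s) j + k + int (degree F) = int CARD('a) - 2"
    using degree_bound_dual[OF j, of s] by (simp add: k_def F_def)
  have dual': "degree_bound (M - s) (dual_index j) + degree_bound s j + int (degree F) = int CARD('a) - 2"
    using degree_bound_dual[OF dual_index_less[OF j], of s] j
    by (simp add: dual_index_dual_index F_def dual_factor_def dual_index_def split: if_splits)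
  have mu: "int \<delta> - 1 \<le> degree_bound (mu n f s) l" if "l < n" for l
    using window_degree_bound[OF t that] .
  have k_ge: "int (degree e_poly) - 1 \<le> k"
    using mu[OF dual_index_less[OF j]] by (simp add: degree_e_poly degree_bound_mu k_def)
  have m_ge: "int (degree F) - 1 \<le> m"
    using mu[OF dual_index_less[OF j]] dual' by (simp add: degree_bound_mu m_def)
  obtain u w where uw: "u * F + w * e_poly = 1" using e_poly_bezout F_def by blast
  have F_orth: "(\<Sum>a\<in>UNIV - \<Delta>. poly p a * poly (F * A) a) = 0" if A: "deg_le A k" for A
  proof -
    have "(\<Sum>a\<in>UNIV - \<Delta>. poly p a * poly (F * A) a)
        = (\<Sum>a\<in>UNIV - \<Delta>. \<Sum>i\<le>degree A. coeff A i * (poly p a * poly F a * a ^ i))"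
      unfolding poly_mult poly_altdef[of A] by (intro sum.cong refl) (simp add: sum_distrib_left mult_ac)
    also have "\<dots> = (\<Sum>i\<le>degree A. coeff A i * (\<Sum>a\<in>UNIV - \<Delta>. poly p a * poly F a * a ^ i))"
      by (subst sum.swap) (simp add: sum_distrib_left)
    also have "\<dots> = 0"
    proof (intro sum.neutral ballI)
      fix i
      show "coeff A i * (\<Sum>a\<in>UNIV - \<Delta>. poly p a * poly F a * a ^ i) = 0"
      proof (cases "coeff A i = 0")
        case False
        then have "int i \<le> k" using A by (simp add: deg_le_iff)
        then show ?thesis using orth by (simp add: k_def F_def)
      qed simp
    qed
    finally show ?thesis .
  qed
  have e_orth: "(\<Sum>a\<in>UNIV - \<Delta>. poly p a * poly (e_poly * B) a) = 0" if B: "deg_le B m" for B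
  proof -
    have "deg_le (p * B) (int CARD('a) - 2 - int \<delta>)"
      by (rule deg_le_mono[OF deg_le_mult[OF p B]]) (simp add: m_def)
    from sum_outside_Delta[OF this] show ?thesis by (simp add: mult_ac)
  qed
  have "(\<Sum>a\<in>UNIV - \<Delta>. poly p a * a ^ i) = 0" if i: "int i \<le> T" for i
  proof -
    have "\<exists>A B. monom 1 i = F * A + e_poly * B \<and> deg_le A k \<and> deg_le B m"
    proof (cases "int i \<le> k + int (degree F)")
      case True
      then have "deg_le (monom (1::'a) i) (k + int (degree F))" by (simp add: deg_le_def degree_monom_eq)
      then show ?thesis
        using bounded_bezout[OF _ uw _ k_ge m_ge] dual_factor_neq_0 by (simp add: F_def)
    next
      case False
      then have "int i \<le> m + int (degree e_poly)" using i by (simp add: T_def degree_e_poly)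
      then have "deg_le (monom (1::'a) i) (m + int (degree e_poly))" by (simp add: deg_le_def degree_monom_eq)
      moreover have "w * e_poly + u * F = 1" using uw by (simp add: add.commute)
      ultimately obtain A B where "monom 1 i = e_poly * A + F * B" "deg_le A m" "deg_le B k"
        using bounded_bezout[OF e_poly_neq_0 _ _ m_ge k_ge] by blast
      then show ?thesis by (metis add.commute)
    qed
    then obtain A B where AB: "monom 1 i = F * A + e_poly * B" "deg_le A k" "deg_le B m" by blast
    have "(\<Sum>a\<in>UNIV - \<Delta>. poly p a * a ^ i) = (\<Sum>a\<in>UNIV - \<Delta>. poly p a * poly (monom 1 i) a)"
      by (simp add: poly_monom)
    also have "\<dots> = (\<Sum>a\<in>UNIV - \<Delta>. poly p a * poly (F * A) a) + (\<Sum>a\<in>UNIV - \<Delta>. poly p a * poly (e_poly * B) a)"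
      unfolding AB(1) poly_add distrib_left sum.distrib ..
    also have "\<dots> = 0" using F_orth[OF AB(2)] e_orth[OF AB(3)] by simp
    finally show ?thesis .
  qed
  from evaluation_dual[OF this]
  obtain r where r: "\<forall>a\<in>UNIV - \<Delta>. poly p a = poly e_poly a * poly r a"
      "deg_le r (int CARD('a) - 2 - int \<delta> - T)" by blast
  have "int CARD('a) - 2 - int \<delta> - T = degree_bound (nu n f s) j"
    using dual by (auto simp: T_def m_def degree_bound_nu degree_bound_mu)
  then show ?thesis using r by auto
qed

text \<open>
  One inclusion is \<open>hull_component\<close> applied to each component.  For the other, the products
  \<open>e\<^sub>\<Delta> R\<^sub>j Q\<^sub>k F\<close> that occur in the form have degree at most \<open>q - 2\<close> by \<open>degree_bound_dual\<close>.
\<close>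

theorem hull_eq:
  assumes t: "tnum n f s < 0"
  shows "code_hull n f (superelliptic_code n f s) = (\<lambda>R. word (\<lambda>j. e_poly * R j)) ` {R. bounded (nu n f s) R}"
proof (intro equalityI subsetI)
  fix w assume "w \<in> code_hull n f (superelliptic_code n f s)"
  then obtain P where P: "bounded s P" "w = word P"
    and orth: "\<And>Q. bounded s Q \<Longrightarrow> (\<Sum>v\<in>affine_points n f. word Q v * word P v) = 0"
    unfolding code_hull_def dual_code_def superelliptic_code_eq by auto
  have "\<exists>r. (\<forall>a\<in>UNIV - \<Delta>. poly (P j) a = poly e_poly a * poly r a) \<and> deg_le r (degree_bound (nu n f s) j)"
    if j: "j < n" for j
  proof (rule hull_component[OF t j])
    show "deg_le (P j) (degree_bound s j)" using P(1) j by (simp add: bounded_iff)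
    fix i assume i: "int i \<le> degree_bound s (dual_index j)"
    define Q where "Q = (\<lambda>l. if l = dual_index j then monom (1::'a) i else 0)"
    have "bounded s Q" unfolding bounded_iff
      using i dual_index_less[OF j] by (auto simp: Q_def deg_le_def degree_monom_eq)
    from orth[OF this] have "(\<Sum>v\<in>affine_points n f. word P v * word Q v) = 0"
      by (simp add: mult.commute)
    then have 0: "(\<Sum>l<n. \<Sum>a\<in>UNIV - \<Delta>. poly (P l) a * poly (Q (dual_index l)) a * poly (dual_factor l) a) = 0"
      unfolding word_product using of_nat_n_neq_0 by simp
    have "(\<Sum>l<n. \<Sum>a\<in>UNIV - \<Delta>. poly (P l) a * poly (Q (dual_index l)) a * poly (dual_factor l) a)
        = (\<Sum>l<n. if l = j then (\<Sum>a\<in>UNIV - \<Delta>. poly (P j) a * poly (dual_factor j) a * a ^ i) else 0)"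
    proof (intro sum.cong refl)
      fix l assume l: "l \<in> {..<n}"
      have "dual_index l = dual_index j \<longleftrightarrow> l = j" using l j dual_index_dual_index by (metis lessThan_iff)
      then show "(\<Sum>a\<in>UNIV - \<Delta>. poly (P l) a * poly (Q (dual_index l)) a * poly (dual_factor l) a)
          = (if l = j then (\<Sum>a\<in>UNIV - \<Delta>. poly (P j) a * poly (dual_factor j) a * a ^ i) else 0)"
        by (auto simp: Q_def poly_monom mult_ac)
    qed
    then show "(\<Sum>a\<in>UNIV - \<Delta>. poly (P j) a * poly (dual_factor j) a * a ^ i) = 0" using 0 j by simp
  qed
  then obtain r where r: "\<And>j a. j < n \<Longrightarrow> a \<in> UNIV - \<Delta> \<Longrightarrow> poly (P j) a = poly e_poly a * poly (r j) a"
      "\<And>j. j < n \<Longrightarrow> deg_le (r j) (degree_bound (nu n f s) j)" by metis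
  define R where "R = (\<lambda>j. if j < n then r j else 0)"
  have "bounded (nu n f s) R" using r(2) by (simp add: bounded_iff R_def)
  moreover have "w = word (\<lambda>j. e_poly * R j)"
    unfolding P(2) by (rule word_cong) (use r(1) in \<open>simp add: R_def\<close>)
  ultimately show "w \<in> (\<lambda>R. word (\<lambda>j. e_poly * R j)) ` {R. bounded (nu n f s) R}" by blast
next
  fix w assume "w \<in> (\<lambda>R. word (\<lambda>j. e_poly * R j)) ` {R. bounded (nu n f s) R}"
  then obtain R where R: "bounded (nu n f s) R" and w: "w = word (\<lambda>j. e_poly * R j)" by blast
  have Rd: "deg_le (R j) (degree_bound (mu n f s) j - int \<delta>)" if "j < n" for j
    using R that by (simp add: bounded_iff degree_bound_nu)
  have "bounded s (\<lambda>j. e_poly * R j)"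
    unfolding bounded_iff
  proof (intro allI conjI impI)
    fix j assume j: "j < n"
    have "deg_le (e_poly * R j) (int \<delta> + (degree_bound (mu n f s) j - int \<delta>))"
      using deg_le_mult[OF deg_le_degree Rd[OF j], of e_poly] by (simp add: degree_e_poly)
    then show "deg_le (e_poly * R j) (degree_bound s j)"
      by (rule deg_le_mono) (simp add: degree_bound_mu)
  next
    fix j assume "n \<le> j"
    then show "e_poly * R j = 0" using R by (simp add: bounded_iff)
  qed
  moreover have "(\<Sum>v\<in>affine_points n f. word Q v * w v) = 0" if Q: "bounded s Q" for Q
  proof -
    have "(\<Sum>a\<in>UNIV - \<Delta>. poly (e_poly * R j) a * poly (Q (dual_index j)) a * poly (dual_factor j) a) = 0"
      if j: "j < n" for j
    proof -
      have "deg_le (Q (dual_index j)) (degree_bound s (dual_index j))"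
        using Q dual_index_less[OF j] by (simp add: bounded_iff)
      then have "deg_le (R j * (Q (dual_index j) * dual_factor j))
          ((degree_bound (mu n f s) j - int \<delta>) + (degree_bound s (dual_index j) + int (degree (dual_factor j))))"
        by (intro deg_le_mult Rd[OF j] deg_le_degree)
      then have "deg_le (R j * (Q (dual_index j) * dual_factor j)) (int CARD('a) - 2 - int \<delta>)"
        by (rule deg_le_mono) (use degree_bound_dual[OF j, of s] in \<open>simp add: degree_bound_mu\<close>)
      from sum_outside_Delta[OF this] show ?thesis by (simp add: mult_ac)
    qed
    then have "(\<Sum>v\<in>affine_points n f. w v * word Q v) = 0"
      unfolding w word_product by simp
    then show ?thesis by (simp add: mult.commute)
  qed
  moreover have "w v = 0" if "v \<notin> affine_points n f" for v using that by (simp add: w word_outside)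
  ultimately show "w \<in> code_hull n f (superelliptic_code n f s)"
    unfolding code_hull_def dual_code_def superelliptic_code_eq w by auto
qed

subsection \<open>Dimension of the hull\<close>

definition monomials :: "int \<Rightarrow> (nat \<times> nat) set" where
  "monomials s = {(j, i). j < n \<and> int i \<le> degree_bound s j}"

lemma monomials_Sigma: "monomials s = (SIGMA j : {..<n}. {i. int i \<le> degree_bound s j})"
  by (auto simp: monomials_def)

lemma card_nat_le: "card {i::nat. int i \<le> k} = nat (k + 1)" "finite {i::nat. int i \<le> k}"
proof -
  have "{i::nat. int i \<le> k} = {..<nat (k + 1)}" by (auto simp: zless_nat_eq_int_zless)
  then show "card {i::nat. int i \<le> k} = nat (k + 1)" "finite {i::nat. int i \<le> k}" by simp_all
qed

lemma finite_monomials: "finite (monomials s)"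
  unfolding monomials_Sigma using card_nat_le(2) by (intro finite_SigmaI) auto

text \<open>
  In the window the degree bounds for \<open>\<nu>(s)\<close> are at least \<open>-1\<close>, so each component contributes exactly
  its bound plus one.
\<close>

lemma card_monomials_nu:
  assumes t: "tnum n f s < 0"
  shows "int (card (monomials (nu n f s))) = int c * nu n f s + 1 - genus n f"
proof -
  have ge: "degree_bound (nu n f s) j + 1 \<ge> 0" if "j < n" for j
    using window_degree_bound[OF t that] by (simp add: degree_bound_nu)
  have "card (monomials (nu n f s)) = (\<Sum>j<n. nat (degree_bound (nu n f s) j + 1))"
    unfolding monomials_Sigma by (subst card_SigmaI) (auto simp: card_nat_le)
  then have "int (card (monomials (nu n f s))) = (\<Sum>j<n. degree_bound (nu n f s) j + 1)"
    using ge by simp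
  then have "2 * int (card (monomials (nu n f s))) = 2 * (int c * nu n f s + 1 - genus n f)"
    using sum_floors[of n d "nu n f s"] n_ge_2 genus_exact
    by (simp add: degree_bound_def algebra_simps)
  then show ?thesis by simp
qed

definition family_of :: "int \<Rightarrow> (nat \<times> nat \<Rightarrow> 'a) \<Rightarrow> nat \<Rightarrow> 'a poly" where
  "family_of s k j = (\<Sum>i\<in>{i. (j, i) \<in> monomials s}. monom (k (j, i)) i)"

lemma finite_monomials_fiber: "finite {i. (j, i) \<in> monomials s}"
  using finite_subset[OF _ card_nat_le(2), of _ "degree_bound s j"] by (auto simp: monomials_def)

lemma coeff_family_of: "coeff (family_of s k j) i = (if (j, i) \<in> monomials s then k (j, i) else 0)"
  using finite_monomials_fiber by (simp add: family_of_def coeff_sum coeff_monom sum.delta')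

lemma bounded_eq_range: "{P. bounded s P} = range (family_of s)"
proof (intro equalityI subsetI)
  fix P assume "P \<in> {P. bounded s P}"
  then have P: "coeff (P j) i \<noteq> 0 \<Longrightarrow> (j, i) \<in> monomials s" for i j
    by (cases "j < n") (auto simp: bounded_iff monomials_def deg_le_iff)
  have "P = family_of s (\<lambda>(j, i). coeff (P j) i)"
    using P by (intro ext poly_eqI) (auto simp: coeff_family_of)
  then show "P \<in> range (family_of s)" by blast
next
  fix P assume "P \<in> range (family_of s)"
  then show "P \<in> {P. bounded s P}"
    by (auto simp: bounded_iff deg_le_iff coeff_family_of monomials_def intro!: poly_eqI split: if_splits)
qed

text \<open>
  The word of \<open>e\<^sub>\<Delta> x\<^sup>i y\<^sup>j\<close>.
\<close>

definition hull_basis :: "nat \<times> nat \<Rightarrow> 'a word" where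
  "hull_basis = (\<lambda>(j, i). word (\<lambda>l. if l = j then e_poly * monom 1 i else 0))"

lemma hull_basis_place_of:
  assumes p: "(a, b) \<in> point_pairs" and j: "j < n"
  shows "hull_basis (j, i) (place_of (a, b)) = poly e_poly a * a ^ i * b ^ j"
proof -
  have "hull_basis (j, i) (place_of (a, b))
      = (\<Sum>l<n. if l = j then poly e_poly a * a ^ i * b ^ j else 0)"
    unfolding hull_basis_def prod.case word_place_of[OF p] eval_family_def
    by (intro sum.cong refl) (simp add: poly_monom)
  then show ?thesis using j by simp
qed

lemma word_family_of:
  "word (\<lambda>j. e_poly * family_of s k j) = (\<lambda>v. \<Sum>p\<in>monomials s. k p * hull_basis p v)"
proof (rule word_eqI[symmetric])
  show "(\<Sum>p\<in>monomials s. k p * hull_basis p v) = 0" if "v \<notin> affine_points n f" for v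
    using that by (intro sum.neutral) (auto simp: hull_basis_def word_outside)
  fix p assume p: "p \<in> point_pairs"
  obtain a b where ab: "p = (a, b)" by (cases p)
  have "eval_family (\<lambda>j. e_poly * family_of s k j) p
      = (\<Sum>j<n. \<Sum>i\<in>{i. (j, i) \<in> monomials s}. k (j, i) * (poly e_poly a * a ^ i * b ^ j))"
    unfolding ab eval_family_e_poly unfolding eval_family_def prod.case sum_distrib_left
    by (intro sum.cong refl)
      (simp add: family_of_def poly_sum poly_monom sum_distrib_left sum_distrib_right mult_ac)
  also have "\<dots> = (\<Sum>p\<in>(SIGMA j : {..<n}. {i. (j, i) \<in> monomials s}).
      case p of (j, i) \<Rightarrow> k (j, i) * (poly e_poly a * a ^ i * b ^ j))"
    using finite_monomials_fiber by (subst sum.Sigma) auto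
  also have "(SIGMA j : {..<n}. {i. (j, i) \<in> monomials s}) = monomials s"
    by (auto simp: monomials_def)
  also have "(\<Sum>p\<in>monomials s. case p of (j, i) \<Rightarrow> k (j, i) * (poly e_poly a * a ^ i * b ^ j))
      = (\<Sum>p\<in>monomials s. k p * hull_basis p (place_of (a, b)))"
    using p ab by (intro sum.cong refl) (auto simp: hull_basis_place_of monomials_def)
  finally show "(\<Sum>p'\<in>monomials s. k p' * hull_basis p' (place_of p)) = eval_family (\<lambda>j. e_poly * family_of s k j) p"
    by (simp add: ab)
qed

text \<open>
  As \<open>2 \<mu>(s) \<le> M\<close>, the degrees for \<open>\<mu>(s)\<close> stay below \<open>q/2\<close>.
\<close>

lemma degree_bound_nu_less:
  assumes "j < n" shows "degree_bound (nu n f s) j < int CARD('a) - int \<delta>"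
proof -
  have "2 * mu n f s \<le> M" by (auto simp: mu_def min_def)
  then have "int c * (2 * mu n f s) \<le> int c * M" by (intro mult_left_mono) auto
  also have "\<dots> < int CARD('a) * int n" using c_times_M c_pos n_ge_2 by (simp add: algebra_simps)
  finally have A: "2 * (int c * mu n f s) < int CARD('a) * int n" by simp
  have "\<not> int CARD('a) \<le> degree_bound (mu n f s) j"
  proof
    assume "int CARD('a) \<le> degree_bound (mu n f s) j"
    then have "int n * int CARD('a) \<le> int c * mu n f s - int d * int j"
      unfolding degree_bound_def using n_ge_2 by (subst (asm) le_div_iff) auto
    moreover have "0 \<le> int d * int j" "0 \<le> int n * int CARD('a)" by simp_all
    moreover have "int CARD('a) * int n = int n * int CARD('a)" by simp
    ultimately show False using A by linarith
  qed
  then show ?thesis by (simp add: degree_bound_nu)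
qed

text \<open>
  For fixed \<open>a\<close> the values at the \<open>n\<close> points over \<open>a\<close> determine the \<open>n\<close> numbers \<open>P\<^sub>j(a)\<close>; each \<open>P\<^sub>j\<close> thus
  has \<open>q - \<delta>\<close> roots, more than its degree.
\<close>

lemma word_e_poly_injective:
  assumes P: "bounded (nu n f s) P" and 0: "word (\<lambda>j. e_poly * P j) = (\<lambda>v. 0)"
  shows "P j = 0"
proof (cases "j < n")
  case False
  then show ?thesis using P by (simp add: bounded_iff)
next
  case j: True
  have root: "poly (P j) a = 0" if a: "a \<notin> \<Delta>" for a
  proof -
    define Q where "Q = (\<Sum>l<n. monom (poly (P l) a) l)"
    have "poly Q b = 0" if b: "b ^ n = poly f a" for b
    proof -
      have "eval_family (\<lambda>j. e_poly * P j) (a, b) = 0"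
        using word_place_of[of "(a, b)" "\<lambda>j. e_poly * P j"] 0 b by (simp add: point_pairs_def)
      then have "eval_family P (a, b) = 0"
        using a by (simp add: eval_family_e_poly poly_e_poly_eq_0)
      then show ?thesis by (simp add: Q_def eval_family_def poly_sum poly_monom)
    qed
    then have sub: "{b. b ^ n = poly f a} \<subseteq> {b. poly Q b = 0}" by auto
    have "Q = 0"
    proof (rule ccontr)
      assume Q0: "Q \<noteq> 0"
      have "n \<le> card {b. poly Q b = 0}"
        using card_mono[OF poly_roots_finite[OF Q0] sub] card_fiber[OF a] by simp
      also have "\<dots> \<le> degree Q" by (rule card_poly_roots_bound[OF Q0])
      also have "\<dots> \<le> n - 1" unfolding Q_def
        by (intro degree_sum_le) (auto intro: order.trans[OF degree_monom_le])
      finally show False using n_ge_2 by simp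
    qed
    then have "coeff Q j = 0" by simp
    then show ?thesis using j by (simp add: Q_def coeff_sum coeff_monom)
  qed
  show ?thesis
  proof (rule ccontr)
    assume P0: "P j \<noteq> 0"
    have "CARD('a) - \<delta> = card (UNIV - \<Delta>)" by (simp add: delta_def card_Diff_subset)
    also have "\<dots> \<le> card {a. poly (P j) a = 0}"
      using root by (intro card_mono poly_roots_finite P0) auto
    also have "\<dots> \<le> degree (P j)" by (rule card_poly_roots_bound[OF P0])
    finally have "int CARD('a) - int \<delta> \<le> int (degree (P j))" by linarith
    moreover have "int (degree (P j)) \<le> degree_bound (nu n f s) j"
    proof -
      have "deg_le (P j) (degree_bound (nu n f s) j)" using P j by (simp add: bounded_iff)
      then show ?thesis using P0 by (simp add: deg_le_def)
    qed
    ultimately show False using degree_bound_nu_less[OF j, of s] by simp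
  qed
qed

theorem hull_dimension:
  assumes t: "tnum n f s < 0"
  shows "hull_dim n f s = int c * nu n f s + 1 - genus n f"
proof -
  let ?s = "nu n f s"
  have "code_hull n f (superelliptic_code n f s) = range (\<lambda>k v. \<Sum>p\<in>monomials ?s. k p * hull_basis p v)"
    unfolding hull_eq[OF t] bounded_eq_range word_family_of[symmetric] by (simp add: image_image)
  moreover have "code_dim (range (\<lambda>k v. \<Sum>p\<in>monomials ?s. k p * hull_basis p v)) = card (monomials ?s)"
  proof (rule code_dim_parametrised[OF finite_monomials])
    fix k assume "\<And>v. (\<Sum>p\<in>monomials ?s. k p * hull_basis p v) = 0"
    then have "word (\<lambda>j. e_poly * family_of ?s k j) = (\<lambda>v. 0)" unfolding word_family_of by simp
    moreover have "bounded ?s (family_of ?s k)" using bounded_eq_range by blast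
    ultimately have "family_of ?s k j = 0" for j using word_e_poly_injective by blast
    then have 0: "coeff (family_of ?s k j) i = 0" for j i by simp
    show "\<forall>p\<in>monomials ?s. k p = 0"
    proof
      fix p assume p: "p \<in> monomials ?s"
      obtain j i where "p = (j, i)" by (cases p)
      then show "k p = 0" using 0[of j i] p by (simp add: coeff_family_of)
    qed
  qed
  ultimately show ?thesis using card_monomials_nu[OF t] by simp
qed

subsection \<open>The window\<close>

lemma mu_le: "2 * mu n f s \<le> M"
  by (auto simp: mu_def min_def)

lemma mu_half: "mu n f (M div 2) = M div 2"
  by (simp add: mu_def min_def)

text \<open>
  The window is described by \<open>\<mu>\<close> alone, and \<open>\<mu>\<close> is largest at \<open>\<lfloor>M/2\<rfloor>\<close>; so if the window is not empty
  it contains that point.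
\<close>

lemma half_in_window:
  assumes s: "s \<in> window n f"
  shows "M div 2 \<in> window n f" "mu n f s \<le> M div 2"
proof -
  show le: "mu n f s \<le> M div 2" using mu_le[of s] by simp
  have t: "tnum n f s < 0" using s by (simp add: window_def)
  have "int c * mu n f s \<le> int c * (M div 2)" using le by (intro mult_left_mono) auto
  then have "tnum n f (M div 2) < 0" using t by (simp add: tnum_def ninf_eq mu_half)
  moreover have "int c * mu n f s > 0"
  proof -
    have "int n * int \<delta> \<ge> 0" by simp
    then show ?thesis using t genus_pos unfolding tnum_def ninf_eq by linarith
  qed
  then have "mu n f s > 0" by (simp add: zero_less_mult_iff)
  ultimately show "M div 2 \<in> window n f" using le by (simp add: window_def)
qed

lemma hull_dimension_mu:
  assumes s: "s \<in> window n f"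
  shows "hull_dim n f s = int c * mu n f s - int n * int \<delta> + 1 - genus n f"
proof -
  have "int c * nu n f s = int c * mu n f s - int n * int \<delta>"
    unfolding nu_eq using int_n_eq by (metis mult.assoc mult.commute right_diff_distrib)
  then show ?thesis using hull_dimension s by (simp add: window_def)
qed

lemma hull_dimension_ge:
  assumes s: "s \<in> window n f" shows "hull_dim n f s \<ge> genus n f"
proof -
  have "tnum n f s < 0" using s by (simp add: window_def)
  then show ?thesis using hull_dimension_mu[OF s] by (simp add: tnum_def ninf_eq)
qed

lemma code_dim_zero: "code_dim {\<lambda>v. 0 :: 'a} = 0"
  using code_dim_parametrised[of "{}" "\<lambda>_::unit. \<lambda>_. 0 :: 'a"] by (simp add: image_constant_conv)

lemma superelliptic_code_not_LCD:
  assumes s: "s \<in> window n f" shows "\<not> is_LCD n f (superelliptic_code n f s)"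
  using hull_dimension_ge[OF s] genus_pos by (auto simp: is_LCD_def code_dim_zero)

end

theorem corollary4p12:
  fixes f :: "'a::{field, finite} poly" and n d :: nat and s :: int
  assumes "superelliptic n d f"
    and "s \<in> window n f"
  shows
    "code_hull n f (superelliptic_code n f s)
       = C_L n f (\<lambda>v. mu n f s * div_inf n f v - div_E n f v)
     \<and> (\<forall>v\<in>affine_points n f. value_at v (e_Delta n f) \<noteq> 0)
     \<and> bij_betw (\<lambda>w v. value_at v (e_Delta n f) * w v)
         (C_L n f (\<lambda>v. nu n f s * div_inf n f v))
         (C_L n f (\<lambda>v. mu n f s * div_inf n f v - div_E n f v))
     \<and> hull_dim n f s = ninf n f * nu n f s + 1 - genus n f
     \<and> hull_dim n f s
         = ninf n f * mu n f s - int n * int (delta n f) + 1 - genus n f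
     \<and> hull_dim n f s \<ge> genus n f
     \<and> genus n f \<ge> 1
     \<and> \<not> is_LCD n f (superelliptic_code n f s)
     \<and> (\<exists>b. \<forall>r\<in>window n f. real_of_int r \<le> real_of_int (Mbound n f) / 2 \<longrightarrow>
          hull_dim n f r = ninf n f * r + b)
     \<and> (\<exists>b. \<forall>r\<in>window n f. real_of_int r \<ge> real_of_int (Mbound n f) / 2 \<longrightarrow>
          hull_dim n f r = - ninf n f * r + b)
     \<and> (\<exists>r\<in>window n f. hull_dim n f r
          = ninf n f * \<lfloor>real_of_int (Mbound n f) / 2\<rfloor> - int n * int (delta n f) + 1 - genus n f)
     \<and> (\<forall>r\<in>window n f. hull_dim n f r
          \<le> ninf n f * \<lfloor>real_of_int (Mbound n f) / 2\<rfloor> - int n * int (delta n f) + 1 - genus n f)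
     \<and> num_points n f = n * (CARD('a) - delta n f)
     \<and> (\<forall>f' :: 'a poly. superelliptic n d f' \<longrightarrow>
          delta n f' = delta n f \<or> num_points n f' = num_points n f \<longrightarrow>
          s \<in> window n f' \<and> hull_dim n f' s = hull_dim n f s)"
proof -
  interpret superelliptic_curve n d f by unfold_locales (rule assms(1))
  note s = assms(2)
  have t: "tnum n f s < 0" using s by (simp add: window_def)
  have hull: "code_hull n f (superelliptic_code n f s)
      = C_L n f (\<lambda>v. mu n f s * div_inf n f v - div_E n f v)"
    unfolding hull_eq[OF t] code_minus_E_eq ..
  have half: "\<lfloor>real_of_int (Mbound n f) / 2\<rfloor> = Mbound n f div 2"
    using floor_divide_of_int_eq[of "Mbound n f" 2] by simp
  have lower: "\<exists>b. \<forall>r\<in>window n f. real_of_int r \<le> real_of_int (Mbound n f) / 2 \<longrightarrow>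
      hull_dim n f r = ninf n f * r + b"
  proof (intro exI ballI impI)
    fix r assume r: "r \<in> window n f" "real_of_int r \<le> real_of_int (Mbound n f) / 2"
    then have "mu n f r = r" by (simp add: mu_def min_def)
    then show "hull_dim n f r = ninf n f * r + (1 - genus n f - int n * int (delta n f))"
      unfolding hull_dimension_mu[OF r(1)] by (simp add: ninf_eq)
  qed
  have upper: "\<exists>b. \<forall>r\<in>window n f. real_of_int r \<ge> real_of_int (Mbound n f) / 2 \<longrightarrow>
      hull_dim n f r = - ninf n f * r + b"
  proof (intro exI ballI impI)
    fix r assume r: "r \<in> window n f" "real_of_int r \<ge> real_of_int (Mbound n f) / 2"
    then have "mu n f r = Mbound n f - r" by (simp add: mu_def min_def)
    then show "hull_dim n f r = - ninf n f * r
        + (ninf n f * Mbound n f + 1 - genus n f - int n * int (delta n f))"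
      unfolding hull_dimension_mu[OF r(1)] by (simp add: ninf_eq right_diff_distrib)
  qed
  have attained: "\<exists>r\<in>window n f. hull_dim n f r
      = ninf n f * \<lfloor>real_of_int (Mbound n f) / 2\<rfloor> - int n * int (delta n f) + 1 - genus n f"
    using half_in_window(1)[OF s] hull_dimension_mu[OF half_in_window(1)[OF s]]
    unfolding half by (intro bexI[of _ "Mbound n f div 2"]) (simp_all add: mu_half ninf_eq)
  have maximal: "\<forall>r\<in>window n f. hull_dim n f r
      \<le> ninf n f * \<lfloor>real_of_int (Mbound n f) / 2\<rfloor> - int n * int (delta n f) + 1 - genus n f"
  proof
    fix r assume r: "r \<in> window n f"
    have "int (gcd n d) * mu n f r \<le> int (gcd n d) * (Mbound n f div 2)"
      using half_in_window(2)[OF r] by (intro mult_left_mono) auto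
    then show "hull_dim n f r
        \<le> ninf n f * \<lfloor>real_of_int (Mbound n f) / 2\<rfloor> - int n * int (delta n f) + 1 - genus n f"
      unfolding half hull_dimension_mu[OF r] by (simp add: ninf_eq)
  qed
  have invariance: "s \<in> window n f' \<and> hull_dim n f' s = hull_dim n f s"
    if f': "superelliptic n d f'"
      and eq: "delta n f' = delta n f \<or> num_points n f' = num_points n f" for f' :: "'a poly"
  proof -
    interpret other: superelliptic_curve n d f' by unfold_locales (rule f')
    \<comment> \<open>The number of points determines \<open>\<delta>\<close> as \<open>\<delta> \<le> q\<close>, so the subtraction of naturals is exact.\<close>
    have delta: "delta n f' = delta n f"
    proof (rule disjE[OF eq])
      assume "num_points n f' = num_points n f"
      then have "n * (CARD('a) - delta n f') = n * (CARD('a) - delta n f)"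
        by (simp only: num_points_eq other.num_points_eq)
      then show ?thesis using n_ge_2 delta_le other.delta_le by simp
    qed
    have deg: "degree f' = degree f" using degree_f other.degree_f by simp
    then have num: "ninf n f' = ninf n f" "genus n f' = genus n f" "Mbound n f' = Mbound n f"
      "mu n f' s = mu n f s"
      by (simp_all add: ninf_def genus_def Mbound_def mu_def)
    then have "s \<in> window n f'" using s by (simp add: window_def tnum_def delta)
    then show ?thesis
      using other.hull_dimension_mu hull_dimension_mu[OF s] num delta by simp
  qed
  have nonzero: "\<forall>v\<in>affine_points n f. value_at v (e_Delta n f) \<noteq> 0"
    using value_at_e_Delta_neq_0 by blast
  have dim_nu: "hull_dim n f s = ninf n f * nu n f s + 1 - genus n f"
    using hull_dimension[OF t] by (simp only: ninf_eq)
  have dim_mu: "hull_dim n f s = ninf n f * mu n f s - int n * int (delta n f) + 1 - genus n f"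
    using hull_dimension_mu[OF s] by (simp only: ninf_eq)
  have all_curves: "\<forall>f' :: 'a poly. superelliptic n d f' \<longrightarrow>
      delta n f' = delta n f \<or> num_points n f' = num_points n f \<longrightarrow>
      s \<in> window n f' \<and> hull_dim n f' s = hull_dim n f s"
    using invariance by blast
  show ?thesis
    by (intro conjI hull nonzero monomial_equivalence dim_nu dim_mu hull_dimension_ge[OF s] genus_pos
        superelliptic_code_not_LCD[OF s] lower upper attained maximal num_points_eq all_curves)
qed

end
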